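(* Let $1<p<\infty$, $0<q<p$ and $\alpha=\frac1q-\frac1p$. There exists a constant $C>0$ such that, for all $C^\infty$ functions $b\in\Lambda_\alpha(\mathbb T)$ and $f\in\mathcal H^p(\mathbb T)$, $$\|\widetilde{\mathcal H}(b,f)\|_{\mathcal H^p(\mathbb T)}\le C\,\|f\|_{\mathcal H^q(\mathbb T)}\,\|b\|_{\Lambda_\alpha(\mathbb T)},$$ where $$\widetilde{\mathcal H}(b,f)(x)=\int_{\mathbb T}\bigl(b(x+t)-b(2x)\bigr)f(2t)\,\frac{dt}{\tan\frac{x-t}{2}} .$$
   Context: Here $\mathbb T=\mathbb R/2\pi\mathbb Z$, and functions on $\mathbb T$ are $2\pi$-periodic and complex valued. For $r>0$, $\mathcal H^r(\mathbb T)$ is the real Hardy space of the torus: the space of distributions $f$ on $\mathbb T$ whose Poisson maximal function $f^*(x)=\sup_{0\le\rho<1}|P_\rho*f(x)|$ lies in $L^r(\mathbb T)$, with (quasi-)norm $\|f\|_{\mathcal H^r}=\|f^*\|_{L^r}$ (any of the standard equivalent quasi-norms may be used); for $1<r<\infty$ it coincides with $L^r(\mathbb T)$ with equivalent norms. For $\alpha>0$, $\Lambda_\alpha(\mathbb T)$ is the usual Lipschitz (Hölder–Zygmund) space of order $\alpha$: with $k$ the smallest integer $>\alpha$ and $\Delta_h g(x)=g(x+h)-g(x)$, it consists of the continuous $b$ with $$\|b\|_{\Lambda_\alpha}=\|b\|_\infty+\sup_{h\ne0}|h|^{-\alpha}\|\Delta_h^k b\|_\infty<\infty$$ (up to equivalence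 of norms). *)

theory Defs
  imports "HOL-Analysis.Analysis" "HOL-Library.Periodic_Fun"
begin

text \<open>
  Functions on the torus are functions on the real line satisfying
  \<^term>\<open>periodic_fun_simple f (2 * pi)\<close>, and integrals over the torus are taken over one period,
  \<^term>\<open>{-pi..pi}\<close>. All (quasi-)norms take values in the extended nonnegative reals, so that an
  infinite norm is really infinite and not a default value.
\<close>

definition smooth :: "(real \<Rightarrow> complex) \<Rightarrow> bool" where
  "smooth g \<longleftrightarrow> (\<forall>n. ((\<lambda>u x. vector_derivative u (at x)) ^^ n) g differentiable_on UNIV)"

text \<open>Power of an extended nonnegative real, for exponents \<open>a > 0\<close> only.\<close>

definition ennreal_powr :: "ennreal \<Rightarrow> real \<Rightarrow> ennreal" where
  "ennreal_powr x a = (if x = \<infinity> then \<infinity> else ennreal (enn2real x powr a))"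

text \<open>
  The kernel below is the closed form of \<open>\<Sum>n. \<rho>^|n| exp(i n x)\<close> (sum over the integers), and
  the convolution is with respect to the normalised measure \<open>dt / (2 pi)\<close>.
\<close>

definition poisson_kernel :: "real \<Rightarrow> real \<Rightarrow> real" where
  "poisson_kernel \<rho> x = (1 - \<rho>\<^sup>2) / (1 - 2 * \<rho> * cos x + \<rho>\<^sup>2)"

definition poisson_integral :: "real \<Rightarrow> (real \<Rightarrow> complex) \<Rightarrow> real \<Rightarrow> complex" where
  "poisson_integral \<rho> f x =
     (LINT t:{-pi..pi}|lebesgue. complex_of_real (poisson_kernel \<rho> (x - t)) * f t) /
     complex_of_real (2 * pi)"

definition poisson_maximal :: "(real \<Rightarrow> complex) \<Rightarrow> real \<Rightarrow> ennreal" where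
  "poisson_maximal f x = (SUP \<rho>\<in>{0..<1}. ennreal (norm (poisson_integral \<rho> f x)))"

definition hardy_norm :: "real \<Rightarrow> (real \<Rightarrow> complex) \<Rightarrow> ennreal" where
  "hardy_norm r f =
     ennreal_powr
       (\<integral>\<^sup>+ x\<in>{-pi..pi}. ennreal_powr (poisson_maximal f x) r \<partial>lebesgue) (1 / r)"

text \<open>
  The elements of the Hardy space that are given by integrable functions. For \<open>r \<ge> 1\<close>, in
  particular for \<open>r > 1\<close> where the Hardy space coincides with \<open>L\<^sup>r\<close>, this is the whole Hardy space;
  for \<open>r < 1\<close> the Hardy space also contains distributions which are not functions. The quasi-norm
  above is meaningful on integrable functions for every \<open>r > 0\<close>.
\<close>

definition hardy_space :: "real \<Rightarrow> (real \<Rightarrow> complex) set" where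
  "hardy_space r =
     {f. periodic_fun_simple f (2 * pi) \<and> f absolutely_integrable_on {-pi..pi} \<and>
         hardy_norm r f < \<infinity>}"

definition fwd_diff :: "real \<Rightarrow> (real \<Rightarrow> complex) \<Rightarrow> real \<Rightarrow> complex" where
  "fwd_diff h g x = g (x + h) - g x"

definition sup_norm :: "(real \<Rightarrow> complex) \<Rightarrow> ennreal" where
  "sup_norm g = (SUP x. ennreal (norm (g x)))"

definition lipschitz_norm :: "real \<Rightarrow> (real \<Rightarrow> complex) \<Rightarrow> ennreal" where
  "lipschitz_norm \<alpha> b =
     (let k = (LEAST k::nat. \<alpha> < real k)
      in sup_norm b +
         (SUP h\<in>-{0}. ennreal (\<bar>h\<bar> powr (-\<alpha>)) * sup_norm ((fwd_diff h ^^ k) b)))"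

definition lipschitz_space :: "real \<Rightarrow> (real \<Rightarrow> complex) set" where
  "lipschitz_space \<alpha> =
     {b. periodic_fun_simple b (2 * pi) \<and> continuous_on UNIV b \<and> lipschitz_norm \<alpha> b < \<infinity>}"

text \<open>
  For smooth \<open>b\<close> and integrable \<open>f\<close> the integral converges absolutely: the factor in \<open>b\<close> cancels
  the singularity at \<open>t = x\<close>. Where the tangent has its pole, its value in the library is \<open>0\<close> and
  so is the quotient, which is the correct value of the cotangent there.
\<close>

definition hankel_tilde :: "(real \<Rightarrow> complex) \<Rightarrow> (real \<Rightarrow> complex) \<Rightarrow> real \<Rightarrow> complex" where
  "hankel_tilde b f x =
     (LINT t:{-pi..pi}|lebesgue.
        (b (x + t) - b (2 * x)) * f (2 * t) / complex_of_real (tan ((x - t) / 2)))"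

end

theory Submission
  imports Defs
begin

text \<open>
  Let \<open>F t = f (2 * t)\<close>, and write \<open>P \<tau>\<close> for the Poisson integral of radius \<open>exp (-\<tau>)\<close>; these operators form a
  semigroup. The operator of the theorem maps \<open>F\<close> to the integral of \<open>F\<close> against the kernel
  \<open>(b (x + t) - b (2 * x)) * cot ((x - t) / 2)\<close>.

  For \<open>b x = exp (i n x)\<close> this kernel is a homogeneous polynomial of degree \<open>2 n\<close> in \<open>exp (i x)\<close> and \<open>exp (i t)\<close>. Therefore
  replacing \<open>b\<close> by \<open>P (2 * \<tau>) b\<close> has the same effect as applying \<open>P \<tau>\<close> both to the input and to the output
  (\<open>hankel_pois\<close>). A function \<open>b\<close> of Lipschitz order \<open>\<alpha>\<close> is a sum of pieces \<open>P (3 * \<eta>) c\<close>, one for each dyadic scale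
  \<open>\<eta> = 1 / 2 ^ j\<close>, with \<open>c\<close> of size \<open>\<eta> powr \<alpha>\<close> (\<open>lipschitz_decomposition\<close>). So the piece of scale \<open>\<eta>\<close> acts only on
  \<open>u = P \<eta> F\<close>, with a kernel of size \<open>\<eta> powr \<alpha> * min (1 / \<eta>) (1 / s)\<close> at distance \<open>s\<close>: the values of \<open>F\<close>
  itself, which a Hardy quasi-norm of order below one does not control, no longer enter.

  Let \<open>A\<close> be the quasi-norm of \<open>f\<close> in the Hardy space of order \<open>q\<close>. The functions \<open>u\<close> have two bounds: the maximal function
  \<open>h\<close>, whose \<open>L\<^sup>q\<close> norm is at most \<open>A\<close>, and a multiple of \<open>A * \<eta> powr (-1/q)\<close> (\<open>poisson_sup_bound\<close>). Summing over the
  scales gives a geometric series on both sides of the scale where the two bounds meet (\<open>dyadic_sum_bound\<close>), and the output at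
  \<open>x\<close> is at most a multiple of \<open>A\<close> times the integral of \<open>H powr (1/p + \<gamma>) * s powr (\<gamma> - 1)\<close>, for each of two small
  exponents \<open>\<gamma>\<close> and with the density \<open>H = (h / A) powr q\<close> of mass at most one. These powers of \<open>s\<close> are stable under Poisson
  averages (\<open>poisson_chord_powr\<close>), so the Poisson maximal function of the output has the same bound.

  It remains to estimate such an integral in \<open>L\<^sup>p\<close>. Splitting according to whether \<open>H\<close> exceeds a level \<open>l\<close> and whether \<open>s\<close>
  exceeds \<open>1 / l\<close> bounds it by \<open>l powr (1/p) + l powr (1/p - 1) * Q x\<close>, where \<open>Q\<close> does not depend on \<open>l\<close> and
  \<open>\<integral>Q\<close> is at most a multiple of \<open>\<integral>H\<close>; with \<open>l = Q x\<close> the \<open>p\<close>-th power is at most a multiple of \<open>Q x\<close>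
  (\<open>Phi_power_le_Psi\<close>, \<open>Psi_integral\<close>).
\<close>

section \<open>Integration over one period\<close>
text \<open>
  The Lebesgue measure on one period, as a measure of its own, so that product measures and
  dominated convergence apply without indicator functions.
\<close>
definition circ :: "real measure" where
  "circ = restrict_space lebesgue {-pi..pi}"

lemma space_circ [simp]: "space circ = {-pi..pi}"
  by (simp add: circ_def space_restrict_space)

lemma emeasure_circ: "emeasure circ (space circ) = ennreal (2 * pi)"
  unfolding circ_def by (subst emeasure_restrict_space) (auto simp: space_restrict_space)

interpretation circ: finite_measure circ
  by (rule finite_measureI) (simp only: emeasure_circ, simp)

interpretation circ_pair: pair_sigma_finite circ circ ..

lemma measure_circ [simp]: "measure circ {-pi..pi} = 2 * pi"
  using emeasure_circ by (simp add: measure_def)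

lemma borel_measurable_circ:
  assumes "f \<in> borel_measurable borel" shows "f \<in> borel_measurable circ"
  using assms unfolding circ_def
  by (intro measurable_restrict_space1 measurable_completion) simp

lemma borel_fst_circ [measurable]: "fst \<in> borel_measurable (circ \<Otimes>\<^sub>M circ)"
  and borel_snd_circ [measurable]: "snd \<in> borel_measurable (circ \<Otimes>\<^sub>M circ)"
  using measurable_compose[OF measurable_fst borel_measurable_circ[of "\<lambda>x. x"]]
    measurable_compose[OF measurable_snd borel_measurable_circ[of "\<lambda>x. x"]] by auto

lemma set_integral_circ:
  fixes f :: "real \<Rightarrow> 'a::{banach,second_countable_topology}"
  shows "(LINT t:{-pi..pi}|lebesgue. f t) = (\<integral>t. f t \<partial>circ)"
  unfolding circ_def set_lebesgue_integral_def by (subst integral_restrict_space) auto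

lemma nn_set_integral_circ: "(\<integral>\<^sup>+t\<in>{-pi..pi}. f t \<partial>lebesgue) = (\<integral>\<^sup>+t. f t \<partial>circ)"
  unfolding circ_def by (subst nn_integral_restrict_space) auto

lemma integrable_circ_iff:
  fixes f :: "real \<Rightarrow> 'a::euclidean_space"
  shows "f absolutely_integrable_on {-pi..pi} \<longleftrightarrow> integrable circ f"
  unfolding circ_def set_integrable_def by (subst integrable_restrict_space) auto

lemma nn_integral_circ_lborel:
  assumes [measurable]: "g \<in> borel_measurable borel"
  shows "(\<integral>\<^sup>+x. g x \<partial>circ) = (\<integral>\<^sup>+x. g x * indicator {-pi..<pi} x \<partial>lborel)"
proof -
  have "(\<integral>\<^sup>+x. g x \<partial>circ) = (\<integral>\<^sup>+x. g x * indicator {-pi..pi} x \<partial>lborel)"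
    unfolding circ_def by (subst nn_integral_restrict_space) (auto simp: nn_integral_completion)
  also have "\<dots> = (\<integral>\<^sup>+x. g x * indicator {-pi..<pi} x \<partial>lborel)"
    by (intro nn_integral_cong_AE, use AE_lborel_singleton[of pi] in eventually_elim)
       (auto split: split_indicator)
  finally show ?thesis .
qed

lemma periodic_int:
  fixes g :: "real \<Rightarrow> 'a"
  assumes "\<And>x. g (x + 2 * pi) = g x"
  shows "g (x + of_int n * (2 * pi)) = g x"
proof -
  interpret periodic_fun_simple g "2 * pi" by standard (rule assms)
  show ?thesis by (rule plus_of_int)
qed

lemma reduce_period:
  fixes a :: real
  obtains n :: int and r where "a = r + of_int n * (2 * pi)" "0 \<le> r" "r < 2 * pi"
proof -
  let ?n = "\<lfloor>a / (2*pi)\<rfloor>"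
  have "of_int ?n \<le> a / (2*pi)" "a / (2*pi) < of_int ?n + 1" by linarith+
  then have "of_int ?n * (2*pi) \<le> a" "a < (of_int ?n + 1) * (2*pi)"
    using pos_le_divide_eq[of "2*pi" "of_int ?n" a] pos_divide_less_eq[of "2*pi" a "of_int ?n + 1"] by auto
  then show ?thesis
    by (intro that[of "a - of_int ?n * (2*pi)" ?n]) (simp_all add: algebra_simps)
qed

text \<open>
  Writing the left end as \<open>r - pi + n * 2 pi\<close> with \<open>0 \<le> r < 2 pi\<close>, the window \<open>{r - pi..r + pi}\<close> differs
  from \<open>{-pi..pi}\<close> by moving the piece \<open>{-pi..r - pi}\<close> one period to the right.
\<close>
lemma has_integral_period:
  fixes g :: "real \<Rightarrow> 'a::euclidean_space"
  assumes per: "\<And>x. g (x + 2 * pi) = g x" and I: "(g has_integral I) {-pi..pi}"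
  shows "(g has_integral I) {a..a + 2 * pi}"
proof -
  have tr: "(g has_integral J) {u + of_int n * (2*pi)..v + of_int n * (2*pi)}"
    if "(g has_integral J) {u..v}" for J u v and n :: int
  proof -
    have "((\<lambda>x. g (x + (- of_int n * (2*pi)))) has_integral J) {u + of_int n * (2*pi)..v + of_int n * (2*pi)}"
      using has_integral_affinity'[of g J u v 1 "- of_int n * (2*pi)"] that
      by (simp add: algebra_simps)
    then show ?thesis using periodic_int[of g _ "-n", OF per] by simp
  qed
  obtain n :: int and r where r: "a + pi = r + of_int n * (2 * pi)" "0 \<le> r" "r < 2 * pi"
    by (rule reduce_period)
  have ig: "g integrable_on {-pi..pi}" using I by blast
  have 1: "(g has_integral integral {-pi..r-pi} g) {-pi..r-pi}"
    and 2: "(g has_integral integral {r-pi..pi} g) {r-pi..pi}"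
    using r by (auto intro!: integrable_integral integrable_subinterval_real[OF ig])
  have "(g has_integral (integral {r-pi..pi} g + integral {-pi..r-pi} g)) {r-pi..(r-pi) + 2*pi}"
    using r 2 tr[OF 1, of 1] by (intro has_integral_combine[of _ pi]) (auto simp: algebra_simps)
  moreover have "(g has_integral (integral {-pi..r-pi} g + integral {r-pi..pi} g)) {-pi..pi}"
    using r 1 2 by (intro has_integral_combine[of _ "r-pi"]) auto
  ultimately have "(g has_integral I) {r-pi..(r-pi) + 2*pi}"
    using I by (metis add.commute has_integral_unique)
  moreover have "r - pi + of_int n * (2*pi) = a" "r - pi + 2*pi + of_int n * (2*pi) = a + 2*pi"
    using r by linarith+
  ultimately show ?thesis using tr[of I "r-pi" "r-pi+2*pi" n] by metis
qed

lemma has_integral_periodic_shift: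
  fixes g :: "real \<Rightarrow> 'a::euclidean_space"
  assumes per: "\<And>x. g (x + 2 * pi) = g x" and I: "(g has_integral I) {-pi..pi}"
  shows "((\<lambda>x. g (x + c)) has_integral I) {-pi..pi}"
  using has_integral_affinity'[of g I "c - pi" "c - pi + 2*pi" 1 c]
    has_integral_period[OF per I, of "c - pi"] by (simp add: algebra_simps)

lemma has_integral_periodic_double:
  fixes g :: "real \<Rightarrow> 'a::euclidean_space"
  assumes per: "\<And>x. g (x + 2 * pi) = g x" and I: "(g has_integral I) {-pi..pi}"
  shows "((\<lambda>x. g (2 * x)) has_integral I) {-pi..pi}"
proof -
  have "(g has_integral (I + I)) {-2*pi..2*pi}"
    using has_integral_period[OF per I, of "-2*pi"] has_integral_period[OF per I, of 0]
    by (intro has_integral_combine[of _ 0]) auto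
  from has_integral_affinity'[of g _ _ _ 2 0, simplified, OF this] show ?thesis
    by (simp flip: scaleR_2)
qed

lemma nn_integral_period:
  fixes g :: "real \<Rightarrow> ennreal"
  assumes per: "\<And>x. g (x + 2 * pi) = g x" and [measurable]: "g \<in> borel_measurable borel"
  shows "(\<integral>\<^sup>+x. g x * indicator {a..<a + 2 * pi} x \<partial>lborel) = (\<integral>\<^sup>+x. g x \<partial>circ)"
proof -
  define N where "N u v = (\<integral>\<^sup>+x. g x * indicator {u..<v} x \<partial>lborel)" for u v
  have tr: "N (u + of_int n * (2*pi)) (v + of_int n * (2*pi)) = N u v" for u v and n :: int
  proof -
    have "N (u + of_int n * (2*pi)) (v + of_int n * (2*pi)) =
      (\<integral>\<^sup>+x. g (of_int n * (2*pi) + x) * indicator {u + of_int n * (2*pi)..<v + of_int n * (2*pi)} (of_int n * (2*pi) + x) \<partial>lborel)"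
      unfolding N_def by (subst nn_integral_real_affine[of _ 1 "of_int n * (2*pi)"]) auto
    also have "\<dots> = N u v" unfolding N_def
      using periodic_int[of g, OF per]
      by (intro nn_integral_cong) (auto split: split_indicator simp: add.commute)
    finally show ?thesis .
  qed
  have add: "N u w = N u v + N v w" if "u \<le> v" "v \<le> w" for u v w
    unfolding N_def using that
    by (subst nn_integral_add[symmetric]) (auto intro!: nn_integral_cong split: split_indicator)
  obtain n :: int and r where r: "a + pi = r + of_int n * (2 * pi)" "0 \<le> r" "r < 2 * pi"
    by (rule reduce_period)
  have "N a (a + 2*pi) = N (r - pi) (r - pi + 2*pi)"
  proof -
    have "r - pi + of_int n * (2*pi) = a" "r - pi + 2*pi + of_int n * (2*pi) = a + 2*pi"
      using r by linarith+
    then show ?thesis using tr[of "r-pi" n "r-pi+2*pi"] by metis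
  qed
  also have "\<dots> = N (r - pi) pi + N pi (r + pi)" using add[of "r-pi" pi "r+pi"] r by (simp add: add.commute)
  also have "N pi (r + pi) = N (-pi) (r - pi)" using tr[of "-pi" 1 "r-pi"] by (simp add: algebra_simps)
  also have "N (r - pi) pi + N (-pi) (r - pi) = N (-pi) pi"
    using add[of "-pi" "r-pi" pi] r by (simp add: add.commute)
  finally show ?thesis by (simp add: N_def nn_integral_circ_lborel)
qed

lemma nn_integral_periodic_shift:
  fixes g :: "real \<Rightarrow> ennreal"
  assumes per: "\<And>x. g (x + 2 * pi) = g x" and [measurable]: "g \<in> borel_measurable borel"
  shows "(\<integral>\<^sup>+x. g (x + c) \<partial>circ) = (\<integral>\<^sup>+x. g x \<partial>circ)"
proof -
  have "(\<integral>\<^sup>+x. g x \<partial>circ) = (\<integral>\<^sup>+x. g x * indicator {c - pi..<c - pi + 2 * pi} x \<partial>lborel)"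
    using nn_integral_period[of g "c - pi"] assms by simp
  also have "\<dots> = (\<integral>\<^sup>+x. g (c + x) * indicator {c - pi..<c - pi + 2 * pi} (c + x) \<partial>lborel)"
    by (subst nn_integral_real_affine[of _ 1 c]) auto
  also have "\<dots> = (\<integral>\<^sup>+x. g (x + c) \<partial>circ)"
    by (subst nn_integral_circ_lborel)
       (auto intro!: nn_integral_cong split: split_indicator simp: algebra_simps)
  finally show ?thesis ..
qed

lemma nn_integral_periodic_double:
  fixes g :: "real \<Rightarrow> ennreal"
  assumes per: "\<And>x. g (x + 2 * pi) = g x" and [measurable]: "g \<in> borel_measurable borel"
  shows "(\<integral>\<^sup>+x. g (2 * x) \<partial>circ) = (\<integral>\<^sup>+x. g x \<partial>circ)"
proof -
  let ?I = "\<integral>\<^sup>+x. g x \<partial>circ"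
  have "2 * (\<integral>\<^sup>+x. g (2 * x) \<partial>circ) = 2 * (\<integral>\<^sup>+x. g (2 * x) * indicator {-2*pi..<2*pi} (2 * x) \<partial>lborel)"
    by (subst nn_integral_circ_lborel)
       (auto intro!: arg_cong[of _ _ "\<lambda>x. 2 * x"] nn_integral_cong split: split_indicator)
  also have "\<dots> = (\<integral>\<^sup>+x. g x * indicator {-2*pi..<2*pi} x \<partial>lborel)"
    by (subst (2) nn_integral_real_affine[of _ 2 0]) auto
  also have "\<dots> = (\<integral>\<^sup>+x. g x * indicator {-2*pi..<-2*pi+2*pi} x \<partial>lborel)
                 + (\<integral>\<^sup>+x. g x * indicator {0..<0+2*pi} x \<partial>lborel)"
    by (subst nn_integral_add[symmetric]) (auto intro!: nn_integral_cong split: split_indicator)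
  also have "\<dots> = 2 * ?I" using nn_integral_period[of g "-2*pi"] nn_integral_period[of g 0] assms
    by (simp only: mult_2)
  finally show ?thesis
    by (simp add: ennreal_mult_cancel_left)
qed

section \<open>The Poisson kernel\<close>
text \<open>
  Half the distance of two points of the unit circle at angle \<open>x\<close>. It measures distance on the torus:
  it is periodic, subadditive and comparable to \<open>\<bar>x\<bar>\<close> on one period.
\<close>
definition chord :: "real \<Rightarrow> real" where
  "chord x = \<bar>sin (x / 2)\<bar>"

lemma chord_nonneg [simp]: "0 \<le> chord x" and chord_le_1: "chord x \<le> 1"
  and chord_minus [simp]: "chord (- x) = chord x" and chord_0 [simp]: "chord 0 = 0"
  by (simp_all add: chord_def)

lemma chord_commute: "chord (x - y) = chord (y - x)"
  using chord_minus[of "x - y"] by simp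

lemma chord_periodic: "chord (x + 2 * pi) = chord x"
  by (simp add: chord_def add_divide_distrib)

lemma borel_chord [measurable]: "chord \<in> borel_measurable borel"
  unfolding chord_def by measurable

lemma chord_add: "chord (a + b) \<le> chord a + chord b"
proof -
  have "\<bar>sin (a/2) * cos (b/2) + cos (a/2) * sin (b/2)\<bar> \<le> \<bar>sin (a/2)\<bar> * 1 + 1 * \<bar>sin (b/2)\<bar>"
    by (intro order_trans[OF abs_triangle_ineq] add_mono) (unfold abs_mult, intro mult_mono; simp)+
  then show ?thesis by (simp add: chord_def add_divide_distrib sin_add)
qed

lemma cos_conv_chord: "cos x = 1 - 2 * (chord x)\<^sup>2"
  using cos_double_sin[of "x/2"] by (simp add: chord_def)

lemma chord_le: "chord x \<le> \<bar>x\<bar> / 2"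
  using abs_sin_x_le_abs_x[of "x/2"] by (simp add: chord_def)

lemma chord_ge:
  assumes "\<bar>x\<bar> \<le> pi" shows "\<bar>x\<bar> / pi \<le> chord x"
proof -
  have *: "y / pi \<le> sin (y / 2)" if "0 \<le> y" "y \<le> pi" for y
  proof -
    have "concave_on {0..pi} sin"
      unfolding concave_on_def
      by (rule f''_ge0_imp_convex[where f' = "\<lambda>x. - cos x" and f'' = "\<lambda>x. sin x"])
         (auto intro!: derivative_eq_intros sin_ge_zero)
    then have "u * sin x + v * sin z \<le> sin (u * x + v * z)"
      if "x \<in> {0..pi}" "z \<in> {0..pi}" "0 \<le> u" "0 \<le> v" "u + v = 1" for x z u v
      using that unfolding concave_on_iff by auto
    from this[of "pi/2" 0 "y/pi" "1 - y/pi"] that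
    have "y / pi * 1 \<le> sin (y / pi * (pi / 2))" by simp
    then show ?thesis by simp
  qed
  show ?thesis using *[of "\<bar>x\<bar>"] assms by (cases "x \<ge> 0") (auto simp: chord_def)
qed

lemma cosh_ge_square: "\<tau>\<^sup>2 / 2 \<le> cosh \<tau> - (1::real)"
proof -
  have "\<bar>y\<bar> \<le> \<bar>sinh y\<bar>" for y :: real
  proof -
    have "y \<le> sinh y" if "0 \<le> y" for y :: real
      using that
    proof -
      have "(\<lambda>y. sinh y - y) 0 \<le> (\<lambda>y. sinh y - y) y"
        using that cosh_real_ge_1
        by (intro DERIV_nonneg_imp_nondecreasing[OF that]) (auto intro!: derivative_eq_intros exI)
      then show ?thesis by simp
    qed
    from this[of y] this[of "-y"] show ?thesis by (cases "y \<ge> 0") auto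
  qed
  from power_mono[OF this[of "\<tau>/2"], of 2] have "(\<tau>/2)\<^sup>2 \<le> (sinh (\<tau>/2))\<^sup>2"
    by (simp only: power2_abs abs_ge_zero)
  moreover have "cosh \<tau> = 1 + 2 * (sinh (\<tau>/2))\<^sup>2"
    using cosh_double[of "\<tau>/2"] cosh_square_eq[of "\<tau>/2"] by simp
  ultimately show ?thesis by (simp add: power2_eq_square)
qed

lemma cosh_le_square:
  assumes "\<bar>\<tau>\<bar> \<le> (M::real)" shows "cosh \<tau> - 1 \<le> \<tau>\<^sup>2 / 2 * (cosh M)\<^sup>2"
proof -
  have s: "sinh y \<le> y * cosh y" if "0 \<le> y" for y :: real
  proof -
    have "(\<lambda>y. y * cosh y - sinh y) 0 \<le> (\<lambda>y. y * cosh y - sinh y) y"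
      by (intro DERIV_nonneg_imp_nondecreasing[OF that])
         (auto intro!: derivative_eq_intros exI)
    then show ?thesis by simp
  qed
  have "sinh (\<bar>\<tau>\<bar>/2) \<le> \<bar>\<tau>\<bar>/2 * cosh (\<bar>\<tau>\<bar>/2)" by (rule s) simp
  also have "\<dots> \<le> \<bar>\<tau>\<bar>/2 * cosh M" using assms by (intro mult_left_mono) (auto simp: cosh_real_nonneg_le_iff)
  finally have "(sinh (\<bar>\<tau>\<bar>/2))\<^sup>2 \<le> (\<bar>\<tau>\<bar>/2 * cosh M)\<^sup>2" by (intro power_mono) auto
  moreover have "cosh \<bar>\<tau>\<bar> = 1 + 2 * (sinh (\<bar>\<tau>\<bar>/2))\<^sup>2"
    using cosh_double[of "\<bar>\<tau>\<bar>/2"] cosh_square_eq[of "\<bar>\<tau>\<bar>/2"] by simp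
  ultimately show ?thesis by (simp add: power_mult_distrib field_simps)
qed

lemma poisson_denom:
  fixes \<rho> x :: real
  shows "1 - 2 * \<rho> * cos x + \<rho>\<^sup>2 = (1 - \<rho>)\<^sup>2 + 4 * \<rho> * (chord x)\<^sup>2"
  by (simp add: cos_conv_chord power2_eq_square algebra_simps)

lemma poisson_denom_pos:
  fixes \<rho> x :: real
  assumes "0 \<le> \<rho>" "\<rho> < 1" shows "0 < 1 - 2 * \<rho> * cos x + \<rho>\<^sup>2"
  unfolding poisson_denom using assms by (intro add_pos_nonneg) auto

lemma poisson_kernel_pos: "0 \<le> \<rho> \<Longrightarrow> \<rho> < 1 \<Longrightarrow> 0 < poisson_kernel \<rho> x"
  unfolding poisson_kernel_def using poisson_denom_pos[of \<rho> x]
  by (intro divide_pos_pos) (auto simp: power_less_one_iff abs_square_less_1)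

lemma poisson_kernel_nonneg [simp]: "0 \<le> \<rho> \<Longrightarrow> \<rho> < 1 \<Longrightarrow> 0 \<le> poisson_kernel \<rho> x"
  using poisson_kernel_pos less_imp_le by blast

lemma poisson_kernel_minus [simp]: "poisson_kernel \<rho> (- x) = poisson_kernel \<rho> x"
  by (simp add: poisson_kernel_def)

lemma poisson_kernel_periodic: "poisson_kernel \<rho> (x + 2 * pi) = poisson_kernel \<rho> x"
  by (simp add: poisson_kernel_def)

lemma borel_poisson_kernel [measurable]: "poisson_kernel \<rho> \<in> borel_measurable borel"
  unfolding poisson_kernel_def by measurable

lemma continuous_poisson_kernel:
  fixes g :: "'a::t2_space \<Rightarrow> real"
  assumes "0 \<le> \<rho>" "\<rho> < 1" "continuous_on S g"
  shows "continuous_on S (\<lambda>x. poisson_kernel \<rho> (g x))"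
  unfolding poisson_kernel_def using poisson_denom_pos[OF assms(1,2)] assms
  by (intro continuous_intros) (auto simp: less_imp_neq[THEN not_sym] intro!: continuous_on_cos)

lemma poisson_kernel_bound:
  assumes "0 \<le> \<rho>" "\<rho> < 1" shows "poisson_kernel \<rho> x \<le> 2 / (1 - \<rho>)"
proof -
  have "(1 - \<rho>)\<^sup>2 \<le> 1 - 2 * \<rho> * cos x + \<rho>\<^sup>2"
    unfolding poisson_denom using assms by simp
  then have "poisson_kernel \<rho> x \<le> (1 - \<rho>\<^sup>2) / (1 - \<rho>)\<^sup>2"
    unfolding poisson_kernel_def using assms
    by (intro divide_left_mono) (auto simp: power_le_one poisson_denom_pos)
  also have "\<dots> = (1 + \<rho>) / (1 - \<rho>)"  
  proof -
    have "1 - \<rho>\<^sup>2 = (1 + \<rho>) * (1 - \<rho>)" by (simp add: power2_eq_square algebra_simps)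
    then show ?thesis using assms by (simp add: power2_eq_square)
  qed
  also have "\<dots> \<le> 2 / (1 - \<rho>)" using assms by (intro divide_right_mono) auto
  finally show ?thesis .
qed

lemma poisson_kernel_chord:
  assumes "0 \<le> \<rho>" "\<rho> < 1" shows "poisson_kernel \<rho> x * chord x \<le> 2"
proof -
  let ?c = "chord x"
  have c: "0 \<le> ?c" "?c \<le> 1" by (auto simp: chord_le_1)
  have "(1 - \<rho>\<^sup>2) * ?c \<le> 2 * ((1 - \<rho>)\<^sup>2 + 4 * \<rho> * ?c\<^sup>2)"
  proof (cases "\<rho> \<ge> 1/4")
    case True
    have "(1 - \<rho>\<^sup>2) * ?c = (1 + \<rho>) * ((1 - \<rho>) * ?c)" by (simp add: power2_eq_square algebra_simps)
    also have "\<dots> \<le> 2 * ((1 - \<rho>) * ?c)" using assms c by (intro mult_right_mono) auto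
    also have "\<dots> \<le> (1 - \<rho>)\<^sup>2 + ?c\<^sup>2" using sum_squares_bound[of "1-\<rho>" ?c] by (simp add: algebra_simps)
    also have "\<dots> \<le> (1 - \<rho>)\<^sup>2 + (4 * \<rho>) * ?c\<^sup>2"
      using True mult_right_mono[of 1 "4*\<rho>" "?c\<^sup>2"] by simp
    also have "\<dots> \<le> 2 * \<dots>" using assms by simp
    finally show ?thesis .
  next
    case False
    have "(1 - \<rho>\<^sup>2) * ?c \<le> 1 * 1" using assms c by (intro mult_mono) (auto simp: power_le_one)
    also have "(3/4)\<^sup>2 \<le> (1 - \<rho>)\<^sup>2" using False by (intro power_mono) auto
    then have "1 * 1 \<le> 2 * (1 - \<rho>)\<^sup>2" by (simp add: power2_eq_square)
    also have "\<dots> \<le> 2 * ((1 - \<rho>)\<^sup>2 + 4 * \<rho> * ?c\<^sup>2)" using assms by simp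
    finally show ?thesis .
  qed
  then show ?thesis using poisson_denom_pos[OF assms, of x]
    by (simp add: poisson_kernel_def poisson_denom[symmetric] divide_simps)
qed

text \<open>
  With the radius written as \<open>exp (-\<tau>)\<close> the kernel has a denominator that is a sum of a function of \<open>\<tau>\<close>
  and a function of \<open>x\<close>, of size \<open>\<tau>\<^sup>2 + chord x ^ 2\<close>. Differences in \<open>x\<close> or in \<open>\<tau>\<close> are then differences
  of fractions, which is how the next lemmas replace derivatives of the kernel.
\<close>
lemma poisson_kernel_exp:
  assumes "\<tau> > 0"
  shows "poisson_kernel (exp (-\<tau>)) x = sinh \<tau> / (cosh \<tau> - cos x)"
    and "0 < cosh \<tau> - cos x"
proof -
  have "0 < \<tau>\<^sup>2 / 2" using assms by simp
  then show *: "0 < cosh \<tau> - cos x" using cosh_ge_square[of \<tau>] cos_le_one[of x] by linarith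
  have e: "exp (-\<tau>) * exp \<tau> = 1" by (simp flip: exp_add)
  have d: "1 - 2 * exp (-\<tau>) * cos x + (exp (-\<tau>))\<^sup>2 = 2 * exp (-\<tau>) * (cosh \<tau> - cos x)"
    using e by (simp add: cosh_def power2_eq_square algebra_simps)
  have n: "1 - (exp (-\<tau>))\<^sup>2 = 2 * exp (-\<tau>) * sinh \<tau>"
    using e by (simp add: sinh_def power2_eq_square algebra_simps)
  show "poisson_kernel (exp (-\<tau>)) x = sinh \<tau> / (cosh \<tau> - cos x)"
    unfolding poisson_kernel_def d n by simp
qed

lemma cosh_minus_cos_ge: "2 * \<bar>\<tau>\<bar> * chord x \<le> cosh \<tau> - cos x"
  "2 * (chord x)\<^sup>2 \<le> cosh \<tau> - cos x"
proof -
  have "2 * (\<bar>\<tau>\<bar> * chord x) \<le> \<tau>\<^sup>2 / 2 + 2 * (chord x)\<^sup>2"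
    using sum_squares_bound[of "\<bar>\<tau>\<bar>/2" "chord x"] by (simp add: power_divide)
  then show "2 * \<bar>\<tau>\<bar> * chord x \<le> cosh \<tau> - cos x" 
    using cosh_ge_square[of \<tau>] by (simp add: cos_conv_chord)
  show "2 * (chord x)\<^sup>2 \<le> cosh \<tau> - cos x"
    using cosh_real_ge_1[of \<tau>] by (simp add: cos_conv_chord)
qed

text \<open>
  The oscillation of the kernel at distance \<open>d\<close> is \<open>d / \<tau>\<close> times the kernel itself; integrated over
  the torus this says that Poisson integrals of bounded functions are Lipschitz with constant
  of order \<open>1 / \<tau>\<close>.
\<close>
lemma poisson_kernel_diff:
  assumes "\<tau> > 0"
  shows "\<bar>poisson_kernel (exp (-\<tau>)) a - poisson_kernel (exp (-\<tau>)) b\<bar>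
    \<le> chord (a - b) / \<tau> * (poisson_kernel (exp (-\<tau>)) a + poisson_kernel (exp (-\<tau>)) b)"
proof -
  let ?d = "\<lambda>x. cosh \<tau> - cos x"
  have d: "0 < ?d a" "0 < ?d b" using poisson_kernel_exp(2)[OF assms] by auto
  have s: "0 < sinh \<tau>" using assms by simp
  have "\<bar>cos a - cos b\<bar> = 2 * chord (a + b) * chord (a - b)"
    unfolding cos_diff_cos chord_commute[of a b] by (simp add: chord_def abs_mult)
  also have "\<dots> \<le> 2 * (chord a + chord b) * chord (a - b)"
    by (intro mult_right_mono mult_left_mono chord_add) auto
  also have "\<dots> \<le> ((?d a + ?d b) / \<tau>) * chord (a - b)"
    using cosh_minus_cos_ge(1)[of \<tau> a] cosh_minus_cos_ge(1)[of \<tau> b] assms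
    by (intro mult_right_mono) (auto simp: field_simps)
  finally have *: "\<bar>cos a - cos b\<bar> \<le> chord (a - b) / \<tau> * (?d a + ?d b)" by (simp add: mult.commute)
  have "sinh \<tau> / ?d a - sinh \<tau> / ?d b = sinh \<tau> / (?d a * ?d b) * (cos a - cos b)"
    using d by (simp add: divide_simps) (simp add: algebra_simps)
  then have "\<bar>sinh \<tau> / ?d a - sinh \<tau> / ?d b\<bar> = sinh \<tau> / (?d a * ?d b) * \<bar>cos a - cos b\<bar>"
    using d s by (simp add: abs_mult)
  also have "\<dots> \<le> sinh \<tau> / (?d a * ?d b) * (chord (a - b) / \<tau> * (?d a + ?d b))"
    using * d s by (intro mult_left_mono) auto
  also have "\<dots> = chord (a - b) / \<tau> * (sinh \<tau> / ?d a + sinh \<tau> / ?d b)"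
    using d assms by (simp add: field_simps)
  finally show ?thesis using poisson_kernel_exp(1)[OF assms] by simp
qed

text \<open>
  The kernel at \<open>2 \<tau>\<close> minus twice the kernel at \<open>\<tau>\<close> decays like \<open>\<tau>\<^sup>3 / x\<^sup>4\<close>, two powers faster than
  the kernel. So it integrates functions that vanish like \<open>x\<^sup>2\<close> to order \<open>\<tau>\<^sup>2\<close>.
\<close>
lemma poisson_kernel_second_diff:
  assumes "\<tau> > 0" "\<tau> \<le> M"
  shows "\<bar>poisson_kernel (exp (-2 * \<tau>)) x - 2 * poisson_kernel (exp (-\<tau>)) x\<bar> * (chord x)\<^sup>2
    \<le> (2 + cosh M) ^ 3 * \<tau>\<^sup>2 * poisson_kernel (exp (-\<tau>)) x"
proof -
  let ?c = "cos x" let ?C = "cosh \<tau>"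
  have d: "0 < ?C - ?c" "0 < cosh (2 * \<tau>) - ?c" using poisson_kernel_exp(2)[of \<tau> x] poisson_kernel_exp(2)[of "2*\<tau>" x] assms by auto
  have s: "0 < sinh \<tau>" using assms by simp
  have C: "1 \<le> ?C" "?C \<le> cosh M" using assms by (auto simp: cosh_real_ge_1 cosh_real_nonneg_le_iff)
  have C1: "0 \<le> 1 + ?C + ?c" using C cos_ge_minus_one[of x] by linarith
  have c2: "cosh (2*\<tau>) = 2 * ?C\<^sup>2 - 1" using cosh_double[of \<tau>] sinh_square_eq[of \<tau>] by simp
  have d2: "0 < 2 * ?C\<^sup>2 - 1 - ?c" using d c2 by simp
  have "sinh (2*\<tau>) / (cosh (2*\<tau>) - ?c) - 2 * (sinh \<tau> / (?C - ?c))
     = - (sinh \<tau> / (?C - ?c) * (2 * (?C - 1) * (1 + ?C + ?c) / (cosh (2*\<tau>) - ?c)))"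
    unfolding c2 sinh_double using d(1) d2 by (simp add: divide_simps) (simp add: power2_eq_square algebra_simps)
  then have "\<bar>poisson_kernel (exp (-2 * \<tau>)) x - 2 * poisson_kernel (exp (-\<tau>)) x\<bar>
      = poisson_kernel (exp (-\<tau>)) x * (2 * (?C - 1) * (1 + ?C + ?c) / (cosh (2*\<tau>) - ?c))"
    using poisson_kernel_exp(1)[of \<tau> x] poisson_kernel_exp(1)[of "2*\<tau>" x] assms d s C C1
    by (simp add: abs_mult)
  then have "\<bar>poisson_kernel (exp (-2 * \<tau>)) x - 2 * poisson_kernel (exp (-\<tau>)) x\<bar> * (chord x)\<^sup>2 
    = poisson_kernel (exp (-\<tau>)) x * ((?C - 1) * (1 + ?C + ?c) * (2 * (chord x)\<^sup>2 / (cosh (2*\<tau>) - ?c)))"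
    by simp
  also have "\<dots> \<le> poisson_kernel (exp (-\<tau>)) x * ((\<tau>\<^sup>2 / 2 * (cosh M)\<^sup>2) * (2 + cosh M) * 1)"
  proof (intro mult_left_mono mult_mono)
    show "?C - 1 \<le> \<tau>\<^sup>2 / 2 * (cosh M)\<^sup>2" using cosh_le_square[of \<tau> M] assms by simp
    show "1 + ?C + ?c \<le> 2 + cosh M" using C cos_le_one[of x] by linarith
    show "2 * (chord x)\<^sup>2 / (cosh (2 * \<tau>) - ?c) \<le> 1"
      using cosh_minus_cos_ge(2)[of x "2*\<tau>"] d by simp
  qed (use C C1 d assms in auto)
  also have "\<dots> \<le> poisson_kernel (exp (-\<tau>)) x * (\<tau>\<^sup>2 * (2 + cosh M)\<^sup>2 * (2 + cosh M))"
  proof -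
    have "(cosh M)\<^sup>2 \<le> (2 + cosh M)\<^sup>2" by (intro power_mono) auto
    then have "(1/2) * (cosh M)\<^sup>2 \<le> (2 + cosh M)\<^sup>2" using zero_le_power2[of "cosh M"] by linarith
    then have "\<tau>\<^sup>2 * ((1/2) * (cosh M)\<^sup>2) \<le> \<tau>\<^sup>2 * (2 + cosh M)\<^sup>2" by (intro mult_left_mono) auto
    then have "\<tau>\<^sup>2 * ((1/2) * (cosh M)\<^sup>2) * (2 + cosh M) \<le> \<tau>\<^sup>2 * (2 + cosh M)\<^sup>2 * (2 + cosh M)"
      using C by (intro mult_right_mono) auto
    from mult_left_mono[OF this, of "poisson_kernel (exp (-\<tau>)) x"] assms show ?thesis by simp
  qed
  finally show ?thesis by (simp add: power3_eq_cube power2_eq_square mult_ac)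
qed

text \<open>
  The sum over a coset of \<open>{0, pi}\<close> keeps the even frequencies, which are the frequencies of
  the kernel of radius \<open>\<rho>\<^sup>2\<close> at \<open>2 x\<close>.
\<close>
lemma poisson_kernel_double:
  assumes "0 \<le> \<rho>" "\<rho> < 1"
  shows "poisson_kernel \<rho> x + poisson_kernel \<rho> (x + pi) = 2 * poisson_kernel (\<rho>\<^sup>2) (2 * x)"
proof -
  have 1: "0 < 1 - 2 * \<rho> * cos x + \<rho>\<^sup>2" using poisson_denom_pos assms by blast
  have 2: "0 < 1 + 2 * \<rho> * cos x + \<rho>\<^sup>2" using poisson_denom_pos[OF assms, of "x + pi"] by simp
  have 3: "1 - 2 * \<rho>\<^sup>2 * cos (2 * x) + (\<rho>\<^sup>2)\<^sup>2 = (1 - 2 * \<rho> * cos x + \<rho>\<^sup>2) * (1 + 2 * \<rho> * cos x + \<rho>\<^sup>2)"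
    unfolding cos_double_cos by (simp add: power2_eq_square algebra_simps)
  show ?thesis unfolding poisson_kernel_def 3 using 1 2
    by (simp add: divide_simps) (simp add: power2_eq_square power4_eq_xxxx algebra_simps)
qed

section \<open>Poisson integrals as Fourier series\<close>
text \<open>
  Continuous functions on the torus.
\<close>
definition cper :: "(real \<Rightarrow> complex) \<Rightarrow> bool" where
  "cper g \<longleftrightarrow> continuous_on UNIV g \<and> (\<forall>x. g (x + 2 * pi) = g x)"

lemma cper_per: "cper g \<Longrightarrow> g (x + 2 * pi) = g x"
  and cper_cont: "cper g \<Longrightarrow> continuous_on S g"
  by (auto simp: cper_def intro: continuous_on_subset)

lemma cper_borel: "cper g \<Longrightarrow> g \<in> borel_measurable borel"
  by (intro borel_measurable_continuous_onI cper_cont)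

lemma integrable_circ_continuous:
  fixes g :: "real \<Rightarrow> 'a::euclidean_space"
  assumes "continuous_on {-pi..pi} g" shows "integrable circ g"
  unfolding integrable_circ_iff[symmetric] using assms by (rule absolutely_integrable_continuous_real)

lemma cper_integrable: "cper g \<Longrightarrow> integrable circ g"
  by (intro integrable_circ_continuous cper_cont)

lemma integrable_bounded_mult:
  fixes F g :: "real \<Rightarrow> complex"
  assumes F: "integrable circ F" and g: "g \<in> borel_measurable borel" and M: "\<And>t. norm (g t) \<le> M"
  shows "integrable circ (\<lambda>t. g t * F t)"
proof (rule Bochner_Integration.integrable_bound)
  show "integrable circ (\<lambda>t. M * norm (F t))" using F by auto
  show "(\<lambda>t. g t * F t) \<in> borel_measurable circ"
    using borel_measurable_circ[OF g] F by measurable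
  show "AE t in circ. norm (g t * F t) \<le> norm (M * norm (F t))"
    using M order_trans[OF norm_ge_zero M[of 0]]
    by (intro AE_I2) (simp add: norm_mult abs_mult mult_right_mono)
qed

lemma integral_circ_HK:
  fixes g :: "real \<Rightarrow> complex"
  assumes "integrable circ g"
  shows "(g has_integral (\<integral>t. g t \<partial>circ)) {-pi..pi}"
  using assms set_lebesgue_integral_eq_integral[of "{-pi..pi}" g]
  by (simp add: integrable_circ_iff[symmetric] set_integral_circ has_integral_iff)

lemma integral_circ_shift:
  fixes g :: "real \<Rightarrow> complex"
  assumes "integrable circ g" "integrable circ (\<lambda>x. g (x + c))" "\<And>x. g (x + 2 * pi) = g x"
  shows "(\<integral>t. g (t + c) \<partial>circ) = (\<integral>t. g t \<partial>circ)"
  using has_integral_periodic_shift[OF assms(3) integral_circ_HK[OF assms(1)], of c]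
    integral_circ_HK[OF assms(2)] has_integral_unique by blast

text \<open>
  Termwise integration against an integrable function. All facts about Poisson integrals below that
  are multiplier identities (semigroup law, action on Fourier coefficients, the identity for the
  Hankel operator) come from this lemma and the action on single exponentials.
\<close>
lemma integral_sums_circ:
  fixes h :: "real \<Rightarrow> complex" and f :: "nat \<Rightarrow> real \<Rightarrow> complex"
  assumes h: "integrable circ h" and f: "\<And>n. f n \<in> borel_measurable borel"
    and M: "\<And>n t. norm (f n t) \<le> M n" "summable M" and g: "\<And>t. (\<lambda>n. f n t) sums g t"
  shows "(\<lambda>n. \<integral>t. f n t * h t \<partial>circ) sums (\<integral>t. g t * h t \<partial>circ)"
proof -
  have int: "integrable circ (\<lambda>t. f n t * h t)" for n by (rule integrable_bounded_mult[OF h f M(1)])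
  have bd: "norm (f n t * h t) \<le> M n * norm (h t)" for n t
    unfolding norm_mult by (intro mult_right_mono M) auto
  have "(\<lambda>n. \<integral>t. f n t * h t \<partial>circ) sums (\<integral>t. (\<Sum>n. f n t * h t) \<partial>circ)"
  proof (rule sums_integral[OF int])
    show "AE t in circ. summable (\<lambda>n. norm (f n t * h t))"
      by (intro AE_I2 summable_comparison_test'[OF summable_mult2[OF M(2)]]) (use bd in auto)
    show "summable (\<lambda>n. \<integral>t. norm (f n t * h t) \<partial>circ)"
    proof (rule summable_comparison_test'[OF summable_mult2[OF M(2)]])
      fix n
      have "(\<integral>t. norm (f n t * h t) \<partial>circ) \<le> (\<integral>t. M n * norm (h t) \<partial>circ)"
        using int bd h by (intro integral_mono integrable_norm) auto
      then show "norm (\<integral>t. norm (f n t * h t) \<partial>circ) \<le> M n * (\<integral>t. norm (h t) \<partial>circ)" by simp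
    qed
  qed
  moreover have "(\<Sum>n. f n t * h t) = g t * h t" for t
    using sums_mult2[OF g[of t], of "h t"] by (rule sums_unique[symmetric])
  ultimately show ?thesis by simp
qed

lemma cper_sums:
  assumes "\<And>n. cper (f n)" "\<And>n x. norm (f n x) \<le> M n" "summable M" "\<And>x. (\<lambda>n. f n x) sums g x"
  shows "cper g"
proof -
  have "uniform_limit UNIV (\<lambda>N x. \<Sum>n<N. f n x) (\<lambda>x. \<Sum>n. f n x) sequentially"
    by (rule Weierstrass_m_test[OF _ assms(3)]) (rule assms(2))
  then have "continuous_on UNIV (\<lambda>x. \<Sum>n. f n x)"
    by (rule uniform_limit_theorem[rotated]) (auto intro!: always_eventually continuous_on_sum cper_cont[OF assms(1)])
  moreover have "(\<lambda>x. \<Sum>n. f n x) = g" using assms(4) by (auto simp: sums_unique[symmetric])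
  moreover have "g (x + 2 * pi) = g x" for x
    using assms(4)[of "x + 2 * pi"] assms(4)[of x] cper_per[OF assms(1)] by (simp add: sums_unique2)
  ultimately show ?thesis by (simp only: cper_def) simp
qed

text \<open>
  In a sum over pairs \<open>cis (n x)\<close>, \<open>cis (-n x)\<close> the frequency zero occurs twice, hence the factor
  one half there.
\<close>
definition weight :: "nat \<Rightarrow> complex" where "weight n = (if n = 0 then 1/2 else 1)"

definition fourier :: "(real \<Rightarrow> complex) \<Rightarrow> real \<Rightarrow> complex" where
  "fourier F k = (\<integral>t. cis (- (k * t)) * F t \<partial>circ) / complex_of_real (2 * pi)"

definition trig_series where
  "trig_series a b g \<longleftrightarrow> summable (\<lambda>n. norm (a n)) \<and> summable (\<lambda>n. norm (b n)) \<and>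
     (\<forall>x. (\<lambda>n. a n * cis (real n * x) + b n * cis (- (real n * x))) sums g x)"

lemma norm_weight: "norm (weight n) \<le> 1" by (simp add: weight_def)

lemma borel_cis [measurable]: "cis \<in> borel_measurable borel"
  by (intro borel_measurable_continuous_onI continuous_intros)

lemma norm_fourier: "norm (fourier F k) \<le> (\<integral>t. norm (F t) \<partial>circ) / (2 * pi)"
  unfolding fourier_def norm_divide
  by (intro divide_mono order_trans[OF integral_norm_bound]) (auto simp: norm_mult)

lemma poisson_integral_circ:
  "poisson_integral \<rho> F x = (\<integral>t. complex_of_real (poisson_kernel \<rho> (x - t)) * F t \<partial>circ) / complex_of_real (2 * pi)"
  by (simp add: poisson_integral_def set_integral_circ)

lemma poisson_kernel_series:
  assumes "0 \<le> \<rho>" "\<rho> < 1"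
  shows "(\<lambda>n. weight n * of_real (\<rho> ^ n) * (cis (real n * x) + cis (- (real n * x)))) sums complex_of_real (poisson_kernel \<rho> x)"
proof -
  define z w where "z = of_real \<rho> * cis x" and "w = of_real \<rho> * cis (-x)"
  have n: "norm z < 1" "norm w < 1" using assms by (auto simp: z_def w_def norm_mult)
  have "(\<lambda>n. z ^ n + w ^ n - (if n = 0 then 1 else 0)) sums (1 / (1 - z) + 1 / (1 - w) - 1)"
    using n by (intro sums_diff sums_add geometric_sums) (auto intro: sums_single)
  moreover have "z ^ n + w ^ n - (if n = 0 then 1 else 0) = weight n * of_real (\<rho> ^ n) * (cis (real n * x) + cis (- (real n * x)))" for n
  proof -
    have "z ^ n = of_real (\<rho> ^ n) * cis (real n * x)" "w ^ n = of_real (\<rho> ^ n) * cis (real n * (- x))"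
      unfolding z_def w_def power_mult_distrib of_real_power by (simp_all only: Complex.DeMoivre)
    then show ?thesis by (simp add: weight_def distrib_left)
  qed
  moreover have "1 / (1 - z) + 1 / (1 - w) - 1 = complex_of_real (poisson_kernel \<rho> x)"
  proof -
    have nz: "1 - z \<noteq> 0" "1 - w \<noteq> 0" using n by auto
    have zw: "z * w = of_real (\<rho>\<^sup>2)" by (simp add: z_def w_def cis_mult power2_eq_square mult_ac)
    have zpw: "z + w = of_real (2 * \<rho> * cos x)" by (simp add: z_def w_def complex_eq_iff)
    have "1 / (1 - z) + 1 / (1 - w) - 1 = (1 - z * w) / ((1 - z) * (1 - w))"
      using nz by (simp add: divide_simps) (simp add: algebra_simps)
    also have "(1 - z) * (1 - w) = 1 - (z + w) + z * w" by (simp add: algebra_simps)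
    finally show ?thesis unfolding zw zpw poisson_kernel_def by simp
  qed
  ultimately show ?thesis by simp
qed

lemma poisson_integral_series:
  assumes F: "integrable circ F" and \<rho>: "0 \<le> \<rho>" "\<rho> < 1"
  shows "trig_series (\<lambda>n. of_real (\<rho> ^ n) * (weight n * fourier F n)) (\<lambda>n. of_real (\<rho> ^ n) * (weight n * fourier F (- real n)))
    (poisson_integral \<rho> F)"
proof -
  define N where "N = (\<integral>t. norm (F t) \<partial>circ)"
  have N: "0 \<le> N" by (simp add: N_def)
  have geo: "summable (\<lambda>n. \<rho> ^ n * c)" for c using \<rho> by (intro summable_mult2) (simp add: summable_geometric)
  have s: "summable (\<lambda>n. norm (of_real (\<rho> ^ n) * (weight n * fourier F (h n))))" for h
  proof (rule summable_comparison_test')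
    show "summable (\<lambda>n. \<rho> ^ n * (N / (2*pi)))" by (rule geo)
    show "norm (norm (of_real (\<rho> ^ n) * (weight n * fourier F (h n)))) \<le> \<rho> ^ n * (N / (2*pi))" for n
    proof -
      have "norm (weight n) * norm (fourier F (h n)) \<le> 1 * (N / (2*pi))"
        unfolding N_def by (intro mult_mono norm_weight norm_fourier) auto
      from mult_left_mono[OF this, of "\<rho> ^ n"] show ?thesis using \<rho> by (simp add: norm_mult norm_power)
    qed
  qed
  have ser: "(\<lambda>n. of_real (\<rho> ^ n) * (weight n * fourier F n) * cis (real n * x) + of_real (\<rho> ^ n) * (weight n * fourier F (- real n)) * cis (- (real n * x)))
     sums poisson_integral \<rho> F x" for x
  proof -
    let ?f = "\<lambda>n t. weight n * of_real (\<rho> ^ n) * (cis (real n * (x - t)) + cis (- (real n * (x - t)))) * F t"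
    have bd: "norm (weight n * of_real (\<rho> ^ n) * (cis (real n * (x - t)) + cis (- (real n * (x - t))))) \<le> \<rho> ^ n * 2" for n t
    proof -
      have "norm (cis (real n * (x - t)) + cis (- (real n * (x - t)))) \<le> 2"
        by (rule order_trans[OF norm_triangle_ineq]) simp
      then have "norm (weight n) * norm (cis (real n * (x - t)) + cis (- (real n * (x - t)))) \<le> 1 * 2"
        by (intro mult_mono norm_weight) auto
      from mult_left_mono[OF this, of "\<rho> ^ n"] show ?thesis using \<rho>
        by (simp add: norm_mult norm_power mult_ac)
    qed
    have "(\<lambda>n. \<integral>t. ?f n t \<partial>circ) sums (\<integral>t. complex_of_real (poisson_kernel \<rho> (x - t)) * F t \<partial>circ)"
      by (rule integral_sums_circ[OF F _ bd geo poisson_kernel_series[OF \<rho>]]) measurable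
    moreover have "(\<integral>t. ?f n t \<partial>circ) = of_real (2 * pi) * (of_real (\<rho> ^ n) * (weight n * fourier F n) * cis (real n * x) + of_real (\<rho> ^ n) * (weight n * fourier F (- real n)) * cis (- (real n * x)))" for n
    proof -
      have i: "integrable circ (\<lambda>t. cis (k * t) * F t)" for k
        by (rule integrable_bounded_mult[OF F, of _ 1]) (auto simp: borel_cis)
      have "?f n t = weight n * of_real (\<rho> ^ n) * cis (real n * x) * (cis (- real n * t) * F t) 
        + weight n * of_real (\<rho> ^ n) * cis (- (real n * x)) * (cis (real n * t) * F t)" for t
      proof -
        have "cis (real n * (x - t)) = cis (real n * x) * cis (- real n * t)"
          "cis (- (real n * (x - t))) = cis (- (real n * x)) * cis (real n * t)"
          unfolding cis_mult by (simp_all add: algebra_simps)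
        then show ?thesis by (simp only:) (simp add: algebra_simps)
      qed
      then have "(\<integral>t. ?f n t \<partial>circ) = weight n * of_real (\<rho> ^ n) * cis (real n * x) * (\<integral>t. cis (- real n * t) * F t \<partial>circ)
        + weight n * of_real (\<rho> ^ n) * cis (- (real n * x)) * (\<integral>t. cis (real n * t) * F t \<partial>circ)"
        using i[of "real n"] i[of "- real n"] by simp
      then show ?thesis by (simp add: fourier_def algebra_simps)
    qed
    ultimately have "(\<lambda>n. of_real (2 * pi) * (of_real (\<rho> ^ n) * (weight n * fourier F n) * cis (real n * x) + of_real (\<rho> ^ n) * (weight n * fourier F (- real n)) * cis (- (real n * x)))) sums
       (\<integral>t. complex_of_real (poisson_kernel \<rho> (x - t)) * F t \<partial>circ)" by simp
    from sums_divide[OF this, of "of_real (2*pi)"] show ?thesis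
      unfolding poisson_integral_circ by simp
  qed
  show ?thesis unfolding trig_series_def using s[of "\<lambda>n. real n"] s[of "\<lambda>n. - real n"] ser by blast
qed

lemma integral_cis:
  fixes j :: int
  shows "(\<integral>t. cis (j * t) \<partial>circ) = (if j = 0 then complex_of_real (2 * pi) else 0)"
proof (cases "j = 0")
  case False
  have i: "integrable circ (\<lambda>t. cis (real_of_int j * (t + c)))" for c
    by (intro integrable_circ_continuous continuous_intros)
  have per: "cis (real_of_int j * (x + 2 * pi)) = cis (real_of_int j * x)" for x
    using cis_multiple_2pi[of "real_of_int j"] by (simp add: distrib_left mult.commute mult.left_commute flip: cis_mult)
  have "(\<integral>t. cis (j * (t + pi / j)) \<partial>circ) = (\<integral>t. cis (j * t) \<partial>circ)"
    using i[of 0] i[of "pi/j"] per by (intro integral_circ_shift) auto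
  moreover have "cis (j * (t + pi / j)) = - cis (j * t)" for t :: real
    using False by (simp add: distrib_left flip: cis_mult)
  ultimately show ?thesis using False by simp
qed (simp add: scaleR_conv_of_real)

lemma fourier_cis:
  fixes m k :: int
  shows "fourier (\<lambda>t::real. cis (m * t)) k = (if m = k then 1 else 0)"
proof -
  have "cis (- (real_of_int k * t)) * cis (real_of_int m * t) = cis (real_of_int (m - k) * t)" for t :: real
    by (simp add: cis_mult algebra_simps)
  then show ?thesis using integral_cis[of "m - k"] by (auto simp: fourier_def)
qed

lemma poisson_integral_cis:
  fixes m :: int and x :: real
  assumes \<rho>: "0 \<le> \<rho>" "\<rho> < 1"
  shows "poisson_integral \<rho> (\<lambda>t::real. cis (m * t)) x = of_real (\<rho> ^ nat \<bar>m\<bar>) * cis (m * x)"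
proof -
  let ?F = "\<lambda>t::real. cis (m * t)"
  have F: "integrable circ ?F" by (intro integrable_circ_continuous continuous_intros)
  let ?g = "\<lambda>n. of_real (\<rho> ^ n) * (weight n * fourier ?F n) * cis (real n * x) + of_real (\<rho> ^ n) * (weight n * fourier ?F (- real n)) * cis (- (real n * x))"
  have "?g sums poisson_integral \<rho> ?F x"
    using poisson_integral_series[OF F \<rho>] by (simp add: trig_series_def)
  moreover have "?g n = (if n = nat \<bar>m\<bar> then of_real (\<rho> ^ nat \<bar>m\<bar>) * cis (m * x) else 0)" for n
    using fourier_cis[of m "int n"] fourier_cis[of m "- int n"] by (auto simp: weight_def)
  then have "?g sums (of_real (\<rho> ^ nat \<bar>m\<bar>) * cis (m * x))"
    using sums_single[of "nat \<bar>m\<bar>" "\<lambda>_. of_real (\<rho> ^ nat \<bar>m\<bar>) * cis (m * x)"] by simp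
  ultimately show ?thesis using sums_unique2 by blast
qed

lemma cper_cis:
  fixes m :: int
  shows "cper (\<lambda>t. cis (m * t))"
proof -
  have "cis (real_of_int m * (x + 2 * pi)) = cis (real_of_int m * x)" for x
    using cis_multiple_2pi[of "real_of_int m"] by (simp add: distrib_left mult.commute mult.left_commute flip: cis_mult)
  then show ?thesis by (simp add: cper_def continuous_intros)
qed

lemma cper_lincomb_cis: "cper (\<lambda>x. a * cis (real n * x) + b * cis (- (real n * x)))"
proof -
  have c: "cper (\<lambda>x. cis (real n * x))" "cper (\<lambda>x. cis (- (real n * x)))"
    using cper_cis[of "int n"] cper_cis[of "- int n"] by simp_all
  show ?thesis using cper_cont[OF c(1)] cper_cont[OF c(2)] cper_per[OF c(1)] cper_per[OF c(2)]
    by (auto simp only: cper_def intro!: continuous_intros)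
qed

lemma norm_lincomb_cis: "norm (a * cis u + b * cis v) \<le> norm a + norm b"
  by (rule order_trans[OF norm_triangle_ineq]) (simp add: norm_mult)

lemma trig_series_cper: "trig_series a b g \<Longrightarrow> cper g"
  unfolding trig_series_def
  by (rule cper_sums[of _ "\<lambda>n. norm (a n) + norm (b n)"])
     (auto intro: cper_lincomb_cis norm_lincomb_cis summable_add)

lemma cper_poisson_integral:
  "integrable circ F \<Longrightarrow> 0 \<le> \<rho> \<Longrightarrow> \<rho> < 1 \<Longrightarrow> cper (poisson_integral \<rho> F)"
  using poisson_integral_series trig_series_cper by blast

lemma poisson_norm_le:
  "norm (poisson_integral \<rho> F x) \<le> (\<integral>t. \<bar>poisson_kernel \<rho> (x - t)\<bar> * norm (F t) \<partial>circ) / (2 * pi)"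
  unfolding poisson_integral_circ norm_divide
  by (intro divide_mono order_trans[OF integral_norm_bound]) (auto simp: norm_mult)

lemma integrable_kernel_mult:
  assumes "integrable circ F" "0 \<le> \<rho>" "\<rho> < 1"
  shows "integrable circ (\<lambda>t. complex_of_real (poisson_kernel \<rho> (x - t)) * F t)"
  by (rule integrable_bounded_mult[OF assms(1), of _ "2 / (1 - \<rho>)"])
     (use assms poisson_kernel_bound in auto)

lemma poisson_integral_lincomb:
  assumes "integrable circ f" "integrable circ g" "0 \<le> \<rho>" "\<rho> < 1"
  shows "poisson_integral \<rho> (\<lambda>t. f t + g t) x = poisson_integral \<rho> f x + poisson_integral \<rho> g x"
    and "poisson_integral \<rho> (\<lambda>t. f t - g t) x = poisson_integral \<rho> f x - poisson_integral \<rho> g x"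
    and "poisson_integral \<rho> (\<lambda>t. c * f t) x = c * poisson_integral \<rho> f x"
  using integrable_kernel_mult[OF assms(1,3,4), of x] integrable_kernel_mult[OF assms(2-4), of x]
  by (simp_all add: poisson_integral_circ distrib_left right_diff_distrib add_divide_distrib diff_divide_distrib mult.left_commute)

lemma integral_poisson_kernel:
  assumes "0 \<le> \<rho>" "\<rho> < 1" shows "(\<integral>t. poisson_kernel \<rho> (x - t) \<partial>circ) = 2 * pi"
proof -
  have "poisson_integral \<rho> (\<lambda>t. 1) x = 1" using poisson_integral_cis[OF assms, of 0] by simp
  then have "complex_of_real (\<integral>t. poisson_kernel \<rho> (x - t) \<partial>circ) = complex_of_real (2 * pi)"
    by (simp add: poisson_integral_circ)
  then show ?thesis using of_real_eq_iff by blast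
qed

lemma integrable_poisson_kernel: "0 \<le> \<rho> \<Longrightarrow> \<rho> < 1 \<Longrightarrow> integrable circ (\<lambda>t. poisson_kernel \<rho> (x - t))"
  by (intro integrable_circ_continuous continuous_poisson_kernel continuous_intros)

lemma nn_integral_poisson_kernel:
  assumes "0 \<le> \<rho>" "\<rho> < 1" shows "(\<integral>\<^sup>+t. ennreal (poisson_kernel \<rho> (x - t)) \<partial>circ) = ennreal (2 * pi)"
  using assms by (subst nn_integral_eq_integral) (auto simp: integral_poisson_kernel integrable_poisson_kernel)

lemma poisson_contraction:
  assumes "0 \<le> \<rho>" "\<rho> < 1" "\<And>t. norm (F t) \<le> M"
  shows "norm (poisson_integral \<rho> F x) \<le> M"
proof -
  have "(\<integral>t. \<bar>poisson_kernel \<rho> (x - t)\<bar> * norm (F t) \<partial>circ) \<le> (\<integral>t. poisson_kernel \<rho> (x - t) * M \<partial>circ)"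
    using assms order_trans[OF norm_ge_zero assms(3)]
    by (intro integral_mono') (auto intro!: integrable_poisson_kernel mult_left_mono)
  also have "\<dots> = 2 * pi * M" using assms by (simp add: integral_poisson_kernel)
  finally have "(\<integral>t. \<bar>poisson_kernel \<rho> (x - t)\<bar> * norm (F t) \<partial>circ) / (2 * pi) \<le> M"
    by (simp add: divide_le_eq mult.commute)
  then show ?thesis using poisson_norm_le[of \<rho> F x] by linarith
qed

lemma nn_poisson_norm_le:
  assumes "0 \<le> \<rho>" "\<rho> < 1"
  shows "ennreal (norm (poisson_integral \<rho> F x)) \<le> (\<integral>\<^sup>+t. ennreal (poisson_kernel \<rho> (x - t)) * ennreal (norm (F t)) \<partial>circ) / ennreal (2 * pi)"
proof -
  let ?f = "\<lambda>t. complex_of_real (poisson_kernel \<rho> (x - t)) * F t"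
  have "ennreal (norm (integral\<^sup>L circ ?f)) \<le> (\<integral>\<^sup>+t. ennreal (norm (?f t)) \<partial>circ)"
    by (cases "integrable circ ?f") (auto intro: integral_norm_bound_ennreal simp: not_integrable_integral_eq)
  also have "\<dots> = (\<integral>\<^sup>+t. ennreal (poisson_kernel \<rho> (x - t)) * ennreal (norm (F t)) \<partial>circ)"
    using assms by (intro nn_integral_cong) (simp add: norm_mult ennreal_mult)
  finally have "ennreal (norm (integral\<^sup>L circ ?f)) / ennreal (2 * pi) \<le> \<dots> / ennreal (2 * pi)"
    by (rule divide_right_mono_ennreal)
  then show ?thesis by (simp add: poisson_integral_circ norm_divide divide_ennreal norm_mult)
qed

lemma poisson_trig_series:
  assumes "trig_series a b g" and \<rho>: "0 \<le> \<rho>" "\<rho> < 1"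
  shows "trig_series (\<lambda>n. of_real (\<rho> ^ n) * a n) (\<lambda>n. of_real (\<rho> ^ n) * b n) (poisson_integral \<rho> g)"
proof -
  have sa: "summable (\<lambda>n. norm (a n))" and sb: "summable (\<lambda>n. norm (b n))" 
    and sg: "\<And>x. (\<lambda>n. a n * cis (real n * x) + b n * cis (- (real n * x))) sums g x"
    using assms by (auto simp: trig_series_def)
  have sum: "summable (\<lambda>n. norm (of_real (\<rho> ^ n) * c n))" if "summable (\<lambda>n. norm (c n))" for c :: "nat \<Rightarrow> complex"
    using \<rho> by (intro summable_comparison_test'[OF that])
      (auto simp: norm_mult norm_power mult_left_le_one_le power_le_one)
  have "(\<lambda>n. of_real (\<rho> ^ n) * a n * cis (real n * x) + of_real (\<rho> ^ n) * b n * cis (- (real n * x))) sums poisson_integral \<rho> g x" for x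
  proof -
    let ?k = "\<lambda>t. complex_of_real (poisson_kernel \<rho> (x - t))"
    let ?e = "\<lambda>n t. a n * cis (real n * t) + b n * cis (- (real n * t))"
    have ci: "integrable circ (\<lambda>t. c * cis (r * t))" for c and r :: real
      by (intro integrable_circ_continuous continuous_intros)
    have ie: "integrable circ (?e n)" for n
      using ci[of "a n" "real n"] ci[of "b n" "- real n"] by auto
    have "integrable circ ?k" using integrable_poisson_kernel[OF \<rho>] by auto
    then have "(\<lambda>n. \<integral>t. ?e n t * ?k t \<partial>circ) sums (\<integral>t. g t * ?k t \<partial>circ)"
      by (rule integral_sums_circ[OF _ cper_borel[OF cper_lincomb_cis] norm_lincomb_cis summable_add[OF sa sb] sg])
    then have "(\<lambda>n. \<integral>t. ?k t * ?e n t \<partial>circ) sums (\<integral>t. ?k t * g t \<partial>circ)" by (simp only: mult.commute)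
    moreover have "(\<integral>t. ?k t * ?e n t \<partial>circ) = of_real (2 * pi) * (of_real (\<rho> ^ n) * a n * cis (real n * x) + of_real (\<rho> ^ n) * b n * cis (- (real n * x)))" for n
    proof -
      have c: "poisson_integral \<rho> (?e n) x = a n * poisson_integral \<rho> (\<lambda>t. cis (real n * t)) x + b n * poisson_integral \<rho> (\<lambda>t. cis (- real n * t)) x"
        using ci[of "a n" "real n"] ci[of "b n" "- real n"] ci[of 1 "real n"] ci[of 1 "- real n"] \<rho>
        by (simp add: poisson_integral_lincomb)
      have "poisson_integral \<rho> (?e n) x = of_real (\<rho> ^ n) * a n * cis (real n * x) + of_real (\<rho> ^ n) * b n * cis (- (real n * x))"
        unfolding c using poisson_integral_cis[OF \<rho>, of "int n" x] poisson_integral_cis[OF \<rho>, of "- int n" x] by simp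
      then show ?thesis unfolding poisson_integral_circ by (simp add: field_simps)
    qed
    ultimately have "(\<lambda>n. of_real (2 * pi) * (of_real (\<rho> ^ n) * a n * cis (real n * x) + of_real (\<rho> ^ n) * b n * cis (- (real n * x)))) sums (\<integral>t. ?k t * g t \<partial>circ)"
      by simp
    from sums_divide[OF this, of "of_real (2*pi)"] show ?thesis
      unfolding poisson_integral_circ by simp
  qed
  then show ?thesis unfolding trig_series_def using sum sa sb by blast
qed

text \<open>
  Both sides multiply the Fourier coefficient of frequency \<open>n\<close> by \<open>(\<rho> * \<sigma>) ^ \<bar>n\<bar>\<close>.
\<close>
lemma poisson_semigroup:
  assumes F: "integrable circ F" and "0 \<le> \<rho>" "\<rho> < 1" "0 \<le> \<sigma>" "\<sigma> < 1"
  shows "poisson_integral \<rho> (poisson_integral \<sigma> F) = poisson_integral (\<rho> * \<sigma>) F"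
proof
  fix x
  have l: "\<rho> * \<sigma> < 1" using assms using mult_strict_mono[of \<rho> 1 \<sigma> 1] by (cases "\<sigma> = 0") auto
  show "poisson_integral \<rho> (poisson_integral \<sigma> F) x = poisson_integral (\<rho> * \<sigma>) F x"
    using poisson_trig_series[OF poisson_integral_series[OF F assms(4,5)] assms(2,3)]
      poisson_integral_series[OF F, of "\<rho> * \<sigma>"] l assms
    by (auto simp: trig_series_def power_mult_distrib mult.assoc intro: sums_unique2)
qed

section \<open>Doubling the variable and the growth of Poisson integrals\<close>
lemma integrable_circ_double:
  fixes f :: "real \<Rightarrow> complex"
  assumes f: "integrable circ f" and per: "\<And>x. f (x + 2 * pi) = f x"
  shows "integrable circ (\<lambda>t. f (2 * t))"
proof -
  have "f integrable_on {-pi..pi}" "(\<lambda>x. norm (f x)) integrable_on {-pi..pi}"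
    using f unfolding integrable_circ_iff[symmetric] absolutely_integrable_on_def by auto
  then have "(\<lambda>t. f (2 * t)) integrable_on {-pi..pi}" "(\<lambda>x. norm (f (2 * x))) integrable_on {-pi..pi}"
    using has_integral_periodic_double[of f, OF per] has_integral_periodic_double[of "\<lambda>x. norm (f x)"] per
    unfolding integrable_on_def by auto
  then show ?thesis unfolding integrable_circ_iff[symmetric] absolutely_integrable_on_def by auto
qed

lemma integral_circ_double:
  fixes g :: "real \<Rightarrow> complex"
  assumes "integrable circ g" "\<And>x. g (x + 2 * pi) = g x"
  shows "(\<integral>t. g (2 * t) \<partial>circ) = (\<integral>t. g t \<partial>circ)"
  using has_integral_periodic_double[OF assms(2) integral_circ_HK[OF assms(1)]]
    integral_circ_HK[OF integrable_circ_double[OF assms]] has_integral_unique by blast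

text \<open>
  The function \<open>f (2 t)\<close> has period \<open>pi\<close>, so the kernel may be averaged over the shift by \<open>pi\<close>;
  by \<open>poisson_kernel_double\<close> the average is a Poisson kernel in the doubled variable.
\<close>
lemma poisson_integral_double:
  fixes f :: "real \<Rightarrow> complex"
  assumes f: "integrable circ f" and per: "\<And>x. f (x + 2 * pi) = f x" and \<rho>: "0 \<le> \<rho>" "\<rho> < 1"
  shows "poisson_integral \<rho> (\<lambda>t. f (2 * t)) x = poisson_integral (\<rho>\<^sup>2) f (2 * x)"
proof -
  let ?F = "\<lambda>t. f (2 * t)"
  have r2: "0 \<le> \<rho>\<^sup>2" "\<rho>\<^sup>2 < 1" using \<rho> by (auto simp: power_less_one_iff abs_square_less_1)
  have F: "integrable circ ?F" by (rule integrable_circ_double[OF f per])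
  let ?k = "\<lambda>t. complex_of_real (poisson_kernel \<rho> t)"
  let ?g = "\<lambda>t. ?k (x - t) * ?F t"
  have Fp: "?F (t + pi) = ?F t" for t using per[of "2 * t"] by (simp add: distrib_left)
  have kp: "poisson_kernel \<rho> (x - (t + pi)) = poisson_kernel \<rho> (x - t + pi)" for t
    using poisson_kernel_periodic[of \<rho> "x - (t + pi)"] by (simp add: algebra_simps)
  have i1: "integrable circ ?g" by (rule integrable_kernel_mult[OF F \<rho>])
  have i2: "integrable circ (\<lambda>t. ?g (t + pi))"
    using integrable_kernel_mult[OF F \<rho>, of "x + pi"] Fp kp by (simp add: algebra_simps)
  have gper: "?g (t + 2 * pi) = ?g t" for t
    using poisson_kernel_periodic[of \<rho> "x - (t + 2 * pi)"] per[of "2 * t"] per[of "2 * t + 2 * pi"]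
    by (simp add: algebra_simps)
  have "(\<integral>t. ?g (t + pi) \<partial>circ) = (\<integral>t. ?g t \<partial>circ)"
    by (rule integral_circ_shift[OF i1 i2 gper])
  then have "2 * (\<integral>t. ?g t \<partial>circ) = (\<integral>t. ?g t + ?g (t + pi) \<partial>circ)"
    using i1 i2 by simp
  also have "\<dots> = (\<integral>t. 2 * (complex_of_real (poisson_kernel (\<rho>\<^sup>2) (2 * x - 2 * t)) * f (2 * t)) \<partial>circ)"
  proof (intro Bochner_Integration.integral_cong refl)
    fix t
    have "?g t + ?g (t + pi) = complex_of_real (poisson_kernel \<rho> (x - t) + poisson_kernel \<rho> (x - t + pi)) * f (2 * t)"
      unfolding kp Fp by (simp add: distrib_right)
    also have "\<dots> = 2 * (complex_of_real (poisson_kernel (\<rho>\<^sup>2) (2 * x - 2 * t)) * f (2 * t))"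
      unfolding poisson_kernel_double[OF \<rho>] by (simp add: right_diff_distrib)
    finally show "?g t + ?g (t + pi) = \<dots>" .
  qed
  also have "\<dots> = 2 * (\<integral>t. complex_of_real (poisson_kernel (\<rho>\<^sup>2) (2 * x - 2 * t)) * f (2 * t) \<partial>circ)"
    by simp
  also have "(\<integral>t. complex_of_real (poisson_kernel (\<rho>\<^sup>2) (2 * x - 2 * t)) * f (2 * t) \<partial>circ)
    = (\<integral>t. complex_of_real (poisson_kernel (\<rho>\<^sup>2) (2 * x - t)) * f t \<partial>circ)"
  proof (rule integral_circ_double[of "\<lambda>t. complex_of_real (poisson_kernel (\<rho>\<^sup>2) (2 * x - t)) * f t"])
    show "integrable circ (\<lambda>t. complex_of_real (poisson_kernel (\<rho>\<^sup>2) (2 * x - t)) * f t)"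
      by (rule integrable_kernel_mult[OF f r2])
    show "complex_of_real (poisson_kernel (\<rho>\<^sup>2) (2 * x - (t + 2 * pi))) * f (t + 2 * pi) =
      complex_of_real (poisson_kernel (\<rho>\<^sup>2) (2 * x - t)) * f t" for t
      using poisson_kernel_periodic[of "\<rho>\<^sup>2" "2 * x - (t + 2 * pi)"] per[of t] by simp
  qed
  finally show ?thesis by (simp add: poisson_integral_circ)
qed

lemma nn_integral_maximal_le:
  assumes "hardy_norm q f \<le> ennreal A" "A > 0" "q > 0"
  shows "(\<integral>\<^sup>+x. ennreal_powr (poisson_maximal f x) q \<partial>circ) \<le> ennreal (A powr q)"
proof -
  let ?I = "\<integral>\<^sup>+x. ennreal_powr (poisson_maximal f x) q \<partial>circ"
  have h: "ennreal_powr ?I (1 / q) \<le> ennreal A"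
    using assms(1) by (simp add: hardy_norm_def nn_set_integral_circ)
  show ?thesis
  proof (cases "?I = \<infinity>")
    case True then show ?thesis using h by (simp add: ennreal_powr_def top_unique)
  next
    case False
    then have "?I < top" by (simp add: less_top)
    then obtain r where r: "?I = ennreal r" "r \<ge> 0" by (auto simp: less_top_ennreal)
    then have "r powr (1/q) \<le> A" using h assms by (simp add: ennreal_powr_def)
    then have "(r powr (1/q)) powr q \<le> A powr q" using assms by (intro powr_mono2) auto
    then show ?thesis using r assms by (simp add: powr_powr)
  qed
qed

lemma ennreal_powr_mono: "0 < a \<Longrightarrow> 0 \<le> x \<Longrightarrow> ennreal x \<le> y \<Longrightarrow> ennreal (x powr a) \<le> ennreal_powr y a"
  unfolding ennreal_powr_def
  by (cases y) (auto intro!: ennreal_leI powr_mono2)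

lemma poisson_le_maximal:
  "0 \<le> \<rho> \<Longrightarrow> \<rho> < 1 \<Longrightarrow> ennreal (norm (poisson_integral \<rho> f x)) \<le> poisson_maximal f x"
  unfolding poisson_maximal_def by (intro SUP_upper) auto

text \<open>
  The maximum over finitely many radii is continuous and periodic, so that the change of variable
  \<open>t \<mapsto> 2 t\<close> is available for it.
\<close>
lemma nn_integral_Max_poisson:
  fixes f :: "real \<Rightarrow> complex"
  assumes f: "integrable circ f" and per: "\<And>x. f (x + 2 * pi) = f x"
    and A: "hardy_norm q f \<le> ennreal A" "A > 0" "q > 0"
    and R: "finite R" "R \<noteq> {}" "\<And>\<rho>. \<rho> \<in> R \<Longrightarrow> 0 \<le> \<rho> \<and> \<rho> < 1"
  shows "(\<integral>\<^sup>+t. ennreal (Max ((\<lambda>\<rho>. norm (poisson_integral \<rho> (\<lambda>t. f (2 * t)) t)) ` R) powr q) \<partial>circ) \<le> ennreal (A powr q)"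
proof -
  define \<phi> where "\<phi> t = Max ((\<lambda>\<rho>. norm (poisson_integral (\<rho>\<^sup>2) f t)) ` R)" for t
  have r2: "0 \<le> \<rho>\<^sup>2 \<and> \<rho>\<^sup>2 < 1" if "\<rho> \<in> R" for \<rho> using R(3)[OF that] by (auto simp: power_less_one_iff abs_square_less_1)
  have cp: "cper (poisson_integral (\<rho>\<^sup>2) f)" if "\<rho> \<in> R" for \<rho> using r2[OF that] f by (intro cper_poisson_integral) auto
  have [measurable]: "\<phi> \<in> borel_measurable borel"
    unfolding \<phi>_def[abs_def] using R cper_borel[OF cp] by (intro borel_measurable_Max) auto
  have pper: "\<phi> (t + 2 * pi) = \<phi> t" for t
    unfolding \<phi>_def using cper_per[OF cp] by (intro arg_cong[of _ _ Max] image_cong) auto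
  have "(\<integral>\<^sup>+t. ennreal (Max ((\<lambda>\<rho>. norm (poisson_integral \<rho> (\<lambda>t. f (2 * t)) t)) ` R) powr q) \<partial>circ)
     = (\<integral>\<^sup>+t. ennreal (\<phi> (2 * t) powr q) \<partial>circ)"
    unfolding \<phi>_def using R(3) poisson_integral_double[OF f per] by (intro nn_integral_cong) (auto intro!: arg_cong[of _ _ "\<lambda>S. Max S powr q"] image_cong)
  also have "\<dots> = (\<integral>\<^sup>+t. ennreal (\<phi> t powr q) \<partial>circ)"
    by (rule nn_integral_periodic_double) (auto simp: pper)
  also have "\<dots> \<le> (\<integral>\<^sup>+x. ennreal_powr (poisson_maximal f x) q \<partial>circ)"
  proof (intro nn_integral_mono ennreal_powr_mono)
    fix t
    have "\<phi> t \<in> (\<lambda>\<rho>. norm (poisson_integral (\<rho>\<^sup>2) f t)) ` R" unfolding \<phi>_def using R by (intro Max_in) auto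
    then obtain \<rho> where "\<rho> \<in> R" "\<phi> t = norm (poisson_integral (\<rho>\<^sup>2) f t)" by auto
    then show "0 \<le> \<phi> t" "ennreal (\<phi> t) \<le> poisson_maximal f t" using r2 poisson_le_maximal by auto
  qed (use A in auto)
  also have "\<dots> \<le> ennreal (A powr q)" by (rule nn_integral_maximal_le[OF A])
  finally show ?thesis .
qed

lemma one_minus_exp_ge:
  assumes "0 \<le> y" "y \<le> (1::real)" shows "y / 2 \<le> 1 - exp (- y)"
proof -
  have "exp (-y) * (1 + y) \<le> exp (-y) * exp y" using exp_ge_add_one_self[of y] by (intro mult_left_mono) auto
  then have "exp (-y) * (1 + y) \<le> 1" by (simp flip: exp_add)
  moreover have "1 \<le> (1 - y/2) * (1 + y)" using assms mult_nonneg_nonneg[of y "1 - y"] by (simp add: algebra_simps)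
  ultimately have "exp (-y) * (1 + y) \<le> (1 - y/2) * (1 + y)" by linarith
  then show ?thesis using assms by simp
qed

lemma poisson_kernel_exp_bound:
  assumes "0 < \<eta>" "\<eta> \<le> 1" shows "poisson_kernel (exp (-\<eta>)) x \<le> 4 / \<eta>"
proof -
  have "poisson_kernel (exp (-\<eta>)) x \<le> 2 / (1 - exp (-\<eta>))" using assms by (intro poisson_kernel_bound) auto
  also have "\<dots> \<le> 2 / (\<eta> / 2)" using assms one_minus_exp_ge[of \<eta>] by (intro divide_left_mono) auto
  finally show ?thesis by simp
qed

lemma integral_circ_scale:
  fixes a w :: "real \<Rightarrow> real"
  shows "(\<integral>s. a s * (B * w s) \<partial>circ) / d = B * ((\<integral>s. a s * w s \<partial>circ) / d)"
proof -
  have "(\<lambda>s. a s * (B * w s)) = (\<lambda>s. B * (a s * w s))" by (simp add: fun_eq_iff)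
  then show ?thesis by simp
qed

text \<open>
  The growth of \<open>u \<eta> = \<bar>P \<eta> F\<bar>\<close> as \<open>\<eta> \<rightarrow> 0\<close>, from \<open>L\<^sup>q\<close> bounds that are uniform in \<open>\<eta>\<close>. By the
  semigroup law \<open>u \<eta>\<close> is at most the Poisson average of \<open>u (\<eta> / 2)\<close>, whose kernel is at most
  \<open>8 / \<eta>\<close>.
  For \<open>q \<ge> 1\<close> one splits \<open>u \<le> \<Lambda> + \<Lambda> powr (1 - q) * u powr q\<close> at the height \<open>\<Lambda> = A \<eta> powr (-1/q)\<close>.
  For \<open>q < 1\<close> one writes \<open>u = u powr q * u powr (1 - q)\<close> and estimates the second factor by the supremum
  at \<open>\<eta> / 2\<close>. The normalised supremum \<open>D\<close> of \<open>\<eta> powr (1/q) * u \<eta>\<close> over all \<open>\<eta> \<le> 1\<close> is finite, because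
  \<open>u \<eta>\<close> is at most a multiple of \<open>1 / \<eta>\<close>, and satisfies \<open>D \<le> K * D powr (1 - q) * A powr q\<close>, whence
  \<open>D\<close> is at most a multiple of \<open>A\<close>.
\<close>
lemma poisson_sup_bound:
  assumes q: "0 < q"
  shows "\<exists>C>0. \<forall>F A. integrable circ F \<and> A > 0 \<and>
     (\<forall>\<eta>>0. (\<integral>\<^sup>+t. ennreal (norm (poisson_integral (exp (-\<eta>)) F t) powr q) \<partial>circ) \<le> ennreal (A powr q)) \<longrightarrow>
     (\<forall>\<eta> t. 0 < \<eta> \<and> \<eta> \<le> 1 \<longrightarrow> norm (poisson_integral (exp (-\<eta>)) F t) \<le> C * A * \<eta> powr (-1 / q))"
proof -
  define C where "C = max 3 ((2 * 2 powr ((1 - q) / q)) powr (1 / q))"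
  have "norm (poisson_integral (exp (-\<eta>)) F t) \<le> C * A * \<eta> powr (-1 / q)"
    if F: "integrable circ F" and A: "A > 0"
      and int: "\<And>\<eta>. \<eta> > 0 \<Longrightarrow> (\<integral>\<^sup>+t. ennreal (norm (poisson_integral (exp (-\<eta>)) F t) powr q) \<partial>circ) \<le> ennreal (A powr q)"
      and \<eta>: "0 < \<eta>" "\<eta> \<le> 1" for F A \<eta> t
  proof -
    define u where "u \<eta> t = norm (poisson_integral (exp (-\<eta>)) F t)" for \<eta> t
    have u0: "0 \<le> u \<eta> t" for \<eta> t by (simp add: u_def)
    have cp: "cper (poisson_integral (exp (-\<eta>)) F)" if "\<eta> > 0" for \<eta>
      using F that by (intro cper_poisson_integral) auto
    have cu: "continuous_on S (u \<eta>)" if "\<eta> > 0" for \<eta> S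
      unfolding u_def using cper_cont[OF cp[OF that]] by (intro continuous_intros)
    have cuq: "continuous_on S (\<lambda>t. u \<eta> t powr q)" if "\<eta> > 0" for \<eta> S
      using cu[OF that] q u0 by (intro continuous_on_powr') auto
    have iuq: "integrable circ (\<lambda>t. u \<eta> t powr q)" if "\<eta> > 0" for \<eta>
      using cuq[OF that] by (rule integrable_circ_continuous)
    have uA: "(\<integral>t. u \<eta> t powr q \<partial>circ) \<le> A powr q" if "\<eta> > 0" for \<eta>
    proof -
      have "ennreal (\<integral>t. u \<eta> t powr q \<partial>circ) \<le> ennreal (A powr q)"
        using int[OF that] iuq[OF that] by (subst nn_integral_eq_integral[symmetric]) (auto simp: u_def)
      then show ?thesis by simp
    qed
    have step: "u \<eta> t \<le> (\<integral>s. poisson_kernel (exp (-(\<eta>/2))) (t - s) * u (\<eta>/2) s \<partial>circ) / (2 * pi)"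
      if "0 < \<eta>" for \<eta> t
    proof -
      have "poisson_integral (exp (-\<eta>)) F = poisson_integral (exp (-(\<eta>/2))) (poisson_integral (exp (-(\<eta>/2))) F)"
        using that by (subst poisson_semigroup[OF F]) (auto simp flip: exp_add)
      then show ?thesis unfolding u_def
        using poisson_norm_le[of "exp (-(\<eta>/2))" "poisson_integral (exp (-(\<eta>/2))) F" t] that by simp
    qed
    have ik: "integrable circ (\<lambda>s. poisson_kernel (exp (-\<eta>)) (t - s) * g s)" if "\<eta> > 0" "continuous_on {-pi..pi} g" for \<eta> t and g :: "real \<Rightarrow> real"
      using that by (intro integrable_circ_continuous continuous_intros continuous_poisson_kernel) auto
    have kq: "(\<integral>s. poisson_kernel (exp (-(\<eta>/2))) (t - s) * (u (\<eta>/2) s powr q) \<partial>circ) / (2 * pi) \<le> 2 / \<eta> * A powr q"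
      if "0 < \<eta>" "\<eta> \<le> 1" for \<eta> t
    proof -
      have "(\<integral>s. poisson_kernel (exp (-(\<eta>/2))) (t - s) * (u (\<eta>/2) s powr q) \<partial>circ) \<le> (\<integral>s. 8 / \<eta> * (u (\<eta>/2) s powr q) \<partial>circ)"
        using that ik[of "\<eta>/2" "\<lambda>s. u (\<eta>/2) s powr q" t] iuq[of "\<eta>/2"] cuq[of "\<eta>/2"] poisson_kernel_exp_bound[of "\<eta>/2"]
        by (intro integral_mono mult_right_mono) auto
      also have "\<dots> \<le> 8 / \<eta> * A powr q" using uA[of "\<eta>/2"] that by (simp add: divide_right_mono mult_left_mono)
      finally have "(\<integral>s. poisson_kernel (exp (-(\<eta>/2))) (t - s) * (u (\<eta>/2) s powr q) \<partial>circ) / (2 * pi) \<le> (8 / \<eta> * A powr q) / (2 * pi)"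
        by (intro divide_right_mono) auto
      also have "\<dots> \<le> (8 / \<eta> * A powr q) / 4"
        using that pi_gt3 by (intro divide_left_mono) auto
      finally show ?thesis by simp
    qed
    have "u \<eta> t \<le> C * A * \<eta> powr (-1 / q)"
    proof (cases "q \<ge> 1")
      case True
      define L where "L = A * \<eta> powr (-1 / q)"
      have L: "L > 0" using A \<eta> by (simp add: L_def)
      have young: "x \<le> L + L powr (1 - q) * x powr q" if "0 \<le> x" for x
      proof (cases "x \<le> L")
        case False
        then have "x = x powr (1 - q) * x powr q" using L by (simp flip: powr_add)
        also have "\<dots> \<le> L powr (1 - q) * x powr q"
          using False L True by (intro mult_right_mono powr_mono2') auto
        finally show ?thesis using L by linarith
      qed (use L in \<open>simp add: add_increasing2\<close>)
      have "u \<eta> t \<le> (\<integral>s. poisson_kernel (exp (-(\<eta>/2))) (t - s) * u (\<eta>/2) s \<partial>circ) / (2 * pi)"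
        using step \<eta> by blast
      also have "\<dots> \<le> (\<integral>s. poisson_kernel (exp (-(\<eta>/2))) (t - s) * (L + L powr (1 - q) * u (\<eta>/2) s powr q) \<partial>circ) / (2 * pi)"
        using \<eta> young[OF u0] cu[of "\<eta>/2"] cuq[of "\<eta>/2"]
        by (intro divide_right_mono integral_mono ik mult_left_mono continuous_on_add continuous_on_mult continuous_on_const) auto
      also have "\<dots> = (\<integral>s. poisson_kernel (exp (-(\<eta>/2))) (t - s) * L + L powr (1 - q) * (poisson_kernel (exp (-(\<eta>/2))) (t - s) * u (\<eta>/2) s powr q) \<partial>circ) / (2 * pi)"
        by (simp add: algebra_simps)
      also have "\<dots> = L + L powr (1 - q) * ((\<integral>s. poisson_kernel (exp (-(\<eta>/2))) (t - s) * (u (\<eta>/2) s powr q) \<partial>circ) / (2 * pi))"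
        using \<eta> ik[of "\<eta>/2" "\<lambda>s. u (\<eta>/2) s powr q" t] ik[of "\<eta>/2" "\<lambda>s. L" t] cuq[of "\<eta>/2"]
        by (subst Bochner_Integration.integral_add) (auto simp: integral_poisson_kernel add_divide_distrib)
      also have "\<dots> \<le> L + L powr (1 - q) * (2 / \<eta> * A powr q)"
        using kq[OF \<eta>] by (intro add_left_mono mult_left_mono) auto
      also have "L powr (1 - q) * (2 / \<eta> * A powr q) = 2 * L"
      proof -
        have "L powr (1 - q) = A powr (1 - q) * \<eta> powr (-1/q * (1 - q))"
          using A \<eta> by (simp add: L_def powr_mult powr_powr)
        also have "-1/q * (1 - q) = -1/q + 1" using q by (simp add: field_simps)
        finally have "L powr (1 - q) = A powr (1 - q) * (\<eta> powr (-1/q) * \<eta>)"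
          using \<eta> by (simp only: powr_add) simp
        then have "L powr (1 - q) * (2 / \<eta> * A powr q) = 2 * (A powr (1 - q) * A powr q) * \<eta> powr (-1/q)"
          using \<eta> by simp
        also have "A powr (1 - q) * A powr q = A" using A by (simp flip: powr_add)
        finally show ?thesis by (simp add: L_def)
      qed
      also have "L + 2 * L = 3 * A * \<eta> powr (-1/q)" by (simp add: L_def)
      also have "\<dots> \<le> C * A * \<eta> powr (-1/q)" using A by (intro mult_right_mono) (auto simp: C_def)
      finally show ?thesis .
    next
      case False
      define K where "K = 2 * 2 powr ((1 - q) / q)"
      have K: "K > 0" by (simp add: K_def)
      define X where "X = {\<eta> powr (1/q) * u \<eta> t | \<eta> t. 0 < \<eta> \<and> \<eta> \<le> 1}"
      define D where "D = Sup X"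
      define N where "N = (\<integral>t. norm (F t) \<partial>circ)"
      \<comment> \<open>A bound that may depend on \<open>F\<close>; it only serves to make the supremum \<open>D\<close> finite.\<close>
      have "\<eta> powr (1/q) * u \<eta> t \<le> N" if "0 < \<eta>" "\<eta> \<le> 1" for \<eta> t
      proof -
        have "u \<eta> t \<le> (\<integral>s. \<bar>poisson_kernel (exp (-\<eta>)) (t - s)\<bar> * norm (F s) \<partial>circ) / (2 * pi)"
          unfolding u_def by (rule poisson_norm_le)
        also have "\<dots> \<le> (\<integral>s. 4 / \<eta> * norm (F s) \<partial>circ) / (2 * pi)"
          using that F poisson_kernel_exp_bound[OF that]
          by (intro divide_right_mono integral_mono' mult_right_mono) auto
        also have "\<dots> = 4 / \<eta> * N / (2 * pi)" by (simp add: N_def)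
        also have "\<dots> \<le> 4 / \<eta> * N / 4" using pi_gt3 that by (intro divide_left_mono) (auto simp: N_def)
        finally have "\<eta> powr (1/q) * u \<eta> t \<le> \<eta> powr (1/q) * (N / \<eta>)" by (intro mult_left_mono) auto
        also have "\<dots> = \<eta> powr (1/q - 1) * N" using that by (simp add: powr_diff)
        also have "\<dots> \<le> 1 * N" using that q False by (intro mult_right_mono powr_le1) (auto simp: N_def field_simps)
        finally show ?thesis by simp
      qed
      then have "bdd_above X" unfolding X_def by (intro bdd_aboveI[of _ N]) auto
      then have DX: "\<eta> powr (1/q) * u \<eta> t \<le> D" if "0 < \<eta>" "\<eta> \<le> 1" for \<eta> t
        unfolding D_def using that by (intro cSup_upper) (auto simp: X_def)
      have D0: "0 \<le> D" using DX[of 1 0] u0[of 1 0] by (simp)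
      have "D \<le> K * D powr (1 - q) * A powr q"
        unfolding D_def
      proof (intro cSup_least)
        show "X \<noteq> {}" unfolding X_def using zero_less_one by blast
        fix y assume "y \<in> X"
        then obtain e t where e: "0 < e" "e \<le> 1" and y: "y = e powr (1/q) * u e t" by (auto simp: X_def)
        have le: "u (e/2) s \<le> (D * (e/2) powr (-1/q)) powr (1 - q) * u (e/2) s powr q" for s
        proof (cases "u (e/2) s = 0")
          case False
          then have "u (e/2) s = u (e/2) s powr (1 - q) * u (e/2) s powr q" using u0[of "e/2" s] by (simp flip: powr_add)
          moreover have "u (e/2) s \<le> D * (e/2) powr (-1/q)"
            using DX[of "e/2" s] e by (simp add: powr_minus field_simps)
          then have "u (e/2) s powr (1 - q) \<le> (D * (e/2) powr (-1/q)) powr (1 - q)"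
            using u0 \<open>\<not> q \<ge> 1\<close> by (intro powr_mono2) auto
          ultimately show ?thesis by (metis mult_right_mono powr_ge_zero)
        qed simp
        have "u e t \<le> (\<integral>s. poisson_kernel (exp (-(e/2))) (t - s) * u (e/2) s \<partial>circ) / (2 * pi)"
          using step e by blast
        also have "\<dots> \<le> (\<integral>s. poisson_kernel (exp (-(e/2))) (t - s) * ((D * (e/2) powr (-1/q)) powr (1 - q) * u (e/2) s powr q) \<partial>circ) / (2 * pi)"
          using e le cu[of "e/2"] cuq[of "e/2"]
          by (intro divide_right_mono integral_mono ik mult_left_mono continuous_on_mult continuous_on_const) auto
        also have "\<dots> = (D * (e/2) powr (-1/q)) powr (1 - q) * ((\<integral>s. poisson_kernel (exp (-(e/2))) (t - s) * (u (e/2) s powr q) \<partial>circ) / (2 * pi))"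
          by (rule integral_circ_scale)
        also have "\<dots> \<le> (D * (e/2) powr (-1/q)) powr (1 - q) * (2 / e * A powr q)"
          using kq[OF e] by (intro mult_left_mono) auto
        finally have "y \<le> e powr (1/q) * ((D * (e/2) powr (-1/q)) powr (1 - q) * (2 / e * A powr q))"
          unfolding y by (intro mult_left_mono) auto
        also have "(D * (e/2) powr (-1/q)) powr (1 - q) = D powr (1 - q) * (e powr (1 - 1/q) * 2 powr ((1-q)/q))"
        proof -
          have ex: "-1/q * (1 - q) = 1 - 1/q" using q by (simp add: field_simps)
          have "(D * (e/2) powr (-1/q)) powr (1 - q) = D powr (1 - q) * ((e/2) powr (-1/q)) powr (1 - q)"
            using D0 e by (simp add: powr_mult)
          also have "((e/2) powr (-1/q)) powr (1 - q) = (e/2) powr (1 - 1/q)" unfolding powr_powr ex ..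
          finally have "(D * (e/2) powr (-1/q)) powr (1 - q) = D powr (1 - q) * (e/2) powr (1 - 1/q)" .
          also have "(e/2) powr (1 - 1/q) = e powr (1 - 1/q) * 2 powr (- (1 - 1/q))"
            unfolding powr_minus using e by (subst powr_divide) (simp_all only: divide_inverse less_imp_le zero_le_numeral)
          also have "- (1 - 1/q) = (1 - q) / q" using q by (simp add: field_simps)
          finally show ?thesis .
        qed
        also have "e powr (1/q) * (D powr (1 - q) * (e powr (1 - 1/q) * 2 powr ((1-q)/q)) * (2 / e * A powr q))
          = (e powr (1/q) * e powr (1 - 1/q)) / e * (K * D powr (1 - q) * A powr q)"
          by (simp add: K_def)
        also have "e powr (1/q) * e powr (1 - 1/q) = e" using e by (simp flip: powr_add)
        finally show "y \<le> K * (Sup X) powr (1 - q) * A powr q" using e by (simp add: D_def)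
      qed
      have "D \<le> K powr (1/q) * A"
      proof (cases "D = 0")
        case False
        then have "D > 0" using D0 by simp
        have "D powr (1 - q) * D powr q = D" using \<open>D > 0\<close> by (simp flip: powr_add)
        then have "D powr (1 - q) * D powr q \<le> D powr (1 - q) * (K * A powr q)"
          using \<open>D \<le> K * D powr (1 - q) * A powr q\<close> by (simp add: mult_ac)
        then have "D powr q \<le> K * A powr q" using \<open>D > 0\<close> by simp
        then have "(D powr q) powr (1/q) \<le> (K * A powr q) powr (1/q)" using q by (intro powr_mono2) auto
        then show ?thesis using q A K \<open>D > 0\<close> by (simp add: powr_mult powr_powr)
      qed (use A in simp)
      also have "\<dots> \<le> C * A" using A by (intro mult_right_mono) (auto simp: C_def K_def)
      finally have "\<eta> powr (1/q) * u \<eta> t \<le> C * A" using DX[OF \<eta>, of t] by linarith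
      then show ?thesis using \<eta> by (simp add: powr_minus field_simps)
    qed
    then show ?thesis by (simp add: u_def)
  qed
  moreover have "C > 0" by (simp add: C_def max.strict_coboundedI1)
  ultimately show ?thesis by blast
qed

section \<open>The defect of the Poisson semigroup\<close>
text \<open>
  Parametrised by \<open>\<tau>\<close> instead of the radius, Poisson integrals form a semigroup for addition.
\<close>
definition pois :: "real \<Rightarrow> (real \<Rightarrow> complex) \<Rightarrow> real \<Rightarrow> complex" where
  "pois \<tau> g = poisson_integral (exp (-\<tau>)) g"

text \<open>
  The operator \<open>I - P \<tau>\<close>. Its powers play the role of differences of high order.
\<close>
definition defect :: "real \<Rightarrow> (real \<Rightarrow> complex) \<Rightarrow> real \<Rightarrow> complex" where
  "defect \<tau> g x = g x - pois \<tau> g x"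

definition avg :: "real \<Rightarrow> (real \<Rightarrow> complex) \<Rightarrow> real \<Rightarrow> complex" where
  "avg h g x = integral {0..1} (\<lambda>s. g (x + h * s))"

lemma cper_pois: "integrable circ F \<Longrightarrow> 0 < \<tau> \<Longrightarrow> cper (pois \<tau> F)"
  by (simp add: pois_def cper_poisson_integral)

lemma pois_pois: "integrable circ F \<Longrightarrow> 0 < \<sigma> \<Longrightarrow> 0 < \<tau> \<Longrightarrow> pois \<sigma> (pois \<tau> F) = pois (\<sigma> + \<tau>) F"
  by (simp add: pois_def poisson_semigroup exp_add[symmetric])

lemma pois_add: "cper f \<Longrightarrow> cper g \<Longrightarrow> 0 < \<tau> \<Longrightarrow> pois \<tau> (\<lambda>x. f x + g x) = (\<lambda>x. pois \<tau> f x + pois \<tau> g x)"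
  and pois_diff: "cper f \<Longrightarrow> cper g \<Longrightarrow> 0 < \<tau> \<Longrightarrow> pois \<tau> (\<lambda>x. f x - g x) = (\<lambda>x. pois \<tau> f x - pois \<tau> g x)"
  and pois_cmult: "cper f \<Longrightarrow> 0 < \<tau> \<Longrightarrow> pois \<tau> (\<lambda>x. a * f x) = (\<lambda>x. a * pois \<tau> f x)"
  by (auto simp: pois_def fun_eq_iff poisson_integral_lincomb[of f g] poisson_integral_lincomb(3)[of f f] cper_integrable)

lemma cper_add: "cper f \<Longrightarrow> cper g \<Longrightarrow> cper (\<lambda>x. f x + g x)"
  and cper_diff: "cper f \<Longrightarrow> cper g \<Longrightarrow> cper (\<lambda>x. f x - g x)"
  and cper_cmult: "cper f \<Longrightarrow> cper (\<lambda>x. a * f x)"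
  and cper_zero: "cper (\<lambda>x. 0)"
  by (auto simp: cper_def intro!: continuous_intros)

lemma cper_sum: "(\<And>i. i \<in> I \<Longrightarrow> cper (f i)) \<Longrightarrow> cper (\<lambda>x. \<Sum>i\<in>I. f i x)"
  by (auto simp: cper_def intro!: continuous_intros)

lemma cper_shift: "cper f \<Longrightarrow> cper (\<lambda>x. f (x + a))"
  unfolding cper_def
  by (auto intro!: continuous_on_compose2[of UNIV f] continuous_intros) (metis add.assoc add.commute)

lemma cper_fwd_diff: "cper f \<Longrightarrow> cper (fwd_diff h f)"
  unfolding fwd_diff_def[abs_def] by (intro cper_diff cper_shift)

lemma cper_defect: "cper f \<Longrightarrow> 0 < \<tau> \<Longrightarrow> cper (defect \<tau> f)"
  unfolding defect_def[abs_def] by (intro cper_diff cper_pois cper_integrable)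

lemma integral_circ_HK_eq:
  fixes g :: "real \<Rightarrow> complex"
  shows "integrable circ g \<Longrightarrow> (\<integral>t. g t \<partial>circ) = integral {-pi..pi} g"
  using integral_circ_HK by (metis integral_unique)

lemma pois_alt:
  assumes g: "cper g" and "0 < \<tau>"
  shows "pois \<tau> g x = (\<integral>r. complex_of_real (poisson_kernel (exp (-\<tau>)) r) * g (x + r) \<partial>circ) / complex_of_real (2 * pi)"
proof -
  let ?G = "\<lambda>t. complex_of_real (poisson_kernel (exp (-\<tau>)) (x - t)) * g t"
  have c: "continuous_on UNIV ?G" using assms
    by (intro continuous_intros continuous_poisson_kernel cper_cont) auto
  have "(\<integral>r. ?G (r + x) \<partial>circ) = (\<integral>t. ?G t \<partial>circ)"
  proof (rule integral_circ_shift)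
    show "integrable circ ?G" by (intro integrable_circ_continuous continuous_on_subset[OF c]) auto
    show "integrable circ (\<lambda>r. ?G (r + x))"
      by (intro integrable_circ_continuous continuous_on_compose2[OF c] continuous_intros) auto
    show "?G (t + 2 * pi) = ?G t" for t
      using cper_per[OF g, of t] poisson_kernel_periodic[of "exp (-\<tau>)" "x - (t + 2 * pi)"] by simp
  qed
  then show ?thesis by (simp add: pois_def poisson_integral_circ add.commute)
qed

lemma pois_shift: "cper g \<Longrightarrow> 0 < \<tau> \<Longrightarrow> pois \<tau> (\<lambda>x. g (x + a)) x = pois \<tau> g (x + a)"
  by (simp add: pois_alt cper_shift ac_simps)

lemma integral_circ_reflect:
  fixes g :: "real \<Rightarrow> complex"
  assumes "continuous_on UNIV g"
  shows "(\<integral>t. g (-t) \<partial>circ) = (\<integral>t. g t \<partial>circ)"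
proof -
  have "continuous_on UNIV (\<lambda>t. g (-t))" by (intro continuous_on_compose2[OF assms] continuous_intros) auto
  then have "integrable circ (\<lambda>t. g (-t))" "integrable circ g"
    using assms by (blast intro: integrable_circ_continuous continuous_on_subset)+
  then show ?thesis
    using Henstock_Kurzweil_Integration.integral_reflect_real[of pi "-pi" g] by (simp add: integral_circ_HK_eq)
qed

lemma pois_contraction: "0 < \<tau> \<Longrightarrow> (\<And>t. norm (g t) \<le> M) \<Longrightarrow> norm (pois \<tau> g x) \<le> M"
  unfolding pois_def by (intro poisson_contraction) auto

lemma defect_norm: "0 < \<tau> \<Longrightarrow> (\<And>t. norm (g t) \<le> M) \<Longrightarrow> norm (defect \<tau> g x) \<le> 2 * M"
  unfolding defect_def using pois_contraction[of \<tau> g M x]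
  by (intro order_trans[OF norm_triangle_ineq4]) (auto intro!: add_mono[of _ M _ M, simplified])

lemma defect_defect: 
  assumes "cper g" "0 < \<tau>"
  shows "defect \<tau> (defect \<tau> g) x = g x - 2 * pois \<tau> g x + pois (2 * \<tau>) g x"
proof -
  have "defect \<tau> g = (\<lambda>x. g x - pois \<tau> g x)" by (simp add: defect_def fun_eq_iff)
  then have "pois \<tau> (defect \<tau> g) x = pois \<tau> g x - pois (2 * \<tau>) g x"
    using pois_diff[OF assms(1) cper_pois[OF cper_integrable[OF assms(1)] assms(2)] assms(2)]
      pois_pois[OF cper_integrable[OF assms(1)] assms(2,2)] by simp
  then show ?thesis by (simp add: defect_def)
qed

definition smoothing_const :: real where "smoothing_const = pi\<^sup>2 * (2 + cosh 3) ^ 3 / 2"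

lemma smoothing_const_pos: "0 < smoothing_const"
  by (simp add: smoothing_const_def add_pos_pos)

text \<open>
  The kernel of \<open>(I - P \<tau>)\<^sup>2 - I\<close> is even with integral \<open>- 2 pi\<close>, so \<open>(I - P \<tau>)\<^sup>2\<close> integrates the symmetric second
  difference of \<open>g\<close>, of size \<open>M r\<^sup>2\<close>, against the fast decaying kernel of \<open>poisson_kernel_second_diff\<close>.
\<close>
lemma defect_defect_bound:
  assumes g: "cper g" and \<tau>: "0 < \<tau>" "\<tau> \<le> 3"
    and M: "\<And>r x. norm (fwd_diff r (fwd_diff r g) x) \<le> M * r\<^sup>2"
  shows "norm (defect \<tau> (defect \<tau> g) x) \<le> smoothing_const * \<tau>\<^sup>2 * M"
proof -
  define k where "k r = poisson_kernel (exp (-2 * \<tau>)) r - 2 * poisson_kernel (exp (-\<tau>)) r" for r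
  let ?k = "\<lambda>r. complex_of_real (k r)"
  let ?\<psi> = "\<lambda>r. g (x + r) + g (x - r) - 2 * g x"
  have M0: "0 \<le> M" using order_trans[OF norm_ge_zero M[of 1 0]] by simp
  have ck: "continuous_on S k" for S unfolding k_def using \<tau>
    by (intro continuous_intros continuous_poisson_kernel) auto
  have cg: "continuous_on S (\<lambda>r. g (x + r))" "continuous_on S (\<lambda>r. g (x - r))" for S
    by (rule continuous_on_compose2[OF cper_cont[OF g, of UNIV] _ subset_UNIV], intro continuous_intros)+
  have i1: "integrable circ (\<lambda>r. ?k r * g (x + r))" and i2: "integrable circ (\<lambda>r. ?k r * g (x - r))"
    and i3: "integrable circ (\<lambda>r. ?k r)" and i4: "integrable circ (\<lambda>r. ?k r * ?\<psi> r)"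
    by (intro integrable_circ_continuous continuous_intros ck cg)+
  have kp: "integrable circ (poisson_kernel (exp (-\<tau>)))" "integrable circ (poisson_kernel (exp (-2*\<tau>)))"
    using integrable_poisson_kernel[of "exp (-\<tau>)" 0] integrable_poisson_kernel[of "exp (-2*\<tau>)" 0] \<tau> by auto
  have "(\<integral>r. k r \<partial>circ) = - (2 * pi)"
    using integral_poisson_kernel[of "exp (-\<tau>)" 0] integral_poisson_kernel[of "exp (-2*\<tau>)" 0] \<tau> kp
    by (simp add: k_def)
  then have k1: "(\<integral>r. ?k r \<partial>circ) = - complex_of_real (2 * pi)" by (simp del: of_real_mult)
  have kpg: "integrable circ (\<lambda>r. complex_of_real (poisson_kernel (exp (-\<sigma>)) r) * g (x + r))" if "\<sigma> > 0" for \<sigma>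
    using that by (intro integrable_circ_continuous continuous_intros continuous_poisson_kernel cg) auto
  have "defect \<tau> (defect \<tau> g) x = g x + (\<integral>r. ?k r * g (x + r) \<partial>circ) / complex_of_real (2 * pi)"
    unfolding defect_defect[OF g \<tau>(1)] using kpg[of \<tau>] kpg[of "2*\<tau>"] \<tau> g
    by (simp add: pois_alt k_def left_diff_distrib mult.assoc diff_divide_distrib)
  also have "(\<integral>r. ?k r * g (x + r) \<partial>circ) = ((\<integral>r. ?k r * ?\<psi> r \<partial>circ) + 2 * g x * (\<integral>r. ?k r \<partial>circ)) / 2"
  proof -
    have "(\<integral>r. ?k r * g (x - r) \<partial>circ) = (\<integral>r. ?k r * g (x + r) \<partial>circ)"
    proof -
      have c: "continuous_on UNIV (\<lambda>r. ?k r * g (x + r))" by (intro continuous_intros ck cg)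
      have "k (-r) = k r" for r by (simp add: k_def)
      then show ?thesis using integral_circ_reflect[OF c] by simp
    qed
    moreover have "(\<integral>r. ?k r * ?\<psi> r \<partial>circ) = (\<integral>r. ?k r * g (x + r) \<partial>circ) + (\<integral>r. ?k r * g (x - r) \<partial>circ) - (\<integral>r. ?k r \<partial>circ) * (2 * g x)"
      using i1 i2 i3 by (simp add: distrib_left right_diff_distrib)
    ultimately show ?thesis by (simp add: algebra_simps)
  qed
  finally have eq: "defect \<tau> (defect \<tau> g) x = (\<integral>r. ?k r * ?\<psi> r \<partial>circ) / complex_of_real (4 * pi)"
    unfolding k1 by (simp add: field_simps)
  have bd: "norm (?k r * ?\<psi> r) \<le> (M * pi\<^sup>2 * (2 + cosh 3) ^ 3 * \<tau>\<^sup>2) * poisson_kernel (exp (-\<tau>)) r"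
    if r: "r \<in> {-pi..pi}" for r
  proof -
    have "?\<psi> r = fwd_diff r (fwd_diff r g) (x - r)" by (simp add: fwd_diff_def)
    then have "norm (?\<psi> r) \<le> M * r\<^sup>2" using M by simp
    also have "r\<^sup>2 \<le> pi\<^sup>2 * (chord r)\<^sup>2"
    proof -
      have "\<bar>r\<bar> \<le> pi * chord r" using chord_ge[of r] r by (auto simp: divide_le_eq mult.commute)
      from power_mono[OF this, of 2] show ?thesis by (simp add: power_mult_distrib)
    qed
    finally have "norm (?\<psi> r) \<le> M * (pi\<^sup>2 * (chord r)\<^sup>2)" using M0 by (simp add: mult_left_mono)
    then have "norm (?k r * ?\<psi> r) \<le> \<bar>k r\<bar> * (M * (pi\<^sup>2 * (chord r)\<^sup>2))"
      unfolding norm_mult by (simp add: mult_left_mono)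
    also have "\<dots> = M * pi\<^sup>2 * (\<bar>k r\<bar> * (chord r)\<^sup>2)" by simp
    also have "\<dots> \<le> M * pi\<^sup>2 * ((2 + cosh 3) ^ 3 * \<tau>\<^sup>2 * poisson_kernel (exp (-\<tau>)) r)"
      using poisson_kernel_second_diff[OF \<tau>, of r] M0 by (intro mult_left_mono) (auto simp: k_def)
    finally show ?thesis by simp
  qed
  have "norm (\<integral>r. ?k r * ?\<psi> r \<partial>circ) \<le> (\<integral>r. norm (?k r * ?\<psi> r) \<partial>circ)" by (rule integral_norm_bound)
  also have "\<dots> \<le> (\<integral>r. (M * pi\<^sup>2 * (2 + cosh 3) ^ 3 * \<tau>\<^sup>2) * poisson_kernel (exp (-\<tau>)) r \<partial>circ)"
    using bd i4 kp by (intro integral_mono integrable_norm) auto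
  also have "\<dots> = (M * pi\<^sup>2 * (2 + cosh 3) ^ 3 * \<tau>\<^sup>2) * (2 * pi)"
    using integral_poisson_kernel[of "exp (-\<tau>)" 0] \<tau> by simp
  finally have "norm (\<integral>r. ?k r * ?\<psi> r \<partial>circ) / (4 * pi) \<le> (M * pi\<^sup>2 * (2 + cosh 3) ^ 3 * \<tau>\<^sup>2) * (2 * pi) / (4 * pi)"
    by (intro divide_right_mono) auto
  then show ?thesis unfolding eq by (simp add: norm_divide norm_mult smoothing_const_def field_simps)
qed

lemma cont_shift_scale:
  fixes g :: "real \<Rightarrow> complex"
  shows "continuous_on UNIV g \<Longrightarrow> continuous_on S (\<lambda>s. g (x + h * s))"
  by (erule continuous_on_compose2[OF _ _ subset_UNIV]) (intro continuous_intros)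

lemma avg_integrable:
  fixes g :: "real \<Rightarrow> complex"
  shows "continuous_on UNIV g \<Longrightarrow> (\<lambda>s. g (x + h * s)) integrable_on {0..1}"
  by (intro integrable_continuous_real cont_shift_scale)

lemma cont_avg:
  assumes "continuous_on UNIV g" shows "continuous_on S (avg h g)"
proof -
  have "continuous_on (UNIV \<times> cbox 0 1) (\<lambda>(x, s). g (x + h * s))" unfolding case_prod_unfold
    by (rule continuous_on_compose2[OF assms _ subset_UNIV]) (intro continuous_intros)
  then have "continuous_on UNIV (\<lambda>x. integral (cbox 0 1) (\<lambda>s. g (x + h * s)))"
    by (rule integral_continuous_on_param)
  then show ?thesis unfolding avg_def[abs_def] by (auto intro: continuous_on_subset)
qed

lemma cper_avg: "cper g \<Longrightarrow> cper (avg h g)"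
  using cont_avg[of g UNIV h] cper_per[of g "_ + h * _"]
  by (auto simp: cper_def avg_def add.assoc add.commute[of "2 * pi"])

lemma avg_norm:
  assumes "continuous_on UNIV g" "\<And>s. s \<in> {0..1} \<Longrightarrow> norm (g (x + h * s)) \<le> M"
  shows "norm (avg h g x) \<le> M"
  using integral_bound[of 0 1 "\<lambda>s. g (x + h * s)" M] cont_shift_scale[OF assms(1), of "{0..1}" x h] assms(2)
  by (simp add: avg_def)

lemma avg_sum:
  assumes "\<And>i. i \<in> I \<Longrightarrow> continuous_on UNIV (f i)" "finite I"
  shows "avg h (\<lambda>x. \<Sum>i\<in>I. a i * f i x) = (\<lambda>x. \<Sum>i\<in>I. a i * avg h (f i) x)"
  using avg_integrable[OF assms(1)] assms(2) by (auto simp: avg_def fun_eq_iff integral_sum integrable_on_mult_right)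

lemma avg_fwd_diff:
  assumes "continuous_on UNIV g" shows "avg h (fwd_diff r g) = fwd_diff r (avg h g)"
proof
  fix x
  have "avg h (fwd_diff r g) x = integral {0..1} (\<lambda>s. g ((x + r) + h * s) - g (x + h * s))"
    by (simp add: avg_def fwd_diff_def algebra_simps)
  also have "\<dots> = avg h g (x + r) - avg h g x"
    unfolding avg_def by (intro Henstock_Kurzweil_Integration.integral_diff avg_integrable assms)
  finally show "avg h (fwd_diff r g) x = fwd_diff r (avg h g) x" by (simp add: fwd_diff_def)
qed

lemma avg_antideriv:
  assumes c: "continuous_on UNIV c" and C: "\<And>y. \<bar>y\<bar> < R \<Longrightarrow> (C has_vector_derivative c y) (at y)"
    and R: "\<bar>x\<bar> + \<bar>h\<bar> < R"
  shows "of_real h * avg h c x = C (x + h) - C x"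
proof -
  have "((\<lambda>s. h *\<^sub>R c (x + h * s)) has_integral (C (x + h * 1) - C (x + h * 0))) {0..1}"
  proof (rule fundamental_theorem_of_calculus)
    fix s :: real assume s: "s \<in> {0..1}"
    have "\<bar>h * s\<bar> \<le> \<bar>h\<bar> * 1" unfolding abs_mult using s by (intro mult_left_mono) auto
    then have lt: "\<bar>x + h * s\<bar> < R" using R by linarith
    have "((\<lambda>s. x + h * s) has_vector_derivative h) (at s within {0..1})"
      by (auto intro!: derivative_eq_intros)
    from vector_diff_chain_within[OF this has_vector_derivative_at_within[OF C[OF lt]]]
    show "((\<lambda>s. C (x + h * s)) has_vector_derivative h *\<^sub>R c (x + h * s)) (at s within {0..1})"
      by (simp add: o_def)
  qed simp
  then have "integral {0..1} (\<lambda>s. h *\<^sub>R c (x + h * s)) = C (x + h) - C x"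
    by (simp add: integral_unique del: integral_cmul)
  then show ?thesis by (simp add: avg_def scaleR_conv_of_real)
qed

text \<open>
  Both sides are the second difference \<open>C (x + h + r) - C (x + h) - C (x + r) + C x\<close> of an
  antiderivative \<open>C\<close>. So an average over length \<open>h\<close> turns a difference of step \<open>r\<close> into a difference
  of step \<open>h\<close> at the price of the factor \<open>r / h\<close>, as a derivative would.
\<close>
lemma fwd_diff_avg_swap:
  assumes c: "continuous_on UNIV c"
  shows "of_real h * fwd_diff r (avg h c) x = of_real r * fwd_diff h (avg r c) x"
proof -
  define R where "R = \<bar>x\<bar> + \<bar>h\<bar> + \<bar>r\<bar> + 1"
  obtain C where C: "\<And>y. y \<in> {-R..R} \<Longrightarrow> (C has_vector_derivative c y) (at y within {-R..R})"
    using antiderivative_continuous[of "-R" R c] continuous_on_subset[OF c] by auto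
  have C': "(C has_vector_derivative c y) (at y)" if "\<bar>y\<bar> < R" for y
    using C[of y] that at_within_interior[of y "{-R..R}"] by (auto simp: abs_less_iff)
  have *: "of_real s * avg s c y = C (y + s) - C y" if "\<bar>y\<bar> + \<bar>s\<bar> < R" for y s
    by (rule avg_antideriv[OF c C' that])
  show ?thesis unfolding fwd_diff_def right_diff_distrib
    by (subst (1 2 3 4) *) (auto simp: R_def algebra_simps)
qed

lemma avg_avg_second_diff:
  assumes c: "cper c" and h: "h > 0" and M: "\<And>x. norm (fwd_diff h (fwd_diff h c) x) \<le> M"
  shows "norm (fwd_diff r (fwd_diff r (avg h (avg h c))) x) \<le> M / h\<^sup>2 * r\<^sup>2"
proof -
  have cc: "continuous_on UNIV c" using c by (rule cper_cont)
  let ?a = "complex_of_real (r / h)"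
  have sw: "fwd_diff r (avg h f) = (\<lambda>x. ?a * avg r (fwd_diff h f) x)" if "cper f" for f
    using fwd_diff_avg_swap[OF cper_cont[OF that], of h r] h avg_fwd_diff[OF cper_cont[OF that], of r h]
    by (auto simp: fun_eq_iff field_simps)
  have cm: "avg r (\<lambda>x. a * f x) = (\<lambda>x. a * avg r f x)" for a f r
    by (auto simp: avg_def fun_eq_iff)
  have dm: "fwd_diff h (\<lambda>x. a * f x) = (\<lambda>x. a * fwd_diff h f x)" for a f h
    by (auto simp: fwd_diff_def fun_eq_iff algebra_simps)
  have "fwd_diff r (fwd_diff r (avg h (avg h c))) = fwd_diff r (avg h (fwd_diff r (avg h c)))"
    by (subst avg_fwd_diff) (auto intro!: cper_cont cper_avg c)
  also have "\<dots> = (\<lambda>x. ?a * avg r (fwd_diff h (fwd_diff r (avg h c))) x)"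
    by (rule sw) (intro cper_fwd_diff cper_avg c)
  also have "\<dots> = (\<lambda>x. ?a * (?a * avg r (avg r (fwd_diff h (fwd_diff h c))) x))"
    unfolding sw[OF c] dm cm by (subst avg_fwd_diff) (auto intro!: cper_cont cper_fwd_diff c)
  finally have "norm (fwd_diff r (fwd_diff r (avg h (avg h c))) x) = \<bar>r / h\<bar>\<^sup>2 * norm (avg r (avg r (fwd_diff h (fwd_diff h c))) x)"
    by (simp add: norm_mult norm_divide power2_eq_square)
  also have "norm (avg r (avg r (fwd_diff h (fwd_diff h c))) x) \<le> M"
    by (intro avg_norm M cper_cont cper_avg cper_fwd_diff c)
  finally have "norm (fwd_diff r (fwd_diff r (avg h (avg h c))) x) \<le> \<bar>r / h\<bar>\<^sup>2 * M"
    by (simp add: mult_left_mono)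
  then show ?thesis by (simp add: power_divide mult.commute)
qed

text \<open>
  Both operators average translations, so they commute by Fubini for continuous functions.
\<close>
lemma pois_avg:
  assumes g: "cper g" and \<tau>: "0 < \<tau>" shows "pois \<tau> (avg h g) = avg h (pois \<tau> g)"
proof
  fix x
  let ?k = "\<lambda>r. complex_of_real (poisson_kernel (exp (-\<tau>)) r)"
  let ?f = "\<lambda>r s. ?k r * g (x + r + h * s)"
  have "continuous_on A (\<lambda>z. g (x + fst z + h * snd z))" for A
    by (rule continuous_on_compose2[OF cper_cont[OF g, of UNIV] _ subset_UNIV]) (intro continuous_intros)
  then have c2: "continuous_on A (\<lambda>z. ?f (fst z) (snd z))" for A
    using \<tau> by (intro continuous_intros continuous_poisson_kernel) auto
  have cg: "continuous_on S (\<lambda>s. g (y + s))" for S y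
    by (rule continuous_on_compose2[OF cper_cont[OF g, of UNIV] _ subset_UNIV], intro continuous_intros)+
  have "continuous_on S (\<lambda>r. avg h g (x + r))" for S
    by (rule continuous_on_compose2[OF cper_cont[OF cper_avg[OF g], of UNIV] _ subset_UNIV]) (intro continuous_intros)
  then have kav: "continuous_on S (\<lambda>r. ?k r * avg h g (x + r))" for S
    using \<tau> by (intro continuous_intros continuous_poisson_kernel) auto
  have kg: "continuous_on S (\<lambda>r. ?k r * g (y + r))" for S y
    using \<tau> by (intro continuous_intros continuous_poisson_kernel cg) auto
  have "pois \<tau> (avg h g) x = integral {-pi..pi} (\<lambda>r. ?k r * avg h g (x + r)) / complex_of_real (2 * pi)"
    using g \<tau> kav by (simp add: pois_alt cper_avg integral_circ_HK_eq integrable_circ_continuous)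
  also have "integral {-pi..pi} (\<lambda>r. ?k r * avg h g (x + r)) = integral {-pi..pi} (\<lambda>r. integral {0..1} (\<lambda>s. ?f r s))"
    by (simp add: avg_def)
  also have "\<dots> = integral {0..1} (\<lambda>s. integral {-pi..pi} (\<lambda>r. ?f r s))"
    using integral_swap_continuous[of "-pi" 0 pi 1 ?f] c2[of "cbox (-pi,0) (pi,1)"]
    by (simp add: case_prod_unfold)
  also have "\<dots> = integral {0..1} (\<lambda>s. pois \<tau> g (x + h * s) * complex_of_real (2 * pi))"
  proof -
    have "pois \<tau> g y * complex_of_real (2 * pi) = integral {-pi..pi} (\<lambda>r. ?k r * g (y + r))" for y
      unfolding pois_alt[OF g \<tau>] integral_circ_HK_eq[OF integrable_circ_continuous[OF kg]] by simp
    then show ?thesis by (simp add: add.assoc add.commute add.left_commute)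
  qed
  also have "\<dots> = avg h (pois \<tau> g) x * complex_of_real (2 * pi)" by (simp add: avg_def)
  finally show "pois \<tau> (avg h g) x = avg h (pois \<tau> g) x" by simp
qed

lemma defect_avg: 
  assumes "cper g" "0 < \<tau>" shows "defect \<tau> (avg h g) = avg h (defect \<tau> g)"
proof
  fix x
  have "avg h (defect \<tau> g) x = avg h g x - avg h (pois \<tau> g) x"
    unfolding avg_def defect_def using assms
    by (intro Henstock_Kurzweil_Integration.integral_diff avg_integrable cper_cont cper_pois cper_integrable)
  then show "defect \<tau> (avg h g) x = avg h (defect \<tau> g) x" using pois_avg[OF assms] by (simp add: defect_def)
qed

lemma defect_fwd_diff: 
  assumes "cper g" "0 < \<tau>" shows "defect \<tau> (fwd_diff h g) = fwd_diff h (defect \<tau> g)"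
  using assms pois_diff[OF cper_shift[of g h] assms(1)] 
  by (auto simp: defect_def fwd_diff_def[abs_def] fun_eq_iff pois_shift)

lemma funpow_invariant: "P c \<Longrightarrow> (\<And>c. P c \<Longrightarrow> P (f c)) \<Longrightarrow> P ((f ^^ n) c)"
  by (induction n) auto

lemma funpow_commute_on:
  assumes "\<And>c. P c \<Longrightarrow> P (f c)" "\<And>c. P c \<Longrightarrow> P (g c)" "\<And>c. P c \<Longrightarrow> f (g c) = g (f c)" "P c"
  shows "(f ^^ n) (g c) = g ((f ^^ n) c)"
  using assms by (induction n) (auto simp: funpow_invariant)

text \<open>
  Each pair of averages allows one application of \<open>defect_defect_bound\<close>, which gains
  \<open>(\<tau> / h)\<^sup>2\<close> and two differences of step \<open>h\<close>. All operators commute with each other.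
\<close>
lemma defect_avg_power_bound:
  assumes \<tau>: "0 < \<tau>" "\<tau> \<le> 3" and h: "h > 0" and c: "cper c" "\<And>x. norm ((fwd_diff h ^^ (2 * j)) c x) \<le> M"
  shows "norm ((defect \<tau> ^^ (2 * j)) ((avg h ^^ (2 * j)) c) x) \<le> (smoothing_const * \<tau>\<^sup>2 / h\<^sup>2) ^ j * M"
  using c
proof (induction j arbitrary: c x)
  case 0 then show ?case by simp
next
  case (Suc j)
  let ?A = "avg h" and ?D = "defect \<tau>" and ?E = "fwd_diff h"
  have inv: "cper ((?D ^^ n) c)" "cper ((?A ^^ n) c)" "cper ((?E ^^ n) c)" if "cper c" for n c
    using that \<tau> by (auto intro!: funpow_invariant[of cper] cper_defect cper_avg cper_fwd_diff)
  have DA: "(?D ^^ n) (?A c) = ?A ((?D ^^ n) c)" if "cper c" for n c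
    by (rule funpow_commute_on[of cper]) (use that \<tau> in \<open>auto intro: cper_defect cper_avg defect_avg\<close>)
  have DE: "(?D ^^ n) (?E c) = ?E ((?D ^^ n) c)" if "cper c" for n c
    by (rule funpow_commute_on[of cper]) (use that \<tau> in \<open>auto intro: cper_defect cper_fwd_diff defect_fwd_diff\<close>)
  have AE: "(?A ^^ n) (?E c) = ?E ((?A ^^ n) c)" if "cper c" for n c
    by (rule funpow_commute_on[of cper]) (use that in \<open>auto intro: cper_avg cper_fwd_diff avg_fwd_diff cper_cont\<close>)
  define v where "v = (?D ^^ (2 * j)) ((?A ^^ (2 * j)) c)"
  have cv: "cper v" unfolding v_def by (intro inv Suc.prems)
  have "(?D ^^ (2 * Suc j)) ((?A ^^ (2 * Suc j)) c) = ?D (?D (?A (?A v)))"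
    unfolding v_def using Suc.prems by (simp add: DA inv cper_avg)
  moreover have Ev: "?E (?E v) = (?D ^^ (2 * j)) ((?A ^^ (2 * j)) (?E (?E c)))"
    unfolding v_def using Suc.prems by (simp add: DE AE inv cper_fwd_diff)
  have "norm (?E (?E v) y) \<le> (smoothing_const * \<tau>\<^sup>2 / h\<^sup>2) ^ j * M" for y
    unfolding Ev
  proof (rule Suc.IH)
    show "cper (?E (?E c))" by (intro cper_fwd_diff Suc.prems)
    have "(?E ^^ (2 * j)) (?E (?E c)) = (?E ^^ (2 * Suc j)) c" by (simp flip: funpow_swap1)
    then show "norm ((?E ^^ (2 * j)) (?E (?E c)) x) \<le> M" for x using Suc.prems by simp
  qed
  from avg_avg_second_diff[OF cv h this]
  have "norm (fwd_diff r (fwd_diff r (?A (?A v))) y) \<le> ((smoothing_const * \<tau>\<^sup>2 / h\<^sup>2) ^ j * M) / h\<^sup>2 * r\<^sup>2" for r y .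
  from defect_defect_bound[OF _ \<tau> this] have "norm (?D (?D (?A (?A v))) x) \<le> smoothing_const * \<tau>\<^sup>2 * (((smoothing_const * \<tau>\<^sup>2 / h\<^sup>2) ^ j * M) / h\<^sup>2)"
    by (simp add: cper_avg cv)
  ultimately show ?case by (simp add: mult_ac)
qed

section \<open>Decomposition of Lipschitz functions\<close>
lemma fwd_diff_funpow:
  "(fwd_diff h ^^ n) g x = (\<Sum>i\<le>n. (-1) ^ (n + i) * of_nat (n choose i) * g (x + of_nat i * h))"
proof (induction n arbitrary: x)
  case 0 then show ?case by simp
next
  case (Suc n)
  define c where "c n i = (-1) ^ (n + i) * (of_nat (n choose i) :: complex)" for n i :: nat
  define G where "G i = g (x + of_nat i * h)" for i :: nat
  have c0: "c (Suc n) 0 = - c n 0" by (simp add: c_def)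
  have cS: "c (Suc n) (Suc i) = c n i - c n (Suc i)" for i by (simp add: c_def algebra_simps)
  have "(\<Sum>i\<le>Suc n. c (Suc n) i * G i) = - c n 0 * G 0 + (\<Sum>i\<le>n. c n i * G (Suc i)) - (\<Sum>i\<le>n. c n (Suc i) * G (Suc i))"
    by (subst sum.atMost_Suc_shift) (simp add: c0 cS left_diff_distrib sum_subtractf)
  also have "(\<Sum>i\<le>n. c n (Suc i) * G (Suc i)) = (\<Sum>i\<le>Suc n. c n i * G i) - c n 0 * G 0"
    by (subst sum.atMost_Suc_shift) simp
  also have "(\<Sum>i\<le>Suc n. c n i * G i) = (\<Sum>i\<le>n. c n i * G i)" by (simp add: c_def)
  finally have "(\<Sum>i\<le>Suc n. c (Suc n) i * G i) = (\<Sum>i\<le>n. c n i * G (Suc i)) - (\<Sum>i\<le>n. c n i * G i)" by simp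
  moreover have "(fwd_diff h ^^ Suc n) g x = (\<Sum>i\<le>n. c n i * G (Suc i)) - (\<Sum>i\<le>n. c n i * G i)"
    by (simp add: fwd_diff_def[of h "(fwd_diff h ^^ n) g"] Suc.IH c_def G_def algebra_simps)
  ultimately show ?case by (simp add: c_def G_def)
qed

lemma fwd_diff_funpow_norm:
  "(\<And>x. norm (g x) \<le> M) \<Longrightarrow> norm ((fwd_diff h ^^ n) g x) \<le> 2 ^ n * M"
proof (induction n arbitrary: x)
  case (Suc n)
  show ?case using Suc.IH[OF Suc.prems, of "x + h"] Suc.IH[OF Suc.prems, of x]
    by (simp add: fwd_diff_def[of h "(fwd_diff h ^^ n) g"]) (rule order_trans[OF norm_triangle_ineq4], linarith)
qed simp

lemma avg_funpow_dilate:
  "(avg h ^^ n) (\<lambda>r. b (x + a * r)) r = (avg (a * h) ^^ n) b (x + a * r)"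
  by (induction n arbitrary: r) (simp_all add: avg_def[abs_def] algebra_simps)

lemma avg_funpow_cont: "continuous_on UNIV g \<Longrightarrow> continuous_on UNIV ((avg h ^^ n) g)"
  by (rule funpow_invariant[of "continuous_on UNIV"]) (auto intro: cont_avg)

lemma avg_funpow_sum:
  assumes "\<And>i. i \<in> I \<Longrightarrow> continuous_on UNIV (f i)" "finite I"
  shows "(avg h ^^ n) (\<lambda>x. \<Sum>i\<in>I. a i * f i x) = (\<lambda>x. \<Sum>i\<in>I. a i * (avg h ^^ n) (f i) x)"
  using assms by (induction n) (simp_all add: avg_sum avg_funpow_cont)

lemma avg_funpow_norm:
  assumes "continuous_on UNIV g" "0 \<le> h" "\<And>r. 0 \<le> r \<Longrightarrow> r \<le> R \<Longrightarrow> norm (g r) \<le> M" "0 \<le> r" "r + real n * h \<le> R"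
  shows "norm ((avg h ^^ n) g r) \<le> M"
  using assms(4,5)
proof (induction n arbitrary: r)
  case (Suc n)
  have "norm (avg h ((avg h ^^ n) g) r) \<le> M"
  proof (rule avg_norm)
    fix s :: real assume s: "s \<in> {0..1}"
    then have "h * s \<le> h * 1" "0 \<le> h * s"
      using assms(2) mult_left_mono[of s 1 h] by auto
    then show "norm ((avg h ^^ n) g (r + h * s)) \<le> M" using Suc.prems by (intro Suc.IH) (auto simp: algebra_simps)
  qed (rule avg_funpow_cont[OF assms(1)])
  then show ?case by simp
qed (use assms(3) in auto)

lemma avg_zero_funpow: "(avg 0 ^^ n) g = g"
  by (induction n) (auto simp: avg_def fun_eq_iff)

lemma pois_sum:
  assumes "0 < \<tau>" "finite I" "\<And>i. i \<in> I \<Longrightarrow> cper (f i)"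
  shows "pois \<tau> (\<lambda>x. \<Sum>i\<in>I. f i x) = (\<lambda>x. \<Sum>i\<in>I. pois \<tau> (f i) x)"
  using assms(2,3)
proof (induction I rule: finite_induct)
  case empty
  show ?case using pois_cmult[OF cper_zero assms(1), of 0] by simp
next
  case (insert i I)
  have "cper (\<lambda>x. \<Sum>i\<in>I. f i x)" using insert by (intro cper_sum) auto
  with insert pois_add[OF _ this assms(1), of "f i"] show ?case by (simp add: fun_eq_iff)
qed

lemma defect_sum:
  assumes "0 < \<tau>" "finite I" "\<And>i. i \<in> I \<Longrightarrow> cper (f i)"
  shows "defect \<tau> (\<lambda>x. \<Sum>i\<in>I. a i * f i x) = (\<lambda>x. \<Sum>i\<in>I. a i * defect \<tau> (f i) x)"
proof
  fix x
  have "pois \<tau> (\<lambda>x. \<Sum>i\<in>I. a i * f i x) x = (\<Sum>i\<in>I. a i * pois \<tau> (f i) x)"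
    using assms by (subst pois_sum) (auto simp: pois_cmult intro: cper_cmult)
  then show "defect \<tau> (\<lambda>x. \<Sum>i\<in>I. a i * f i x) x = (\<Sum>i\<in>I. a i * defect \<tau> (f i) x)"
    by (simp add: defect_def right_diff_distrib sum_subtractf)
qed

lemma cper_defect_funpow: "cper c \<Longrightarrow> 0 < \<tau> \<Longrightarrow> cper ((defect \<tau> ^^ n) c)"
  by (rule funpow_invariant[of cper]) (auto intro: cper_defect)

lemma defect_funpow_sum:
  assumes "0 < \<tau>" "finite I" "\<And>i. i \<in> I \<Longrightarrow> cper (f i)"
  shows "(defect \<tau> ^^ n) (\<lambda>x. \<Sum>i\<in>I. a i * f i x) = (\<lambda>x. \<Sum>i\<in>I. a i * (defect \<tau> ^^ n) (f i) x)"
  using assms by (induction n) (simp_all add: defect_sum cper_defect_funpow)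

lemma defect_funpow_norm:
  "0 < \<tau> \<Longrightarrow> (\<And>t. norm (g t) \<le> M) \<Longrightarrow> norm ((defect \<tau> ^^ n) g x) \<le> 2 ^ n * M"
proof (induction n arbitrary: x)
  case (Suc n)
  show ?case using defect_norm[OF Suc.prems(1), of "(defect \<tau> ^^ n) g" "2 ^ n * M" x] Suc.IH[OF Suc.prems] by simp
qed simp

text \<open>
  Let \<open>N = 2 k\<close>. The \<open>N\<close>-fold average over \<open>r\<close> of length \<open>\<tau>\<close> of the difference \<open>fwd_diff r ^^ N\<close> of \<open>b\<close> is an
  alternating sum of \<open>b\<close> and of the \<open>N\<close>-fold averages of \<open>b\<close> over the lengths \<open>i * \<tau>\<close>, \<open>1 \<le> i \<le> N\<close>. The left
  side, called \<open>E\<close>, is of size \<open>L (N \<tau>) powr \<alpha>\<close> and keeps this size under powers of the defect; the averages are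
  handled by \<open>defect_avg_power_bound\<close>. In other words, \<open>b\<close> is approximated by its Steklov averages.
\<close>
lemma defect_power_lipschitz:
  assumes b: "cper b" and k: "k \<ge> 1" and \<alpha>: "\<alpha> > 0" and L: "L \<ge> 0"
    and diff: "\<And>r x. norm ((fwd_diff r ^^ (2 * k)) b x) \<le> L * \<bar>r\<bar> powr \<alpha>"
    and \<tau>: "0 < \<tau>" "\<tau> \<le> 3"
  shows "norm ((defect \<tau> ^^ (2 * k)) b x) \<le> 2 ^ (2 * k) * (1 + smoothing_const ^ k) * real (2 * k) powr \<alpha> * L * \<tau> powr \<alpha>"
proof -
  define N where "N = 2 * k"
  define B where "B = L * (real N * \<tau>) powr \<alpha>"
  have B0: "0 \<le> B" using L by (simp add: B_def)
  define c where "c i = (-1) ^ (N + i) * (of_nat (N choose i) :: complex)" for i :: nat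
  have cN: "norm (c i) = real (N choose i)" for i by (simp add: c_def norm_mult norm_power)
  define e where "e i = (avg (real i * \<tau>) ^^ N) b" for i
  have ce: "cper (e i)" for i unfolding e_def by (rule funpow_invariant[of cper]) (auto intro: b cper_avg)
  define E where "E x = (\<Sum>i\<le>N. c i * e i x)" for x
  have cE: "cper E" unfolding E_def[abs_def] by (intro cper_sum cper_cmult ce)
  have E_bound: "norm (E x) \<le> B" for x
  proof -
    define \<Phi> where "\<Phi> r = (\<Sum>i\<le>N. c i * b (x + real i * r))" for r
    have \<Phi>: "\<Phi> r = (fwd_diff r ^^ N) b x" for r by (simp add: \<Phi>_def fwd_diff_funpow c_def)
    have cb: "continuous_on UNIV (\<lambda>r. b (x + real i * r))" for i
      by (rule cont_shift_scale) (rule cper_cont[OF b])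
    have "norm ((avg \<tau> ^^ N) \<Phi> 0) \<le> B"
    proof (rule avg_funpow_norm)
      show "continuous_on UNIV \<Phi>" unfolding \<Phi>_def[abs_def] by (intro continuous_intros cb)
      fix r :: real assume r: "0 \<le> r" "r \<le> real N * \<tau>"
      have "norm (\<Phi> r) \<le> L * \<bar>r\<bar> powr \<alpha>" unfolding \<Phi> N_def by (rule diff)
      also have "\<dots> \<le> B" unfolding B_def using r L \<alpha> by (intro mult_left_mono powr_mono2) auto
      finally show "norm (\<Phi> r) \<le> B" .
    qed (use \<tau> in auto)
    moreover have "(avg \<tau> ^^ N) \<Phi> 0 = (\<Sum>i\<le>N. c i * (avg \<tau> ^^ N) (\<lambda>r. b (x + real i * r)) 0)"
      unfolding \<Phi>_def[abs_def] by (subst avg_funpow_sum) (auto intro: cb)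
    moreover have "\<dots> = E x" by (simp add: E_def e_def avg_funpow_dilate)
    ultimately show ?thesis by simp
  qed
  have e_bound: "norm ((defect \<tau> ^^ N) (e i) x) \<le> smoothing_const ^ k * B" if i: "1 \<le> i" "i \<le> N" for i x
  proof -
    have "norm ((defect \<tau> ^^ (2 * k)) ((avg (real i * \<tau>) ^^ (2 * k)) b) x)
      \<le> (smoothing_const * \<tau>\<^sup>2 / (real i * \<tau>)\<^sup>2) ^ k * B"
    proof (rule defect_avg_power_bound[OF \<tau> _ b])
      fix x
      have "norm ((fwd_diff (real i * \<tau>) ^^ (2 * k)) b x) \<le> L * \<bar>real i * \<tau>\<bar> powr \<alpha>" by (rule diff)
      also have "\<dots> \<le> B" unfolding B_def using i \<tau> \<alpha> L
        by (intro mult_left_mono powr_mono2) (auto simp: abs_mult)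
      finally show "norm ((fwd_diff (real i * \<tau>) ^^ (2 * k)) b x) \<le> B" .
    qed (use i \<tau> in auto)
    also have "smoothing_const * \<tau>\<^sup>2 / (real i * \<tau>)\<^sup>2 \<le> smoothing_const"
    proof -
      have "1 \<le> (real i)\<^sup>2" using i by (simp add: one_le_power)
      then show ?thesis using \<tau> smoothing_const_pos mult_left_mono[of 1 "(real i)\<^sup>2" smoothing_const] 
        by (simp add: power_mult_distrib divide_le_eq)
    qed
    then have "(smoothing_const * \<tau>\<^sup>2 / (real i * \<tau>)\<^sup>2) ^ k * B \<le> smoothing_const ^ k * B"
      using smoothing_const_pos B0 \<tau> by (intro mult_right_mono power_mono) auto
    finally show ?thesis by (simp add: e_def N_def)
  qed
  have split: "(\<Sum>i\<le>N. h i) = h 0 + (\<Sum>i\<in>{1..N}. h i)" for h :: "nat \<Rightarrow> 'b::comm_monoid_add"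
    by (simp add: atMost_atLeast0 sum.atLeast_Suc_atMost)
  \<comment> \<open>The term \<open>i = 0\<close> is \<open>b\<close> itself, with coefficient \<open>1\<close> because \<open>N\<close> is even.\<close>
  have "c 0 = 1" by (simp add: c_def N_def)
  then have "b = (\<lambda>x. E x - (\<Sum>i\<in>{1..N}. c i * e i x))"
    by (simp add: E_def split e_def avg_zero_funpow)
  moreover have "(\<lambda>x. E x - (\<Sum>i\<in>{1..N}. c i * e i x)) = (\<lambda>x. \<Sum>i\<le>N. (if i = 0 then 1 else - c i) * (if i = 0 then E else e i) x)"
    by (auto simp: split fun_eq_iff sum_negf intro!: sum.cong)
  ultimately have "b = (\<lambda>x. \<Sum>i\<le>N. (if i = 0 then 1 else - c i) * (if i = 0 then E else e i) x)" by simp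
  then have "(defect \<tau> ^^ N) b x = (\<Sum>i\<le>N. (if i = 0 then 1 else - c i) * (defect \<tau> ^^ N) (if i = 0 then E else e i) x)"
    using defect_funpow_sum[OF \<tau>(1), of "{..N}" "\<lambda>i. if i = 0 then E else e i" N "\<lambda>i. if i = 0 then 1 else - c i"] ce cE
    by simp
  also have "\<dots> = (defect \<tau> ^^ N) E x + (\<Sum>i\<in>{1..N}. - c i * (defect \<tau> ^^ N) (e i) x)"
    by (auto simp: split intro!: sum.cong)
  finally have sp: "(defect \<tau> ^^ N) b x = (defect \<tau> ^^ N) E x + (\<Sum>i\<in>{1..N}. - c i * (defect \<tau> ^^ N) (e i) x)" .
  have "norm ((defect \<tau> ^^ N) b x) \<le> norm ((defect \<tau> ^^ N) E x) + (\<Sum>i\<in>{1..N}. norm (- c i * (defect \<tau> ^^ N) (e i) x))"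
    unfolding sp by (intro order_trans[OF norm_triangle_ineq] add_left_mono norm_sum)
  also have "\<dots> \<le> 2 ^ N * B + (\<Sum>i\<in>{1..N}. real (N choose i) * (smoothing_const ^ k * B))"
    using e_bound by (intro add_mono defect_funpow_norm[OF \<tau>(1) E_bound] sum_mono) (auto simp: norm_mult cN intro!: mult_left_mono)
  also have "(\<Sum>i\<in>{1..N}. real (N choose i) * (smoothing_const ^ k * B)) \<le> 2 ^ N * (smoothing_const ^ k * B)"
  proof -
    have "(\<Sum>i\<in>{1..N}. real (N choose i)) \<le> (\<Sum>i\<le>N. real (N choose i))" by (intro sum_mono2) auto
    also have "\<dots> = 2 ^ N" using choose_row_sum[of N] by (simp flip: of_nat_sum)
    finally show ?thesis using B0 smoothing_const_pos
      by (simp only: sum_distrib_right[symmetric]) (intro mult_right_mono, auto)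
  qed
  finally have "norm ((defect \<tau> ^^ N) b x) \<le> 2 ^ N * (1 + smoothing_const ^ k) * B" by (simp add: algebra_simps)
  also have "B = real N powr \<alpha> * L * \<tau> powr \<alpha>" using \<tau> by (simp add: B_def powr_mult)
  finally show ?thesis by (simp add: N_def mult.assoc)
qed

text \<open>
  The operator \<open>I + P \<tau>\<close>, the quotient of \<open>I - P (2 \<tau>)\<close> by \<open>I - P \<tau>\<close>.
\<close>
definition blur :: "real \<Rightarrow> (real \<Rightarrow> complex) \<Rightarrow> real \<Rightarrow> complex" where
  "blur \<tau> c x = c x + pois \<tau> c x"

lemma cper_blur: "cper c \<Longrightarrow> 0 < \<tau> \<Longrightarrow> cper (blur \<tau> c)"
  unfolding blur_def[abs_def] by (intro cper_add cper_pois cper_integrable)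

lemma blur_defect:
  assumes c: "cper c" and \<tau>: "0 < \<tau>"
  shows "blur \<tau> (defect \<tau> c) = defect (2 * \<tau>) c" and "defect \<tau> (blur \<tau> c) = defect (2 * \<tau>) c"
proof -
  have P: "cper (pois \<tau> c)" and PP: "pois \<tau> (pois \<tau> c) = pois (2 * \<tau>) c"
    using cper_pois[OF cper_integrable[OF c] \<tau>] pois_pois[OF cper_integrable[OF c] \<tau> \<tau>] by simp_all
  show "blur \<tau> (defect \<tau> c) = defect (2 * \<tau>) c"
    using pois_diff[OF c P \<tau>] by (simp add: blur_def defect_def[abs_def] PP fun_eq_iff)
  show "defect \<tau> (blur \<tau> c) = defect (2 * \<tau>) c"
    using pois_add[OF c P \<tau>] by (simp add: blur_def[abs_def] defect_def PP fun_eq_iff)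
qed

lemma defect_double_funpow:
  assumes c: "cper c" and \<tau>: "0 < \<tau>"
  shows "(defect (2 * \<tau>) ^^ n) c = (blur \<tau> ^^ n) ((defect \<tau> ^^ n) c)"
proof (induction n)
  case (Suc n)
  have comm: "(blur \<tau> ^^ n) (defect \<tau> v) = defect \<tau> ((blur \<tau> ^^ n) v)" if "cper v" for v
    by (rule funpow_commute_on[of cper]) (use that \<tau> in \<open>auto intro: cper_defect cper_blur simp: blur_defect\<close>)
  have v: "cper ((defect \<tau> ^^ n) c)" by (intro cper_defect_funpow c \<tau>)
  have w: "cper ((blur \<tau> ^^ n) ((defect \<tau> ^^ n) c))"
    by (rule funpow_invariant[of cper]) (auto intro: v cper_blur \<tau>)
  show ?case by (simp add: Suc comm[OF v] blur_defect(1)[OF w \<tau>])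
qed simp

lemma blur_funpow_telescope:
  assumes "cper v" "0 < \<tau>"
  shows "(blur \<tau> ^^ n) v x = v x + pois \<tau> (\<lambda>x. \<Sum>l<n. (blur \<tau> ^^ l) v x) x"
proof -
  have c: "cper ((blur \<tau> ^^ n) v)" for n by (rule funpow_invariant[of cper]) (auto intro: assms cper_blur)
  have "(blur \<tau> ^^ n) v x = v x + (\<Sum>l<n. pois \<tau> ((blur \<tau> ^^ l) v) x)"
    by (induction n) (simp_all add: blur_def)
  then show ?thesis using assms c by (subst pois_sum) auto
qed

lemma defect_funpow_telescope:
  assumes "cper v" "0 < \<tau>"
  shows "(defect \<tau> ^^ n) v x = v x - pois \<tau> (\<lambda>x. \<Sum>l<n. (defect \<tau> ^^ l) v x) x"
proof -
  have "(defect \<tau> ^^ n) v x = v x - (\<Sum>l<n. pois \<tau> ((defect \<tau> ^^ l) v) x)"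
    by (induction n) (simp_all add: defect_def)
  then show ?thesis using assms by (subst pois_sum) (auto intro: cper_defect_funpow)
qed

lemma blur_norm: "0 < \<tau> \<Longrightarrow> (\<And>t. norm (g t) \<le> M) \<Longrightarrow> norm (blur \<tau> g x) \<le> 2 * M"
  unfolding blur_def using pois_contraction[of \<tau> g M x]
  by (intro order_trans[OF norm_triangle_ineq]) (auto intro!: add_mono[of _ M _ M, simplified])

lemma blur_funpow_norm:
  "0 < \<tau> \<Longrightarrow> (\<And>t. norm (g t) \<le> M) \<Longrightarrow> norm ((blur \<tau> ^^ n) g x) \<le> 2 ^ n * M"
proof (induction n arbitrary: x)
  case (Suc n)
  show ?case using blur_norm[OF Suc.prems(1), of "(blur \<tau> ^^ n) g" "2 ^ n * M" x] Suc.IH[OF Suc.prems] by simp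
qed simp

lemma sum_powers_two_le: "(\<And>l. norm (f l) \<le> 2 ^ l * M) \<Longrightarrow> 0 \<le> M \<Longrightarrow> norm (\<Sum>l<n. f l :: complex) \<le> 2 ^ n * M"
proof (induction n)
  case (Suc n)
  have "norm (\<Sum>l<Suc n. f l) \<le> norm (\<Sum>l<n. f l) + norm (f n)" by (simp add: norm_triangle_ineq)
  also have "\<dots> \<le> 2 ^ n * M + 2 ^ n * M" by (intro add_mono Suc)
  finally show ?case by (simp add: mult_ac)
qed simp

text \<open>
  Lipschitz continuity on the torus. For the operator below this is the natural form: the factor
  \<open>chord (x - t)\<close> is what compensates the pole of the cotangent.
\<close>
definition chord_lipschitz :: "real \<Rightarrow> (real \<Rightarrow> complex) \<Rightarrow> bool" where
  "chord_lipschitz \<Lambda> g \<longleftrightarrow> (\<forall>x y. norm (g x - g y) \<le> \<Lambda> * chord (x - y))"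

lemma chord_lipschitz_pois:
  assumes g: "cper g" "chord_lipschitz \<Lambda> g" and \<tau>: "0 < \<tau>"
  shows "chord_lipschitz \<Lambda> (pois \<tau> g)"
  unfolding chord_lipschitz_def
proof (intro allI)
  fix x y
  have "pois \<tau> g x - pois \<tau> g y = pois \<tau> (\<lambda>z. g (z + (x - y)) - g z) y"
    using pois_diff[OF cper_shift[OF g(1), of "x - y"] g(1) \<tau>] pois_shift[OF g(1) \<tau>, of "x - y" y] by simp
  also have "norm \<dots> \<le> \<Lambda> * chord (x - y)"
  proof (rule pois_contraction[OF \<tau>])
    fix t show "norm (g (t + (x - y)) - g t) \<le> \<Lambda> * chord (x - y)"
      using g(2)[unfolded chord_lipschitz_def, rule_format, of "t + (x - y)" t] by simp
  qed
  finally show "norm (pois \<tau> g x - pois \<tau> g y) \<le> \<Lambda> * chord (x - y)" .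
qed

lemma chord_lipschitz_defect_funpow:
  assumes g: "cper g" "chord_lipschitz \<Lambda> g" and \<tau>: "0 < \<tau>"
  shows "chord_lipschitz (2 ^ n * \<Lambda>) ((defect \<tau> ^^ n) g)"
proof (induction n)
  case (Suc n)
  let ?v = "(defect \<tau> ^^ n) g"
  have P: "chord_lipschitz (2 ^ n * \<Lambda>) (pois \<tau> ?v)"
    using g Suc \<tau> by (intro chord_lipschitz_pois cper_defect_funpow) auto
  have "norm (defect \<tau> ?v x - defect \<tau> ?v y) \<le> 2 ^ n * \<Lambda> * chord (x - y) + 2 ^ n * \<Lambda> * chord (x - y)" for x y
  proof -
    have eq: "defect \<tau> ?v x - defect \<tau> ?v y = (?v x - ?v y) - (pois \<tau> ?v x - pois \<tau> ?v y)" by (simp add: defect_def)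
    moreover have "norm (?v x - ?v y) \<le> 2 ^ n * \<Lambda> * chord (x - y)"
      "norm (pois \<tau> ?v x - pois \<tau> ?v y) \<le> 2 ^ n * \<Lambda> * chord (x - y)"
      using Suc P unfolding chord_lipschitz_def by blast+
    ultimately show ?thesis unfolding eq
      using norm_triangle_ineq4[of "?v x - ?v y" "pois \<tau> ?v x - pois \<tau> ?v y"] by linarith
  qed
  then show ?case by (simp add: chord_lipschitz_def mult_ac)
qed (use g in simp)

lemma lipschitz_norm_bounds:
  fixes \<alpha> L :: real
  assumes "lipschitz_norm \<alpha> b \<le> ennreal L" "0 \<le> L" "0 < \<alpha>"
  defines "k \<equiv> (LEAST k::nat. \<alpha> < real k)"
  shows "norm (b x) \<le> L" "norm ((fwd_diff h ^^ k) b x) \<le> L * \<bar>h\<bar> powr \<alpha>" "1 \<le> k"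
proof -
  have "\<alpha> < real k" unfolding k_def using reals_Archimedean2[of \<alpha>] by (auto intro: LeastI)
  then show k: "1 \<le> k" using assms(3) by (cases k) auto
  have l: "sup_norm b + (SUP h\<in>-{0}. ennreal (\<bar>h\<bar> powr (-\<alpha>)) * sup_norm ((fwd_diff h ^^ k) b)) \<le> ennreal L"
    using assms(1) by (simp add: lipschitz_norm_def k_def Let_def)
  have sup: "ennreal (norm (g x)) \<le> sup_norm g" for g x unfolding sup_norm_def by (rule SUP_upper) simp
  have "ennreal (norm (b x)) \<le> ennreal L" by (rule order_trans[OF sup order_trans[OF _ l]]) simp
  then show "norm (b x) \<le> L" using assms by simp
  show "norm ((fwd_diff h ^^ k) b x) \<le> L * \<bar>h\<bar> powr \<alpha>"
  proof (cases "h = 0")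
    case True
    obtain k' where "k = Suc k'" using k by (cases k) auto
    then show ?thesis using True by (simp add: fwd_diff_def)
  next
    case False
    have "ennreal (\<bar>h\<bar> powr (-\<alpha>) * norm ((fwd_diff h ^^ k) b x)) = ennreal (\<bar>h\<bar> powr (-\<alpha>)) * ennreal (norm ((fwd_diff h ^^ k) b x))"
      by (simp add: ennreal_mult)
    also have "\<dots> \<le> ennreal (\<bar>h\<bar> powr (-\<alpha>)) * sup_norm ((fwd_diff h ^^ k) b)" by (intro mult_left_mono sup) auto
    also have "\<dots> \<le> (SUP h\<in>-{0}. ennreal (\<bar>h\<bar> powr (-\<alpha>)) * sup_norm ((fwd_diff h ^^ k) b))"
      using False by (intro SUP_upper) auto
    also have "\<dots> \<le> ennreal L" by (rule order_trans[OF _ l]) simp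
    finally have "\<bar>h\<bar> powr (-\<alpha>) * norm ((fwd_diff h ^^ k) b x) \<le> L" using assms by simp
    then show ?thesis using False by (simp add: powr_minus field_simps)
  qed
qed

text \<open>
  Let \<open>\<delta> j = 3 / 2 ^ j\<close> and \<open>R j = (I - P (\<delta> j)) ^ N b\<close>, which is of size \<open>\<delta> j powr \<alpha>\<close> by
  \<open>defect_power_lipschitz\<close>. Since \<open>I - P (2 \<tau>) = (I + P \<tau>) (I - P \<tau>)\<close>,
  the difference \<open>R j - R (j + 1)\<close> is \<open>((I + P) ^ N - I) (R (j + 1))\<close> with \<open>P = P (\<delta> (j + 1))\<close>, and the polynomial
  \<open>(1 + y) ^ N - 1\<close> is divisible by \<open>y\<close>: the difference carries a factor \<open>P\<close>. The first
  piece \<open>b - R 0\<close> carries the factor \<open>P (\<delta> 0)\<close> for the same reason. The three units of smoothing are used later: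
  one makes the piece Lipschitz, two are moved to input and output of the operator.
\<close>
lemma lipschitz_decomposition:
  fixes \<alpha> :: real
  assumes \<alpha>: "0 < \<alpha>"
  shows "\<exists>C>0. \<forall>b L \<Lambda>. cper b \<and> 0 \<le> L \<and> lipschitz_norm \<alpha> b \<le> ennreal L \<and> chord_lipschitz \<Lambda> b \<longrightarrow>
    (\<exists>c R \<Lambda>'. \<forall>j. cper (c j) \<and> cper (R j) \<and> (\<forall>x. norm (c j x) \<le> C * L * ((1/2) ^ j) powr \<alpha>) \<and>
       (\<forall>x. norm (R j x) \<le> C * L * ((1/2) ^ j) powr \<alpha>) \<and> chord_lipschitz \<Lambda>' (R j) \<and>
       (\<forall>x. b x = (\<Sum>i\<le>j. pois (3 * (1/2) ^ i) (c i) x) + R j x))"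
proof -
  define k where "k = (LEAST k::nat. \<alpha> < real k)"
  define N where "N = 2 * k"
  define C1 where "C1 = 2 ^ (2 * k) * (1 + smoothing_const ^ k) * real (2 * k) powr \<alpha> * 2 ^ k * 3 powr \<alpha>"
  define C where "C = 2 ^ N * (C1 + 1)"
  have C1: "0 \<le> C1" using smoothing_const_pos by (simp add: C1_def)
  have C: "0 < C" using C1 by (simp add: C_def add_nonneg_pos)
  have "\<exists>c R \<Lambda>'. \<forall>j. cper (c j) \<and> cper (R j) \<and> (\<forall>x. norm (c j x) \<le> C * L * ((1/2) ^ j) powr \<alpha>) \<and>
       (\<forall>x. norm (R j x) \<le> C * L * ((1/2) ^ j) powr \<alpha>) \<and> chord_lipschitz \<Lambda>' (R j) \<and>
       (\<forall>x. b x = (\<Sum>i\<le>j. pois (3 * (1/2) ^ i) (c i) x) + R j x)"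
    if b: "cper b" and L: "0 \<le> L" and bL: "lipschitz_norm \<alpha> b \<le> ennreal L" and \<Lambda>: "chord_lipschitz \<Lambda> b" for b L \<Lambda>
  proof -
    note lb = lipschitz_norm_bounds[OF bL L \<alpha>, folded k_def]
    define \<delta> where "\<delta> j = 3 * (1/2 :: real) ^ j" for j :: nat
    have \<delta>: "0 < \<delta> j" "\<delta> j \<le> 3" for j by (auto simp: \<delta>_def power_le_one)
    have \<delta>S: "2 * \<delta> (Suc j) = \<delta> j" for j by (simp add: \<delta>_def)
    define R where "R j = (defect (\<delta> j) ^^ N) b" for j
    define c where "c j = (case j of 0 \<Rightarrow> (\<lambda>x. \<Sum>l<N. (defect (\<delta> 0) ^^ l) b x)
        | Suc i \<Rightarrow> (\<lambda>x. \<Sum>l<N. (blur (\<delta> j) ^^ l) (R j) x))" for j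
    have cR: "cper (R j)" for j unfolding R_def by (intro cper_defect_funpow b \<delta>)
    have cbl: "cper ((blur (\<delta> j) ^^ l) (R j))" for j l
      by (rule funpow_invariant[of cper]) (auto intro: cR cper_blur \<delta>)
    have cc: "cper (c j)" for j
      unfolding c_def by (cases j) (auto intro!: cper_sum cper_defect_funpow b \<delta> cbl)
    have diff: "norm ((fwd_diff r ^^ (2 * k)) b x) \<le> (2 ^ k * L) * \<bar>r\<bar> powr \<alpha>" for r x
    proof -
      have "(fwd_diff r ^^ (2 * k)) b = (fwd_diff r ^^ k) ((fwd_diff r ^^ k) b)"
        by (simp add: mult_2 funpow_add)
      then show ?thesis using fwd_diff_funpow_norm[where g = "(fwd_diff r ^^ k) b" and h = r and n = k, OF lb(2)] by (simp add: mult.assoc)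
    qed
    have Rb: "norm (R j x) \<le> C1 * L * ((1/2) ^ j) powr \<alpha>" for j x
    proof -
      have "norm (R j x) \<le> 2 ^ (2 * k) * (1 + smoothing_const ^ k) * real (2 * k) powr \<alpha> * (2 ^ k * L) * \<delta> j powr \<alpha>"
        unfolding R_def N_def by (rule defect_power_lipschitz[OF b lb(3) \<alpha> _ diff \<delta>]) (use L in simp)
      also have "\<delta> j powr \<alpha> = 3 powr \<alpha> * ((1/2) ^ j) powr \<alpha>" by (simp add: \<delta>_def powr_mult)
      finally show ?thesis by (simp add: C1_def mult_ac)
    qed
    have "norm (c j x) \<le> C * L * ((1/2) ^ j) powr \<alpha>" for j x
    proof (cases j)
      case 0
      have "norm (c 0 x) \<le> 2 ^ N * L"
        unfolding c_def by (simp, intro sum_powers_two_le defect_funpow_norm \<delta> lb(1) L)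
      also have "\<dots> \<le> C * L" unfolding C_def using C1 L by (intro mult_right_mono) auto
      finally show ?thesis using 0 by simp
    next
      case (Suc i)
      have "norm (c j x) \<le> 2 ^ N * (C1 * L * ((1/2) ^ j) powr \<alpha>)"
        unfolding c_def Suc nat.case by (intro sum_powers_two_le blur_funpow_norm \<delta> Rb mult_nonneg_nonneg C1 L) auto
      also have "\<dots> = (2 ^ N * C1) * (L * ((1/2) ^ j) powr \<alpha>)" by simp
      also have "\<dots> \<le> C * (L * ((1/2) ^ j) powr \<alpha>)" unfolding C_def using L by (intro mult_right_mono) auto
      finally show ?thesis by (simp add: mult.assoc)
    qed
    moreover have "norm (R j x) \<le> C * L * ((1/2) ^ j) powr \<alpha>" for j x
    proof -
      have "1 * C1 \<le> 2 ^ N * (C1 + 1)" using C1 by (intro mult_mono) auto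
      then have "C1 * (L * ((1/2) ^ j) powr \<alpha>) \<le> C * (L * ((1/2) ^ j) powr \<alpha>)"
        unfolding C_def using L by (intro mult_right_mono) auto
      with Rb[of j x] show ?thesis by (simp add: mult.assoc)
    qed
    moreover have "chord_lipschitz (2 ^ N * \<Lambda>) (R j)" for j
      unfolding R_def by (intro chord_lipschitz_defect_funpow b \<Lambda> \<delta>)
    moreover have "b x = (\<Sum>i\<le>j. pois (\<delta> i) (c i) x) + R j x" for j x
    proof (induction j)
      case 0
      show ?case using defect_funpow_telescope[OF b \<delta>(1)[of 0], where n = N and x = x] by (simp add: R_def c_def)
    next
      case (Suc j)
      have "R j x = R (Suc j) x + pois (\<delta> (Suc j)) (c (Suc j)) x"
        using blur_funpow_telescope[OF cR[of "Suc j"] \<delta>(1)[of "Suc j"], where n = N and x = x]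
          defect_double_funpow[OF b \<delta>(1)[of "Suc j"], where n = N]
        by (simp add: R_def c_def \<delta>S)
      then show ?case using Suc by simp
    qed
    ultimately show ?thesis using cc cR unfolding \<delta>_def by blast
  qed
  then show ?thesis using C by blast
qed

section \<open>The Hankel operator and the Poisson semigroup\<close>
lemma pois_sums:
  assumes "\<And>n. cper (f n)" "\<And>n x. norm (f n x) \<le> M n" "summable M" "\<And>x. (\<lambda>n. f n x) sums g x" "0 < \<tau>"
  shows "(\<lambda>n. pois \<tau> (f n) x) sums pois \<tau> g x"
proof -
  let ?h = "\<lambda>t. complex_of_real (poisson_kernel (exp (-\<tau>)) (x - t))"
  have "integrable circ ?h" using assms(5)
    by (intro integrable_circ_continuous continuous_intros continuous_poisson_kernel) auto
  from integral_sums_circ[OF this cper_borel[OF assms(1)] assms(2-4)]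
  show ?thesis unfolding pois_def poisson_integral_circ by (intro sums_divide) (simp add: mult.commute)
qed

lemma pois_cis: "0 < \<tau> \<Longrightarrow> pois \<tau> (\<lambda>t. cis (of_int m * t)) x = of_real (exp (-\<tau>) ^ nat \<bar>m\<bar>) * cis (of_int m * x)"
  unfolding pois_def by (rule poisson_integral_cis) auto

lemma fourier_pois:
  assumes F: "integrable circ F" and \<tau>: "0 < \<tau>"
  shows "fourier (pois \<tau> F) (of_int k) = of_real (exp (-\<tau>) ^ nat \<bar>k\<bar>) * fourier F (of_int k)"
proof -
  define \<rho> where "\<rho> = exp (-\<tau>)"
  have \<rho>: "0 \<le> \<rho>" "\<rho> < 1" using \<tau> by (auto simp: \<rho>_def)
  define a b where "a n = of_real (\<rho> ^ n) * (weight n * fourier F n)" and "b n = of_real (\<rho> ^ n) * (weight n * fourier F (- real n))" for n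
  have ser: "trig_series a b (pois \<tau> F)"
    using poisson_integral_series[OF F \<rho>] unfolding a_def[abs_def] b_def[abs_def] pois_def \<rho>_def .
  let ?f = "\<lambda>n t. a n * cis (real n * t) + b n * cis (- (real n * t))"
  let ?h = "\<lambda>t. cis (- (of_int k * t))"
  have ih: "integrable circ (\<lambda>t. c * cis (r * t))" for c r by (intro integrable_circ_continuous continuous_intros)
  have "(\<lambda>n. \<integral>t. ?f n t * ?h t \<partial>circ) sums (\<integral>t. pois \<tau> F t * ?h t \<partial>circ)"
  proof (rule integral_sums_circ)
    show "integrable circ ?h" using ih[of 1 "- of_int k"] by simp
    show "?f n \<in> borel_measurable borel" for n by measurable
    show "norm (?f n t) \<le> norm (a n) + norm (b n)" for n t
      by (rule order_trans[OF norm_triangle_ineq]) (simp add: norm_mult)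
  qed (use ser in \<open>auto simp: trig_series_def intro: summable_add\<close>)
  moreover have "(\<integral>t. ?f n t * ?h t \<partial>circ) = (if n = nat \<bar>k\<bar> then of_real (2 * pi) * (of_real (\<rho> ^ nat \<bar>k\<bar>) * fourier F (of_int k)) else 0)" for n
  proof -
    have "?f n t * ?h t = a n * cis (of_int (int n - k) * t) + b n * cis (of_int (- int n - k) * t)" for t
    proof -
      have "cis (real n * t) * ?h t = cis (of_int (int n - k) * t)" "cis (- (real n * t)) * ?h t = cis (of_int (- int n - k) * t)"
        unfolding cis_mult by (rule arg_cong[of _ _ cis], simp add: algebra_simps)+
      then show ?thesis by (simp only: distrib_right mult.assoc)
    qed
    then have "(\<integral>t. ?f n t * ?h t \<partial>circ) = a n * (\<integral>t. cis (of_int (int n - k) * t) \<partial>circ) + b n * (\<integral>t. cis (of_int (- int n - k) * t) \<partial>circ)"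
      using ih by simp
    then show ?thesis unfolding integral_cis by (auto simp: a_def b_def weight_def)
  qed
  ultimately have "(\<integral>t. pois \<tau> F t * ?h t \<partial>circ) = of_real (2 * pi) * (of_real (\<rho> ^ nat \<bar>k\<bar>) * fourier F (of_int k))"
    using sums_single[of "nat \<bar>k\<bar>" "\<lambda>_. of_real (2 * pi) * (of_real (\<rho> ^ nat \<bar>k\<bar>) * fourier F (of_int k))"]
    by (simp add: sums_unique2)
  then show ?thesis by (simp add: fourier_def[of "pois \<tau> F"] mult.commute[of "cis _"] \<rho>_def)
qed

text \<open>
  The kernel of the operator, acting on \<open>t \<mapsto> f (2 * t)\<close>. On the diagonal and at the pole of the tangent its
  value is \<open>0\<close>.
\<close>
definition hker :: "(real \<Rightarrow> complex) \<Rightarrow> real \<Rightarrow> real \<Rightarrow> complex" where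
  "hker b x t = (b (x + t) - b (2 * x)) / complex_of_real (tan ((x - t) / 2))"

definition hankel :: "(real \<Rightarrow> complex) \<Rightarrow> (real \<Rightarrow> complex) \<Rightarrow> real \<Rightarrow> complex" where
  "hankel b F x = (\<integral>t. hker b x t * F t \<partial>circ)"

lemma hankel_tilde_conv: "hankel_tilde b f = hankel b (\<lambda>t. f (2 * t))"
  unfolding hankel_tilde_def hankel_def hker_def set_integral_circ by simp

lemma abs_tan_half:
  "1 / \<bar>tan ((x - t) / 2)\<bar> * chord (x - t) \<le> 1" "1 / \<bar>tan ((x - t) / 2)\<bar> \<le> 1 / chord (x - t)"
  by (auto simp: tan_def chord_def abs_mult field_simps divide_le_eq)

lemma hker_lipschitz: 
  assumes "chord_lipschitz \<Lambda> b" shows "norm (hker b x t) \<le> \<Lambda>"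
proof -
  have \<Lambda>: "norm (b (x + t) - b (2 * x)) \<le> \<Lambda> * chord (x - t)"
    using assms[unfolded chord_lipschitz_def, rule_format, of "x + t" "2 * x"] chord_commute[of t x] by simp
  have "0 \<le> \<Lambda>" using assms[unfolded chord_lipschitz_def, rule_format, of pi 0] order_trans[OF norm_ge_zero]
    by (fastforce simp: chord_def)
  have "norm (hker b x t) \<le> (\<Lambda> * chord (x - t)) * (1 / \<bar>tan ((x - t) / 2)\<bar>)"
    using mult_right_mono[OF \<Lambda>, of "1 / \<bar>tan ((x - t) / 2)\<bar>"] by (simp add: hker_def norm_divide)
  also have "\<dots> = \<Lambda> * (1 / \<bar>tan ((x - t) / 2)\<bar> * chord (x - t))" by simp
  also have "\<dots> \<le> \<Lambda> * 1" using \<open>0 \<le> \<Lambda>\<close> by (intro mult_left_mono abs_tan_half)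
  finally show ?thesis by simp
qed

lemma hker_bounded: 
  assumes "\<And>x. norm (b x) \<le> M" shows "norm (hker b x t) \<le> 2 * M / chord (x - t)"
proof -
  have "norm (b (x + t) - b (2 * x)) \<le> 2 * M"
    using norm_triangle_ineq4[of "b (x + t)" "b (2 * x)"] assms[of "x + t"] assms[of "2 * x"] by linarith
  then have "norm (hker b x t) \<le> 2 * M * (1 / \<bar>tan ((x - t) / 2)\<bar>)"
    unfolding hker_def norm_divide by (simp add: divide_right_mono)
  also have "\<dots> \<le> 2 * M * (1 / chord (x - t))"
    using order_trans[OF norm_ge_zero assms] by (intro mult_left_mono abs_tan_half) auto
  finally show ?thesis by simp
qed

lemma borel_hker [measurable]:
  assumes [measurable]: "b \<in> borel_measurable borel" shows "hker b x \<in> borel_measurable borel"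
  unfolding hker_def[abs_def] tan_def by measurable

lemma integrable_hker:
  assumes "b \<in> borel_measurable borel" "chord_lipschitz \<Lambda> b" "integrable circ F"
  shows "integrable circ (\<lambda>t. hker b x t * F t)"
  using hker_lipschitz[OF assms(2)] by (intro integrable_bounded_mult[OF assms(3)] borel_hker assms(1))

lemma hankel_norm:
  assumes "b \<in> borel_measurable borel" "chord_lipschitz \<Lambda> b" "integrable circ F"
  shows "norm (hankel b F x) \<le> \<Lambda> * (\<integral>t. norm (F t) \<partial>circ)"
proof -
  have "norm (hankel b F x) \<le> (\<integral>t. norm (hker b x t * F t) \<partial>circ)" unfolding hankel_def by (rule integral_norm_bound)
  also have "\<dots> \<le> (\<integral>t. \<Lambda> * norm (F t) \<partial>circ)"
    using hker_lipschitz[OF assms(2)] integrable_hker[OF assms] assms(3)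
    by (intro integral_mono integrable_norm) (auto simp: norm_mult intro!: mult_right_mono)
  finally show ?thesis by simp
qed

lemma norm_cis_diff: "norm (cis a - cis b) = 2 * chord (a - b)"
proof -
  have "cis a - cis b = cis ((a + b) / 2) * (cis ((a - b) / 2) - cis (- ((a - b) / 2)))"
    unfolding right_diff_distrib cis_mult by (simp add: field_simps)
  moreover have "cis y - cis (- y) = complex_of_real (2 * sin y) * \<i>" for y by (simp add: complex_eq_iff)
  ultimately show ?thesis by (simp add: norm_mult chord_def)
qed

lemma chord_lipschitz_cis:
  "chord_lipschitz (2 * real n) (\<lambda>t. cis (real n * t))" "chord_lipschitz (2 * real n) (\<lambda>t. cis (- (real n * t)))"
proof -
  have *: "norm (cis (real n * x) - cis (real n * y)) \<le> real n * (2 * chord (x - y))" for x y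
    using norm_power_diff[of "cis x" "cis y" n] by (simp add: Complex.DeMoivre norm_cis_diff)
  then show "chord_lipschitz (2 * real n) (\<lambda>t. cis (real n * t))" by (simp add: chord_lipschitz_def mult.assoc mult.left_commute)
  show "chord_lipschitz (2 * real n) (\<lambda>t. cis (- (real n * t)))"
    using *[of "- _" "- _"] chord_commute by (auto simp: chord_lipschitz_def mult.assoc mult.left_commute)
qed

text \<open>
  With \<open>z = cis t\<close> and \<open>w = cis x\<close> the cotangent is \<open>\<i> (w + z) / (w - z)\<close>, and \<open>w - z\<close> divides
  \<open>z ^ n - w ^ n\<close>. The result is a homogeneous polynomial of degree \<open>2 n\<close> in \<open>z\<close> and \<open>w\<close>; homogeneity
  is what \<open>pois_hankel_cis\<close> exploits.
\<close>
lemma hker_cis: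
  assumes "sin ((x - t) / 2) \<noteq> 0"
  shows "hker (\<lambda>t. cis (real n * t)) x t
     = - \<i> * (\<Sum>j<n. cis (of_int (int j) * t) * cis (of_int (int (2 * n - j)) * x) + cis (of_int (int (Suc j)) * t) * cis (of_int (int (2 * n - Suc j)) * x))"
proof -
  define z w where "z = cis t" and "w = cis x"
  define c where "c = cis ((x - t) / 2)"
  have wc: "w = c * c * z" by (simp add: w_def c_def z_def cis_mult)
  have zn: "z \<noteq> 0" "c \<noteq> 0" by (simp_all add: z_def c_def)
  have cc: "c - inverse c = 2 * \<i> * sin ((x - t) / 2)" "c + inverse c = 2 * cos ((x - t) / 2)"
    by (simp_all add: c_def cis_inverse complex_eq_iff)
  have c1: "c * c - 1 \<noteq> 0"
  proof
    assume "c * c - 1 = 0"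
    then have "c - inverse c = 0" using zn by (simp add: field_simps)
    then show False using cc assms by (simp add: complex_eq_iff)
  qed
  have "1 / complex_of_real (tan ((x - t) / 2)) = complex_of_real (cos ((x - t) / 2)) / complex_of_real (sin ((x - t) / 2))"
    by (simp add: tan_def)
  also have "\<dots> = \<i> * ((c + inverse c) / (c - inverse c))" unfolding cc using assms by simp
  also have "(c + inverse c) / (c - inverse c) = (c * c + 1) / (c * c - 1)" using zn c1 by (simp add: divide_simps)
  also have "\<dots> = (w + z) / (w - z)"
  proof -
    have "w + z = (c * c + 1) * z" "w - z = (c * c - 1) * z" by (simp_all add: wc algebra_simps)
    then show ?thesis using zn by simp
  qed
  finally have tan: "1 / complex_of_real (tan ((x - t) / 2)) = \<i> * ((w + z) / (w - z))" .
  have wz: "w - z \<noteq> 0" using c1 zn by (simp add: wc field_simps)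
  have "hker (\<lambda>t. cis (real n * t)) x t = (w ^ n * (z ^ n - w ^ n)) * (1 / complex_of_real (tan ((x - t) / 2)))"
  proof -
    have "cis (real n * (x + t)) = w ^ n * z ^ n" "cis (real n * (2 * x)) = w ^ n * w ^ n"
      by (simp_all add: w_def z_def Complex.DeMoivre cis_mult algebra_simps)
    then show ?thesis by (simp add: hker_def right_diff_distrib)
  qed
  also have "z ^ n - w ^ n = (z - w) * (\<Sum>j<n. z ^ j * w ^ (n - Suc j))"
  proof (cases n)
    case (Suc m)
    then show ?thesis using power_diff_sumr2[of z n w]
      by (simp add: mult.commute)
  qed simp
  also have "(w ^ n * ((z - w) * (\<Sum>j<n. z ^ j * w ^ (n - Suc j)))) * (1 / complex_of_real (tan ((x - t) / 2)))
     = - \<i> * ((w + z) * w ^ n * (\<Sum>j<n. z ^ j * w ^ (n - Suc j)))"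
  proof -
    have "(z - w) / (w - z) = -1" using wz by (metis divide_minus_left divide_self minus_diff_eq)
    moreover have "(w ^ n * ((z - w) * S)) * (\<i> * ((w + z) / (w - z))) = ((z - w) / (w - z)) * (\<i> * ((w + z) * w ^ n * S))" for S
      by simp
    ultimately show ?thesis unfolding tan by simp
  qed
  also have "(w + z) * w ^ n * (\<Sum>j<n. z ^ j * w ^ (n - Suc j))
    = (\<Sum>j<n. z ^ j * w ^ (2 * n - j) + z ^ Suc j * w ^ (2 * n - Suc j))"
    unfolding sum_distrib_left
  proof (intro sum.cong refl)
    fix j assume "j \<in> {..<n}"
    then have "2 * n - j = Suc (n + (n - Suc j))" "2 * n - Suc j = n + (n - Suc j)" by auto
    then show "(w + z) * w ^ n * (z ^ j * w ^ (n - Suc j)) = z ^ j * w ^ (2 * n - j) + z ^ Suc j * w ^ (2 * n - Suc j)"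
      by (simp only: power_add power_Suc) (simp add: algebra_simps)
  qed
  finally show ?thesis by (simp add: z_def w_def Complex.DeMoivre del: power_Suc)
qed

lemma AE_circ_sin: "AE t in circ. sin ((x - t) / 2) \<noteq> 0"
proof -
  have "{t. sin ((x - t) / 2) = 0} \<subseteq> range (\<lambda>i::int. x - 2 * (of_int i * pi))"
    by (auto simp: sin_zero_iff_int2 image_iff field_simps)
  then have "countable {t. sin ((x - t) / 2) = 0}" by (rule countable_subset) auto
  then have "{t. sin ((x - t) / 2) = 0} \<in> null_sets lborel" by (rule countable_imp_null_set_lborel)
  then have "AE t in lborel. sin ((x - t) / 2) \<noteq> 0" using AE_not_in by fastforce
  then have "AE t in lebesgue. sin ((x - t) / 2) \<noteq> 0" by (rule AE_completion)
  then show ?thesis unfolding circ_def by (subst AE_restrict_space_iff) auto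
qed

lemma hankel_cis:
  fixes s :: int
  assumes G: "integrable circ G" and s: "s = 1 \<or> s = -1"
  shows "hankel (\<lambda>t. cis (of_int s * (real n * t))) G x
     = - of_int s * \<i> * of_real (2 * pi) * (\<Sum>j<n. fourier G (of_int (- s * int j)) * cis (of_int (s * int (2 * n - j)) * x)
          + fourier G (of_int (- s * int (Suc j))) * cis (of_int (s * int (2 * n - Suc j)) * x))"
proof -
  have *: "hker (\<lambda>t. cis (of_int s * (real n * t))) x t
     = - of_int s * \<i> * (\<Sum>j<n. cis (of_int (s * int j) * t) * cis (of_int (s * int (2 * n - j)) * x)
        + cis (of_int (s * int (Suc j)) * t) * cis (of_int (s * int (2 * n - Suc j)) * x))"
    if t: "sin ((x - t) / 2) \<noteq> 0" for t
  proof (cases "s = 1")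
    case True then show ?thesis using hker_cis[OF t, of n] by simp
  next
    case False
    then have s: "s = -1" using s by simp
    have "hker (\<lambda>t. cis (of_int s * (real n * t))) x t = cnj (hker (\<lambda>t. cis (real n * t)) x t)"
      by (simp add: hker_def s cis_cnj)
    also have "\<dots> = - of_int s * \<i> * (\<Sum>j<n. cis (of_int (s * int j) * t) * cis (of_int (s * int (2 * n - j)) * x)
        + cis (of_int (s * int (Suc j)) * t) * cis (of_int (s * int (2 * n - Suc j)) * x))"
      unfolding hker_cis[OF t] by (simp add: s cis_cnj algebra_simps)
    finally show ?thesis .
  qed
  have i: "integrable circ (\<lambda>t. cis (r * t) * G t)" for r
    by (rule integrable_bounded_mult[OF G, of _ 1]) auto
  have I: "(\<integral>t. cis (of_int m * t) * G t \<partial>circ) = of_real (2 * pi) * fourier G (of_int (- m))" for m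
    by (simp add: fourier_def)
  have step: "k * (\<Sum>j<n. a j * b j + c j * d j) * g = k * (\<Sum>j<n. b j * (a j * g) + d j * (c j * g))"
    for k g :: complex and a b c d :: "nat \<Rightarrow> complex"
    by (simp add: sum_distrib_left sum_distrib_right algebra_simps)
  have "hankel (\<lambda>t. cis (of_int s * (real n * t))) G x = (\<integral>t. - of_int s * \<i> * (\<Sum>j<n. cis (of_int (s * int (2 * n - j)) * x) * (cis (of_int (s * int j) * t) * G t)
        + cis (of_int (s * int (2 * n - Suc j)) * x) * (cis (of_int (s * int (Suc j)) * t) * G t)) \<partial>circ)"
    unfolding hankel_def
  proof (rule integral_cong_AE)
    show "(\<lambda>t. hker (\<lambda>t. cis (of_int s * (real n * t))) x t * G t) \<in> borel_measurable circ"
      using G borel_measurable_circ[OF borel_hker[of "\<lambda>t. cis (of_int s * (real n * t))" x]] by measurable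
    show "AE t in circ. hker (\<lambda>t. cis (of_int s * (real n * t))) x t * G t = - of_int s * \<i> * (\<Sum>j<n. cis (of_int (s * int (2 * n - j)) * x) * (cis (of_int (s * int j) * t) * G t)
        + cis (of_int (s * int (2 * n - Suc j)) * x) * (cis (of_int (s * int (Suc j)) * t) * G t))"
      using AE_circ_sin[of x]
    proof eventually_elim
      case (elim t)
      show ?case unfolding *[OF elim] by (rule step)
    qed
  qed (use i in \<open>auto intro!: borel_measurable_integrable\<close>)
  also have "\<dots> = - of_int s * \<i> * (\<Sum>j<n. cis (of_int (s * int (2 * n - j)) * x) * (\<integral>t. cis (of_int (s * int j) * t) * G t \<partial>circ)
        + cis (of_int (s * int (2 * n - Suc j)) * x) * (\<integral>t. cis (of_int (s * int (Suc j)) * t) * G t \<partial>circ))"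
    using i by simp
  also have "\<dots> = - of_int s * \<i> * of_real (2 * pi) * (\<Sum>j<n. fourier G (of_int (- s * int j)) * cis (of_int (s * int (2 * n - j)) * x)
          + fourier G (of_int (- s * int (Suc j))) * cis (of_int (s * int (2 * n - Suc j)) * x))"
    unfolding I by (simp add: sum_distrib_left sum_distrib_right mult_ac distrib_left)
  finally show ?thesis .
qed

lemma cper_hankel_cis:
  fixes s :: int
  assumes G: "integrable circ G" and s: "s = 1 \<or> s = -1"
  shows "cper (hankel (\<lambda>t. cis (of_int s * (real n * t))) G)"
  unfolding hankel_cis[OF assms, abs_def]
  by (intro cper_cmult cper_sum cper_add cper_cis)

text \<open>
  Smoothing by \<open>P \<tau>\<close> in both variables multiplies each monomial \<open>z ^ j * w ^ (2 n - j)\<close> by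
  \<open>exp (-\<tau>) ^ (2 n)\<close>, because both exponents have the same sign.
\<close>
lemma pois_hankel_cis:
  fixes s :: int
  assumes F: "integrable circ F" and s: "s = 1 \<or> s = -1" and \<tau>: "0 < \<tau>"
  shows "pois \<tau> (hankel (\<lambda>t. cis (of_int s * (real n * t))) (pois \<tau> F)) x
     = of_real (exp (- (2 * \<tau>)) ^ n) * hankel (\<lambda>t. cis (of_int s * (real n * t))) F x"
proof -
  let ?\<rho> = "exp (-\<tau>)"
  let ?G = "pois \<tau> F"
  have G: "integrable circ ?G" by (intro cper_integrable cper_pois F \<tau>)
  let ?e = "\<lambda>m x. cis (of_int (s * int m) * x)"
  have abs_s: "nat \<bar>s * int m\<bar> = m" "nat \<bar>- s * int m\<bar> = m" for m using s by (auto simp: abs_mult)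
  have pow: "?\<rho> ^ j * ?\<rho> ^ (2 * n - j) = exp (- (2 * \<tau>)) ^ n" if "j \<le> 2 * n" for j
  proof -
    have "?\<rho> ^ j * ?\<rho> ^ (2 * n - j) = ?\<rho> ^ (2 * n)" using that by (simp flip: power_add)
    also have "\<dots> = (?\<rho>\<^sup>2) ^ n" by (simp add: power_mult)
    also have "?\<rho>\<^sup>2 = exp (- (2 * \<tau>))" by (simp flip: exp_double)
    finally show ?thesis .
  qed
  have tm: "fourier ?G (of_int (- s * int j)) * pois \<tau> (?e (2 * n - j)) x = of_real (exp (- (2 * \<tau>)) ^ n) * (fourier F (of_int (- s * int j)) * ?e (2 * n - j) x)"
    if "j \<le> 2 * n" for j
  proof -
    have "fourier ?G (of_int (- s * int j)) * pois \<tau> (?e (2 * n - j)) x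
      = of_real (?\<rho> ^ j * ?\<rho> ^ (2 * n - j)) * (fourier F (of_int (- s * int j)) * ?e (2 * n - j) x)"
      unfolding fourier_pois[OF F \<tau>] pois_cis[OF \<tau>] abs_s by simp
    then show ?thesis unfolding pow[OF that] .
  qed
  have cf: "cper (\<lambda>x. A * ?e m x + B * ?e m' x)" for A B m m'
    by (intro cper_add cper_cmult cper_cis)
  have pf: "pois \<tau> (\<lambda>x. A * ?e m x + B * ?e m' x) x = A * pois \<tau> (?e m) x + B * pois \<tau> (?e m') x" for A B m m'
    by (simp only: pois_add[OF cper_cmult[OF cper_cis] cper_cmult[OF cper_cis] \<tau>] pois_cmult[OF cper_cis \<tau>])
  have "pois \<tau> (hankel (\<lambda>t. cis (of_int s * (real n * t))) ?G) x =
     - of_int s * \<i> * of_real (2 * pi) * pois \<tau> (\<lambda>x. \<Sum>j<n. fourier ?G (of_int (- s * int j)) * ?e (2 * n - j) x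
          + fourier ?G (of_int (- s * int (Suc j))) * ?e (2 * n - Suc j) x) x"
    unfolding hankel_cis[OF G s, abs_def]
    by (simp only: pois_cmult[OF cper_sum[OF cf] \<tau>])
  also have "pois \<tau> (\<lambda>x. \<Sum>j<n. fourier ?G (of_int (- s * int j)) * ?e (2 * n - j) x
          + fourier ?G (of_int (- s * int (Suc j))) * ?e (2 * n - Suc j) x) x
    = (\<Sum>j<n. fourier ?G (of_int (- s * int j)) * pois \<tau> (?e (2 * n - j)) x
          + fourier ?G (of_int (- s * int (Suc j))) * pois \<tau> (?e (2 * n - Suc j)) x)"
    by (simp only: pois_sum[OF \<tau> finite_lessThan cf] pf)
  also have "\<dots> = (\<Sum>j<n. of_real (exp (- (2 * \<tau>)) ^ n) * (fourier F (of_int (- s * int j)) * ?e (2 * n - j) x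
          + fourier F (of_int (- s * int (Suc j))) * ?e (2 * n - Suc j) x))"
    by (intro sum.cong refl) (simp only: lessThan_iff distrib_left, subst (1 2) tm, auto)
  finally show ?thesis unfolding hankel_cis[OF F s] by (simp only: sum_distrib_left[symmetric]) (simp only: mult_ac)
qed

lemma hankel_series:
  assumes ser: "trig_series a b B" and a: "summable (\<lambda>n. norm (a n) * (2 * real n))" and b: "summable (\<lambda>n. norm (b n) * (2 * real n))"
    and G: "integrable circ G"
  shows "(\<lambda>n. a n * hankel (\<lambda>t. cis (of_int 1 * (real n * t))) G x + b n * hankel (\<lambda>t. cis (of_int (-1) * (real n * t))) G x) sums hankel B G x"
proof -
  let ?e = "\<lambda>s n t. cis (of_int s * (real n * t))"
  let ?f = "\<lambda>n t. a n * hker (?e 1 n) x t + b n * hker (?e (-1) n) x t"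
  have hkb: "norm (hker (?e 1 n) x t) \<le> 2 * real n" "norm (hker (?e (-1) n) x t) \<le> 2 * real n" for n t
    using hker_lipschitz[OF chord_lipschitz_cis(1), of n x t] hker_lipschitz[OF chord_lipschitz_cis(2), of n x t] by simp_all
  have [measurable]: "hker (?e s n) x \<in> borel_measurable borel" for s n by (rule borel_hker) measurable
  have "(\<lambda>n. \<integral>t. ?f n t * G t \<partial>circ) sums (\<integral>t. hker B x t * G t \<partial>circ)"
  proof (rule integral_sums_circ[OF G])
    show "?f n \<in> borel_measurable borel" for n by measurable
    show "norm (?f n t) \<le> norm (a n) * (2 * real n) + norm (b n) * (2 * real n)" for n t
      by (rule order_trans[OF norm_triangle_ineq]) (auto simp: norm_mult intro!: add_mono mult_left_mono hkb[simplified])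
    show "summable (\<lambda>n. norm (a n) * (2 * real n) + norm (b n) * (2 * real n))" by (intro summable_add a b)
    fix t
    let ?g = "\<lambda>n x. a n * cis (real n * x) + b n * cis (- (real n * x))"
    have "(\<lambda>n. (?g n (x + t) - ?g n (2 * x)) / complex_of_real (tan ((x - t) / 2))) sums hker B x t"
      unfolding hker_def using ser unfolding trig_series_def by (intro sums_divide sums_diff) auto
    moreover have "(?g n (x + t) - ?g n (2 * x)) / complex_of_real (tan ((x - t) / 2)) = ?f n t" for n
      by (simp add: hker_def diff_divide_distrib add_divide_distrib right_diff_distrib)
    ultimately show "(\<lambda>n. ?f n t) sums hker B x t" by simp
  qed
  moreover have "(\<integral>t. ?f n t * G t \<partial>circ) = a n * hankel (?e 1 n) G x + b n * hankel (?e (-1) n) G x" for n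
  proof -
    have i: "integrable circ (\<lambda>t. hker (?e 1 n) x t * G t)" "integrable circ (\<lambda>t. hker (?e (-1) n) x t * G t)"
      using hkb by (auto intro!: integrable_bounded_mult[OF G, of _ "2 * real n"])
    have "?f n t * G t = a n * (hker (?e 1 n) x t * G t) + b n * (hker (?e (-1) n) x t * G t)" for t by (simp add: algebra_simps)
    then show ?thesis using i unfolding hankel_def by simp
  qed
  ultimately show ?thesis by (simp add: hankel_def)
qed

text \<open>
  Smoothing of the symbol is smoothing of input and output. The symbol is assumed to be a Poisson integral so
  that its Fourier series converges fast enough to sum \<open>pois_hankel_cis\<close> over all frequencies \<open>n\<close>, where
  the kernel of frequency \<open>n\<close> is only bounded by \<open>2 n\<close>.
\<close>
lemma hankel_pois:
  assumes c: "cper c" and \<tau>: "0 < \<tau>" and F: "integrable circ F"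
  defines "B \<equiv> pois \<tau> c"
  shows "hankel (pois (2 * \<tau>) B) F x = pois \<tau> (hankel B (pois \<tau> F)) x"
    and "integrable circ G \<Longrightarrow> cper (hankel B G)"
proof -
  define \<rho> where "\<rho> = exp (-\<tau>)"
  have \<rho>: "0 \<le> \<rho>" "\<rho> < 1" using \<tau> by (auto simp: \<rho>_def)
  define a b where "a n = of_real (\<rho> ^ n) * (weight n * fourier c n)" and "b n = of_real (\<rho> ^ n) * (weight n * fourier c (- real n))" for n
  have ser: "trig_series a b B"
    using poisson_integral_series[OF cper_integrable[OF c] \<rho>] unfolding a_def[abs_def] b_def[abs_def] B_def pois_def \<rho>_def .
  define N where "N = (\<integral>t. norm (c t) \<partial>circ) / (2 * pi)"
  have N: "norm (weight n * fourier c h) \<le> N" for n h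
    unfolding norm_mult N_def using mult_mono[OF norm_weight[of n] norm_fourier[of c h]] by simp
  have nr: "summable (\<lambda>n. \<rho> ^ n * (N * (2 * real n)))"
  proof -
    have "summable (\<lambda>n. real (Suc n) * \<rho> ^ n)"
      using geometric_deriv_sums[of \<rho>] \<rho> by (auto simp: sums_iff)
    then have "summable (\<lambda>n. real n * \<rho> ^ n)"
      by (rule summable_comparison_test') (use \<rho> in \<open>auto intro!: mult_right_mono\<close>)
    from summable_mult[OF this, of "2 * N"] show ?thesis by (simp add: mult_ac)
  qed
  have sab: "summable (\<lambda>n. norm (a n) * (2 * real n))" "summable (\<lambda>n. norm (b n) * (2 * real n))"
  proof -
    have "norm (a n) \<le> \<rho> ^ n * N" "norm (b n) \<le> \<rho> ^ n * N" for n
      using mult_left_mono[OF N[of n "real n"], of "\<rho> ^ n"] mult_left_mono[OF N[of n "- real n"], of "\<rho> ^ n"] \<rho>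
      by (simp_all add: a_def b_def norm_mult norm_power)
    from mult_right_mono[OF this(1)] mult_right_mono[OF this(2)]
    have "norm (a n) * (2 * real n) \<le> \<rho> ^ n * (N * (2 * real n))" "norm (b n) * (2 * real n) \<le> \<rho> ^ n * (N * (2 * real n))" for n
      by (simp_all only: mult.assoc)
    then show "summable (\<lambda>n. norm (a n) * (2 * real n))" "summable (\<lambda>n. norm (b n) * (2 * real n))"
      by (auto intro!: summable_comparison_test'[OF nr])
  qed
  let ?e = "\<lambda>s n t. cis (of_int s * (real n * t))"
  define N' where "N' G = (\<integral>t. norm (G t) \<partial>circ)" for G :: "real \<Rightarrow> complex"
  have he: "norm (hankel (?e 1 n) G x) \<le> 2 * real n * N' G" "norm (hankel (?e (-1) n) G x) \<le> 2 * real n * N' G"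
    if "integrable circ G" for G n x
    using hankel_norm[OF _ chord_lipschitz_cis(1) that, of n x] hankel_norm[OF _ chord_lipschitz_cis(2) that, of n x]
    by (simp_all add: N'_def)
  have ce: "cper (\<lambda>x. a n * hankel (?e 1 n) G x + b n * hankel (?e (-1) n) G x)" if "integrable circ G" for G n
    by (intro cper_add cper_cmult cper_hankel_cis that) auto
  have te: "norm (a n * hankel (?e 1 n) G x + b n * hankel (?e (-1) n) G x) \<le> norm (a n) * (2 * real n) * N' G + norm (b n) * (2 * real n) * N' G"
    if G: "integrable circ G" for G n x
    using mult_left_mono[OF he(1)[OF G, of n x], of "norm (a n)"] mult_left_mono[OF he(2)[OF G, of n x], of "norm (b n)"]
    by (intro order_trans[OF norm_triangle_ineq] add_mono) (auto simp: norm_mult mult.assoc)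
  have st: "summable (\<lambda>n. norm (a n) * (2 * real n) * N' G + norm (b n) * (2 * real n) * N' G)" for G
    by (intro summable_add summable_mult2 sab)
  show "cper (hankel B G)" if G: "integrable circ G"
    by (rule cper_sums[OF ce[OF G] te[OF G] st hankel_series[OF ser sab G]])
  have P: "integrable circ (pois \<tau> F)" by (intro cper_integrable cper_pois F \<tau>)
  have "(\<lambda>n. pois \<tau> (\<lambda>x. a n * hankel (?e 1 n) (pois \<tau> F) x + b n * hankel (?e (-1) n) (pois \<tau> F) x) x) sums pois \<tau> (hankel B (pois \<tau> F)) x"
    by (rule pois_sums[OF ce[OF P] te[OF P] st hankel_series[OF ser sab P] \<tau>])
  moreover have "pois \<tau> (\<lambda>x. a n * hankel (?e 1 n) (pois \<tau> F) x + b n * hankel (?e (-1) n) (pois \<tau> F) x) x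
    = (of_real (exp (- (2 * \<tau>)) ^ n) * a n) * hankel (?e 1 n) F x + (of_real (exp (- (2 * \<tau>)) ^ n) * b n) * hankel (?e (-1) n) F x" for n
  proof -
    have h: "cper (hankel (?e 1 n) (pois \<tau> F))" "cper (hankel (?e (-1) n) (pois \<tau> F))"
      by (intro cper_hankel_cis P; simp)+
    show ?thesis
      unfolding pois_add[OF cper_cmult[OF h(1)] cper_cmult[OF h(2)] \<tau>] pois_cmult[OF h(1) \<tau>] pois_cmult[OF h(2) \<tau>]
      using pois_hankel_cis[OF F _ \<tau>, of 1 n x] pois_hankel_cis[OF F _ \<tau>, of "-1" n x] by simp
  qed
  moreover have "(\<lambda>n. (of_real (exp (- (2 * \<tau>)) ^ n) * a n) * hankel (?e 1 n) F x + (of_real (exp (- (2 * \<tau>)) ^ n) * b n) * hankel (?e (-1) n) F x) sums hankel (pois (2 * \<tau>) B) F x"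
  proof (rule hankel_series[OF _ _ _ F])
    show "trig_series (\<lambda>n. of_real (exp (- (2 * \<tau>)) ^ n) * a n) (\<lambda>n. of_real (exp (- (2 * \<tau>)) ^ n) * b n) (pois (2 * \<tau>) B)"
      unfolding pois_def[of "2 * \<tau>"] by (rule poisson_trig_series[OF ser]) (use \<tau> in auto)
    have "norm (of_real (exp (- (2 * \<tau>)) ^ n) * z) \<le> norm z" for n and z :: complex
      using \<tau> by (simp add: norm_mult norm_power mult_left_le_one_le power_le_one)
    then have "norm (of_real (exp (- (2 * \<tau>)) ^ n) * z) * (2 * real n) \<le> norm z * (2 * real n)" for n and z :: complex
      by (intro mult_right_mono) auto
    then show "summable (\<lambda>n. norm (of_real (exp (- (2 * \<tau>)) ^ n) * a n) * (2 * real n))"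
      "summable (\<lambda>n. norm (of_real (exp (- (2 * \<tau>)) ^ n) * b n) * (2 * real n))"
      by (intro summable_comparison_test'[OF sab(1)] summable_comparison_test'[OF sab(2)], simp)+
  qed
  ultimately show "hankel (pois (2 * \<tau>) B) F x = pois \<tau> (hankel B (pois \<tau> F)) x"
    by (simp only: sums_unique2)
qed

section \<open>Powers of the chord and kernel bounds\<close>
lemma nn_integral_abs_le:
  fixes \<phi> :: "real \<Rightarrow> ennreal"
  assumes [measurable]: "\<phi> \<in> borel_measurable borel"
  shows "(\<integral>\<^sup>+x. \<phi> \<bar>x\<bar> \<partial>lborel) \<le> 2 * (\<integral>\<^sup>+x. \<phi> x * indicator {0..} x \<partial>lborel)"
proof -
  have "(\<integral>\<^sup>+x. \<phi> \<bar>x\<bar> \<partial>lborel) \<le> (\<integral>\<^sup>+x. \<phi> x * indicator {0..} x + \<phi> (-x) * indicator {0..} (-x) \<partial>lborel)"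
    by (intro nn_integral_mono) (auto split: split_indicator)
  also have "\<dots> = (\<integral>\<^sup>+x. \<phi> x * indicator {0..} x \<partial>lborel) + (\<integral>\<^sup>+x. \<phi> (-x) * indicator {0..} (-x) \<partial>lborel)"
    by (rule nn_integral_add) measurable
  also have "(\<integral>\<^sup>+x. \<phi> (-x) * indicator {0..} (-x) \<partial>lborel) = (\<integral>\<^sup>+x. \<phi> x * indicator {0..} x \<partial>lborel)"
    by (subst (2) nn_integral_real_affine[of _ "-1" 0]) auto
  finally show ?thesis by (simp add: mult_2)
qed

lemma nn_integral_powr_small:
  assumes "0 < s" "0 \<le> c"
  shows "(\<integral>\<^sup>+x. ennreal (\<bar>x\<bar> powr (s - 1) * indicator {..c} \<bar>x\<bar>) \<partial>lborel) \<le> ennreal (2 * c powr s / s)"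
proof -
  let ?\<phi> = "\<lambda>x. ennreal (x powr (s - 1) * indicator {..c} x)"
  have "(\<integral>\<^sup>+x. ?\<phi> \<bar>x\<bar> \<partial>lborel) \<le> 2 * (\<integral>\<^sup>+x. ?\<phi> x * indicator {0..} x \<partial>lborel)"
    by (rule nn_integral_abs_le) measurable
  also have "(\<integral>\<^sup>+x. ?\<phi> x * indicator {0..} x \<partial>lborel) = (\<integral>\<^sup>+x. ennreal (indicator {0..c} x * x powr (s - 1)) \<partial>lborel)"
    by (intro nn_integral_cong) (auto split: split_indicator)
  also have "\<dots> = ennreal (c powr s / s)"
    using has_integral_powr_from_0[of "s - 1" c] assms
    by (intro nn_integral_has_integral_lebesgue) auto
  also have "2 * ennreal (c powr s / s) = ennreal (2 * c powr s / s)"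
    using assms by (simp add: ennreal_mult[symmetric] flip: ennreal_numeral)
  finally show ?thesis .
qed

lemma nn_integral_powr_large:
  assumes "0 < s" "0 < c"
  shows "(\<integral>\<^sup>+x. ennreal (\<bar>x\<bar> powr (-s - 1) * indicator {c..} \<bar>x\<bar>) \<partial>lborel) \<le> ennreal (2 * c powr (-s) / s)"
proof -
  let ?\<phi> = "\<lambda>x. ennreal (x powr (-s - 1) * indicator {c..} x)"
  have "(\<integral>\<^sup>+x. ?\<phi> \<bar>x\<bar> \<partial>lborel) \<le> 2 * (\<integral>\<^sup>+x. ?\<phi> x * indicator {0..} x \<partial>lborel)"
    by (rule nn_integral_abs_le) measurable
  also have "(\<integral>\<^sup>+x. ?\<phi> x * indicator {0..} x \<partial>lborel) = (\<integral>\<^sup>+x. ennreal (indicator {c..} x * x powr (-s - 1)) \<partial>lborel)"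
    using assms by (intro nn_integral_cong) (auto split: split_indicator)
  also have "\<dots> = ennreal (c powr (-s) / s)"
    using has_integral_powr_to_inf[of "-s - 1" c] assms
    by (intro nn_integral_has_integral_lebesgue) auto
  also have "2 * ennreal (c powr (-s) / s) = ennreal (2 * c powr (-s) / s)"
    using assms by (simp add: ennreal_mult[symmetric] flip: ennreal_numeral)
  finally show ?thesis .
qed

definition near :: "real \<Rightarrow> real \<Rightarrow> real \<Rightarrow> real" where
  "near s a x = chord x powr (s - 1) * indicator {..a} (chord x)"

definition far :: "real \<Rightarrow> real \<Rightarrow> real \<Rightarrow> real" where
  "far s a x = chord x powr (-s - 1) * indicator {a<..} (chord x)"

lemma near_nonneg [simp]: "0 \<le> near s a x" and far_nonneg [simp]: "0 \<le> far s a x"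
  by (simp_all add: near_def far_def)

lemma borel_near [measurable]: "near s a \<in> borel_measurable borel"
  and borel_far [measurable]: "far s a \<in> borel_measurable borel"
  unfolding near_def[abs_def] far_def[abs_def] by measurable

lemma nn_integral_circ_le_lborel:
  assumes "\<And>x. x \<in> {-pi..pi} \<Longrightarrow> g x \<le> G x"
  shows "(\<integral>\<^sup>+x. g x \<partial>circ) \<le> (\<integral>\<^sup>+x. G x \<partial>lborel)"
proof -
  have "(\<integral>\<^sup>+x. g x \<partial>circ) = (\<integral>\<^sup>+x. g x * indicator {-pi..pi} x \<partial>lborel)"
    unfolding circ_def by (subst nn_integral_restrict_space) (auto simp: nn_integral_completion)
  also have "\<dots> \<le> (\<integral>\<^sup>+x. G x \<partial>lborel)"
    using assms by (intro nn_integral_mono) (auto split: split_indicator)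
  finally show ?thesis .
qed

lemma powr_chord_le:
  assumes "x \<in> {-pi..pi}" "e \<le> 0" shows "chord x powr e \<le> pi powr (-e) * \<bar>x\<bar> powr e"
proof (cases "x = 0")
  case False
  have "chord x powr e \<le> (\<bar>x\<bar> / pi) powr e"
    using assms chord_ge[of x] False by (intro powr_mono2') auto
  also have "\<dots> = pi powr (-e) * \<bar>x\<bar> powr e" by (simp add: powr_divide powr_minus field_simps)
  finally show ?thesis .
qed simp

lemma nn_integral_near:
  assumes s: "0 < s" "s \<le> 1" and a: "0 \<le> a"
  shows "(\<integral>\<^sup>+x. ennreal (near s a (x - y)) \<partial>circ) \<le> ennreal (2 * pi / s * a powr s)"
proof -
  have "(\<integral>\<^sup>+x. ennreal (near s a (x - y)) \<partial>circ) = (\<integral>\<^sup>+x. ennreal (near s a x) \<partial>circ)"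
    using nn_integral_periodic_shift[of "\<lambda>x. ennreal (near s a x)" "-y"] by (simp add: near_def chord_periodic)
  also have "\<dots> \<le> (\<integral>\<^sup>+x. ennreal (pi powr (1 - s)) * ennreal (\<bar>x\<bar> powr (s - 1) * indicator {..pi * a} \<bar>x\<bar>) \<partial>lborel)"
  proof (rule nn_integral_circ_le_lborel)
    fix x :: real assume x: "x \<in> {-pi..pi}"
    have "\<bar>x\<bar> \<le> pi * chord x" using chord_ge[of x] x by (auto simp: divide_le_eq mult.commute)
    then have "chord x \<le> a \<Longrightarrow> \<bar>x\<bar> \<le> pi * a"
      by (rule order_trans) (auto intro: mult_left_mono)
    then have "near s a x \<le> pi powr (1 - s) * (\<bar>x\<bar> powr (s - 1) * indicator {..pi * a} \<bar>x\<bar>)"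
      using powr_chord_le[OF x, of "s - 1"] s by (auto simp: near_def split: split_indicator)
    then show "ennreal (near s a x) \<le> ennreal (pi powr (1 - s)) * ennreal (\<bar>x\<bar> powr (s - 1) * indicator {..pi * a} \<bar>x\<bar>)"
      by (simp add: ennreal_mult[symmetric] ennreal_leI)
  qed
  also have "\<dots> = ennreal (pi powr (1 - s)) * (\<integral>\<^sup>+x. ennreal (\<bar>x\<bar> powr (s - 1) * indicator {..pi * a} \<bar>x\<bar>) \<partial>lborel)"
    by (rule nn_integral_cmult) measurable
  also have "\<dots> \<le> ennreal (pi powr (1 - s)) * ennreal (2 * (pi * a) powr s / s)"
    using s a by (intro mult_left_mono nn_integral_powr_small) auto
  also have "\<dots> = ennreal (pi powr (1 - s) * (2 * (pi * a) powr s / s))"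
    using s by (subst ennreal_mult) auto
  also have "pi powr (1 - s) * (2 * (pi * a) powr s / s) = 2 * pi / s * a powr s"
  proof -
    have "pi powr (1 - s) * pi powr s = pi" by (simp flip: powr_add)
    then show ?thesis using a by (simp add: powr_mult field_simps)
  qed
  finally show ?thesis .
qed

lemma nn_integral_far:
  assumes s: "0 < s" and a: "0 < a"
  shows "(\<integral>\<^sup>+x. ennreal (far s a (x - y)) \<partial>circ) \<le> ennreal (2 * pi powr (s + 1) / s * a powr (-s))"
proof -
  have "(\<integral>\<^sup>+x. ennreal (far s a (x - y)) \<partial>circ) = (\<integral>\<^sup>+x. ennreal (far s a x) \<partial>circ)"
    using nn_integral_periodic_shift[of "\<lambda>x. ennreal (far s a x)" "-y"] by (simp add: far_def chord_periodic)
  also have "\<dots> \<le> (\<integral>\<^sup>+x. ennreal (pi powr (s + 1)) * ennreal (\<bar>x\<bar> powr (-s - 1) * indicator {a..} \<bar>x\<bar>) \<partial>lborel)"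
  proof (rule nn_integral_circ_le_lborel)
    fix x :: real assume x: "x \<in> {-pi..pi}"
    have "a < chord x \<Longrightarrow> a \<le> \<bar>x\<bar>" using chord_le[of x] a by linarith
    then have "far s a x \<le> pi powr (s + 1) * (\<bar>x\<bar> powr (-s - 1) * indicator {a..} \<bar>x\<bar>)"
      using powr_chord_le[OF x, of "-s - 1"] s by (auto simp: far_def add.commute split: split_indicator)
    then show "ennreal (far s a x) \<le> ennreal (pi powr (s + 1)) * ennreal (\<bar>x\<bar> powr (-s - 1) * indicator {a..} \<bar>x\<bar>)"
      by (simp add: ennreal_mult[symmetric] ennreal_leI)
  qed
  also have "\<dots> = ennreal (pi powr (s + 1)) * (\<integral>\<^sup>+x. ennreal (\<bar>x\<bar> powr (-s - 1) * indicator {a..} \<bar>x\<bar>) \<partial>lborel)"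
    by (rule nn_integral_cmult) measurable
  also have "\<dots> \<le> ennreal (pi powr (s + 1)) * ennreal (2 * a powr (-s) / s)"
    using s a by (intro mult_left_mono nn_integral_powr_large) auto
  also have "\<dots> = ennreal (2 * pi powr (s + 1) / s * a powr (-s))" using s by (simp add: ennreal_mult[symmetric] mult_ac)
  finally show ?thesis .
qed

text \<open>
  Powers \<open>chord powr (\<gamma> - 1)\<close> are reproduced by all Poisson averages up to a constant. At points \<open>t\<close> with
  \<open>chord (t - y) \<ge> S / 2\<close>, where \<open>S = chord (x - y)\<close>, the power is comparable to its value at \<open>x\<close>; at the other
  points \<open>t\<close> is at distance at least \<open>S / 2\<close> from \<open>x\<close>, where the kernel is at most \<open>4 / S\<close> for every radius.
  This is how a bound for the kernel of the operator passes to the Poisson maximal function of its values.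
\<close>
lemma poisson_chord_powr:
  assumes \<gamma>: "0 < \<gamma>" "\<gamma> \<le> 1" and \<rho>: "0 \<le> \<rho>" "\<rho> < 1" and xy: "chord (x - y) \<noteq> 0"
  shows "(\<integral>\<^sup>+t. ennreal (poisson_kernel \<rho> (x - t)) * ennreal (chord (t - y) powr (\<gamma> - 1)) \<partial>circ)
     \<le> ennreal ((4 * pi + 8 * pi / \<gamma>) * chord (x - y) powr (\<gamma> - 1))"
proof -
  define S where "S = chord (x - y)"
  have S: "S > 0" using xy by (simp add: S_def less_le)
  define c1 where "c1 = 2 * S powr (\<gamma> - 1)"
  have pt: "poisson_kernel \<rho> (x - t) * chord (t - y) powr (\<gamma> - 1) \<le> c1 * poisson_kernel \<rho> (x - t) + 4 / S * near \<gamma> (S/2) (t - y)" for t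
  proof (cases "chord (t - y) \<le> S / 2")
    case True
    have "S \<le> chord (x - t) + chord (t - y)" using chord_add[of "x - t" "t - y"] by (simp add: S_def)
    then have ge: "S / 2 \<le> chord (x - t)" using True by simp
    then have "poisson_kernel \<rho> (x - t) * (S / 2) \<le> 2"
      using poisson_kernel_chord[OF \<rho>, of "x - t"] mult_left_mono[OF ge poisson_kernel_nonneg[OF \<rho>, of "x - t"]] by linarith
    then have "poisson_kernel \<rho> (x - t) \<le> 4 / S" using S by (simp add: field_simps)
    then have "poisson_kernel \<rho> (x - t) * chord (t - y) powr (\<gamma> - 1) \<le> 4 / S * near \<gamma> (S/2) (t - y)"
      using True mult_right_mono[of _ "4 / S" "chord (t - y) powr (\<gamma> - 1)"] by (simp add: near_def)
    then show ?thesis using \<rho> by (simp add: c1_def add_increasing)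
  next
    case False
    have "chord (t - y) powr (\<gamma> - 1) \<le> (S/2) powr (\<gamma> - 1)" using False S \<gamma> by (intro powr_mono2') auto
    also have "\<dots> = 2 powr (1 - \<gamma>) * S powr (\<gamma> - 1)" using S by (simp add: powr_divide powr_diff)
    also have "\<dots> \<le> 2 powr 1 * S powr (\<gamma> - 1)" using \<gamma> by (intro mult_right_mono powr_mono) auto
    finally have "chord (t - y) powr (\<gamma> - 1) \<le> c1" by (simp add: c1_def)
    from mult_left_mono[OF this poisson_kernel_nonneg[OF \<rho>, of "x - t"]]
    have "poisson_kernel \<rho> (x - t) * chord (t - y) powr (\<gamma> - 1) \<le> c1 * poisson_kernel \<rho> (x - t)" by (simp add: mult.commute)
    then show ?thesis using S by (simp add: add_increasing2)
  qed
  have [measurable]: "(\<lambda>t. poisson_kernel \<rho> (x - t)) \<in> borel_measurable circ" "(\<lambda>t. near \<gamma> (S/2) (t - y)) \<in> borel_measurable circ"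
    by (intro borel_measurable_circ; measurable)+
  have "(\<integral>\<^sup>+t. ennreal (poisson_kernel \<rho> (x - t)) * ennreal (chord (t - y) powr (\<gamma> - 1)) \<partial>circ)
    \<le> (\<integral>\<^sup>+t. ennreal c1 * ennreal (poisson_kernel \<rho> (x - t)) + ennreal (4 / S) * ennreal (near \<gamma> (S/2) (t - y)) \<partial>circ)"
  proof (rule nn_integral_mono)
    fix t
    have p: "0 \<le> poisson_kernel \<rho> (x - t)" using \<rho> by simp
    have "ennreal (poisson_kernel \<rho> (x - t)) * ennreal (chord (t - y) powr (\<gamma> - 1)) = ennreal (poisson_kernel \<rho> (x - t) * chord (t - y) powr (\<gamma> - 1))"
      using p by (simp add: ennreal_mult)
    also have "\<dots> \<le> ennreal (c1 * poisson_kernel \<rho> (x - t) + 4 / S * near \<gamma> (S/2) (t - y))"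
      by (rule ennreal_leI[OF pt])
    also have "\<dots> = ennreal (c1 * poisson_kernel \<rho> (x - t)) + ennreal (4 / S * near \<gamma> (S/2) (t - y))"
      using p S by (intro ennreal_plus mult_nonneg_nonneg) (auto simp: c1_def)
    also have "\<dots> = ennreal c1 * ennreal (poisson_kernel \<rho> (x - t)) + ennreal (4 / S) * ennreal (near \<gamma> (S/2) (t - y))"
      using p S by (intro arg_cong2[of _ _ _ _ "(+)"] ennreal_mult) (auto simp: c1_def)
    finally show "ennreal (poisson_kernel \<rho> (x - t)) * ennreal (chord (t - y) powr (\<gamma> - 1)) \<le> \<dots>" .
  qed
  also have "\<dots> = ennreal c1 * (\<integral>\<^sup>+t. ennreal (poisson_kernel \<rho> (x - t)) \<partial>circ) + ennreal (4 / S) * (\<integral>\<^sup>+t. ennreal (near \<gamma> (S/2) (t - y)) \<partial>circ)"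
    by (subst nn_integral_add) (auto simp: nn_integral_cmult)
  also have "\<dots> \<le> ennreal c1 * ennreal (2 * pi) + ennreal (4 / S) * ennreal (2 * pi / \<gamma> * (S/2) powr \<gamma>)"
    using \<gamma> S by (intro add_mono mult_left_mono nn_integral_near) (auto simp: nn_integral_poisson_kernel[OF \<rho>])
  also have "\<dots> = ennreal (c1 * (2 * pi) + 4 / S * (2 * pi / \<gamma> * (S/2) powr \<gamma>))"
    using S \<gamma> by (simp add: c1_def ennreal_mult[symmetric] ennreal_plus[symmetric] del: ennreal_plus)
  also have "\<dots> \<le> ennreal ((4 * pi + 8 * pi / \<gamma>) * S powr (\<gamma> - 1))"
  proof (rule ennreal_leI)
    have "(S/2) powr \<gamma> \<le> S powr \<gamma>" using S \<gamma> by (intro powr_mono2) auto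
    then have "4 / S * (2 * pi / \<gamma> * (S/2) powr \<gamma>) \<le> 4 / S * (2 * pi / \<gamma> * S powr \<gamma>)" using S \<gamma> by (intro mult_left_mono) auto
    also have "\<dots> = 8 * pi / \<gamma> * S powr (\<gamma> - 1)" using S by (simp add: powr_diff mult_ac)
    finally show "c1 * (2 * pi) + 4 / S * (2 * pi / \<gamma> * (S/2) powr \<gamma>) \<le> (4 * pi + 8 * pi / \<gamma>) * S powr (\<gamma> - 1)"
      by (simp add: c1_def distrib_right)
  qed
  finally show ?thesis by (simp add: S_def)
qed

lemma chord_lipschitz_smoothed:
  assumes c: "cper c" "\<And>x. norm (c x) \<le> M" and \<eta>: "0 < \<eta>"
  shows "chord_lipschitz (2 * M / \<eta>) (pois \<eta> c)"
  unfolding chord_lipschitz_def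
proof (intro allI)
  fix x y
  let ?k = "\<lambda>x t. poisson_kernel (exp (-\<eta>)) (x - t)"
  have ik: "integrable circ (\<lambda>t. ?k x t)" for x using \<eta> by (intro integrable_poisson_kernel) auto
  have ikc: "integrable circ (\<lambda>t. complex_of_real (?k x t) * c t)" for x
    using \<eta> by (intro integrable_kernel_mult cper_integrable c) auto
  have M0: "0 \<le> M" using order_trans[OF norm_ge_zero c(2)] .
  have eq: "pois \<eta> c x - pois \<eta> c y = (\<integral>t. complex_of_real (?k x t - ?k y t) * c t \<partial>circ) / complex_of_real (2 * pi)"
    using ikc[of x] ikc[of y] by (simp add: pois_def poisson_integral_circ left_diff_distrib diff_divide_distrib)
  have "norm (pois \<eta> c x - pois \<eta> c y) \<le> (\<integral>t. (chord (x - y) / \<eta> * M) * (?k x t + ?k y t) \<partial>circ) / (2 * pi)"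
    unfolding eq norm_divide
  proof (intro divide_mono order_trans[OF integral_norm_bound] integral_mono')
    show "integrable circ (\<lambda>t. chord (x - y) / \<eta> * M * (?k x t + ?k y t))" using ik by auto
    fix t
    have "\<bar>?k x t - ?k y t\<bar> * norm (c t) \<le> (chord (x - y) / \<eta> * (?k x t + ?k y t)) * M"
      using poisson_kernel_diff[OF \<eta>, of "x - t" "y - t"] c(2)[of t] \<eta> by (intro mult_mono) auto
    then show "norm (complex_of_real (?k x t - ?k y t) * c t) \<le> chord (x - y) / \<eta> * M * (?k x t + ?k y t)"
      unfolding norm_mult norm_of_real by (simp add: mult_ac)
    show "0 \<le> chord (x - y) / \<eta> * M * (?k x t + ?k y t)" using \<eta> M0 by (intro mult_nonneg_nonneg add_nonneg_nonneg) auto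
  qed auto
  also have "\<dots> = 2 * M / \<eta> * chord (x - y)"
  proof -
    have I: "(\<integral>t. ?k x t + ?k y t \<partial>circ) = 4 * pi"
      using ik[of x] ik[of y] integral_poisson_kernel[of "exp (-\<eta>)"] \<eta> by simp
    show ?thesis unfolding integral_mult_right_zero I by simp
  qed
  finally show "norm (pois \<eta> c x - pois \<eta> c y) \<le> 2 * M / \<eta> * chord (x - y)" .
qed

text \<open>
  Interpolation between the Lipschitz bound \<open>2 M / \<eta>\<close> and the size bound \<open>2 M / chord (x - t)\<close>.
\<close>
lemma hker_smoothed_bound:
  assumes c: "cper c" "\<And>x. norm (c x) \<le> M" and \<eta>: "0 < \<eta>" and \<gamma>: "0 < \<gamma>" "\<gamma> < 1"
  shows "norm (hker (pois \<eta> c) x t) \<le> 2 * M * \<eta> powr (-\<gamma>) * chord (x - t) powr (\<gamma> - 1)"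
proof (cases "chord (x - t) = 0")
  case True
  then show ?thesis using hker_bounded[of "pois \<eta> c" M x t] pois_contraction[OF \<eta> c(2)] by simp
next
  case False
  define u where "u = norm (hker (pois \<eta> c) x t)"
  let ?s = "chord (x - t)"
  have s: "?s > 0" using False by (simp add: less_le)
  have M0: "0 \<le> M" using order_trans[OF norm_ge_zero c(2)] .
  have u1: "u \<le> 2 * M / \<eta>" unfolding u_def by (rule hker_lipschitz[OF chord_lipschitz_smoothed[OF c \<eta>]])
  have u2: "u \<le> 2 * M / ?s" unfolding u_def by (rule hker_bounded) (rule pois_contraction[OF \<eta> c(2)])
  have "u = u powr \<gamma> * u powr (1 - \<gamma>)"
  proof (cases "u = 0")
    case False then show ?thesis by (simp add: u_def flip: powr_add)
  qed simp
  also have "\<dots> \<le> (2 * M / \<eta>) powr \<gamma> * (2 * M / ?s) powr (1 - \<gamma>)"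
    using u1 u2 \<gamma> by (intro mult_mono powr_mono2) (auto simp: u_def)
  also have "\<dots> = ((2 * M) powr \<gamma> * (2 * M) powr (1 - \<gamma>)) * \<eta> powr (-\<gamma>) * ?s powr (-(1 - \<gamma>))"
    using M0 \<eta> s unfolding powr_minus by (simp add: powr_divide) (simp add: field_simps)
  also have "(2 * M) powr \<gamma> * (2 * M) powr (1 - \<gamma>) = 2 * M"
  proof (cases "M = 0")
    case False then show ?thesis using M0 by (simp flip: powr_add)
  qed simp
  finally show ?thesis by (simp add: u_def)
qed

section \<open>Sums over dyadic scales\<close>
lemma two_sided_geometric:
  fixes z r :: real
  assumes r: "1 < r" and z: "0 < z"
  shows "(\<Sum>j\<le>J. min (z * r ^ j) (1 / (z * r ^ j))) \<le> 2 * r / (r - 1)"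
proof -
  have c: "r / (r - 1) = 1 + 1 / (r - 1)" using r by (simp add: field_simps)
  have sh: "(\<Sum>j\<le>Suc J. min (z * r ^ j) (1 / (z * r ^ j))) = min z (1 / z) + (\<Sum>j\<le>J. min ((z * r) * r ^ j) (1 / ((z * r) * r ^ j)))" for z J
    by (subst sum.atMost_Suc_shift) (simp add: mult.assoc)
  have big: "(\<Sum>j\<le>J. min (z * r ^ j) (1 / (z * r ^ j))) \<le> (1 / z) * (r / (r - 1))" if "1 \<le> z" for z J
    using that
  proof (induction J arbitrary: z)
    case 0
    have "min z (1 / z) \<le> (1 / z) * 1" by simp
    also have "\<dots> \<le> (1 / z) * (r / (r - 1))" using 0 r by (intro mult_left_mono) (auto simp: c)
    finally show ?case by simp
  next
    case (Suc J)
    have "1 * 1 \<le> z * r" using Suc.prems r by (intro mult_mono) auto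
    then have "1 \<le> z * r" by simp
    then have "(\<Sum>j\<le>J. min ((z * r) * r ^ j) (1 / ((z * r) * r ^ j))) \<le> (1 / (z * r)) * (r / (r - 1))" by (rule Suc.IH)
    also have "\<dots> = (1 / z) * (1 / (r - 1))" using r by simp
    finally have "(\<Sum>j\<le>Suc J. min (z * r ^ j) (1 / (z * r ^ j))) \<le> 1 / z + (1 / z) * (1 / (r - 1))"
      unfolding sh by (intro add_mono) auto
    then show ?case unfolding c by (simp add: distrib_left)
  qed
  have "(\<Sum>j\<le>J. min (z * r ^ j) (1 / (z * r ^ j))) \<le> 2 * r / (r - 1) - z / (r - 1)" if "0 < z" "z \<le> 1" for z
    using that
  proof (induction J arbitrary: z)
    case 0
    have "z * (r / (r - 1)) \<le> 1 * (r / (r - 1))" using 0 r by (intro mult_right_mono) auto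
    moreover have "z * (r / (r - 1)) = z + z / (r - 1)" unfolding c by (simp add: distrib_left)
    moreover have "0 \<le> r / (r - 1)" using r by simp
    moreover have "min z (1 / z) \<le> z" by simp
    ultimately show ?case by (simp; linarith)
  next
    case (Suc J)
    let ?S = "\<Sum>j\<le>J. min ((z * r) * r ^ j) (1 / ((z * r) * r ^ j))"
    have m: "min z (1 / z) \<le> z" by simp
    show ?case
    proof (cases "z * r \<le> 1")
      case True
      then have "?S \<le> 2 * r / (r - 1) - z * r / (r - 1)" using Suc r by simp
      moreover have "z * r / (r - 1) = z + z / (r - 1)" using c by (metis distrib_left mult.right_neutral times_divide_eq_right)
      ultimately show ?thesis unfolding sh using m by linarith
    next
      case False
      then have "?S \<le> (1 / (z * r)) * (r / (r - 1))" by (intro big) auto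
      also have "\<dots> \<le> 1 * (r / (r - 1))" using False r by (intro mult_right_mono) auto
      finally have "?S \<le> r / (r - 1)" by simp
      moreover have "z * (r / (r - 1)) \<le> 1 * (r / (r - 1))" using Suc r by (intro mult_right_mono) auto
      moreover have "z * (r / (r - 1)) = z + z / (r - 1)" unfolding c by (simp add: distrib_left)
      moreover have "2 * r / (r - 1) = r / (r - 1) + r / (r - 1)" by simp
      ultimately show ?thesis unfolding sh using m by linarith
    qed
  qed
  note small = this
  show ?thesis
  proof (cases "z \<le> 1")
    case True
    have "0 \<le> z / (r - 1)" using r z by simp
    then show ?thesis using small[OF z True] by linarith
  next
    case False
    have "1 / z \<le> 2" using False by (simp add: divide_le_eq)
    then have "(1 / z) * (r / (r - 1)) \<le> 2 * (r / (r - 1))" using r by (intro mult_right_mono) auto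
    with big[of z J] False show ?thesis by simp
  qed
qed

text \<open>
  The minimum of \<open>h\<close> and the increasing sequence \<open>A * 2 powr (j / q)\<close> changes over at the scale \<open>\<delta> = (A / h) powr q\<close>.
  As \<open>0 < \<beta> < 1 / q\<close>, the sum decays geometrically on both sides of that scale, so it is comparable to
  \<open>\<delta> powr \<beta> * h\<close>.
\<close>
lemma dyadic_sum_bound:
  fixes q \<beta> :: real
  assumes q: "0 < q" and \<beta>: "0 < \<beta>" "\<beta> < 1 / q"
  shows "\<exists>C>0. \<forall>v h A J. 0 \<le> h \<and> 0 < A \<and> (\<forall>j\<le>J. 0 \<le> v j \<and> v j \<le> h \<and> v j \<le> A * ((1/2) ^ j) powr (-1/q)) \<longrightarrow>
     (\<Sum>j\<le>J. ((1/2) ^ j) powr \<beta> * v j) \<le> C * h powr (1 - \<beta> * q) * A powr (\<beta> * q)"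
proof -
  define \<theta> where "\<theta> = \<beta> * q"
  have \<theta>: "0 < \<theta>" "\<theta> < 1" using q \<beta> mult_pos_pos[of \<beta> q] pos_less_divide_eq[of q \<beta> 1] by (auto simp: \<theta>_def)
  define \<epsilon> where "\<epsilon> = min \<theta> (1 - \<theta>)"
  have \<epsilon>: "0 < \<epsilon>" "\<epsilon> \<le> \<theta>" "\<theta> + \<epsilon> \<le> 1" using \<theta> by (auto simp: \<epsilon>_def)
  define r :: real where "r = 2 powr (\<epsilon> / q)"
  have r: "1 < r" using \<epsilon> q by (simp add: r_def)
  define C where "C = 2 * r / (r - 1)"
  have "(\<Sum>j\<le>J. ((1/2) ^ j) powr \<beta> * v j) \<le> C * h powr (1 - \<theta>) * A powr \<theta>"
    if h: "0 \<le> h" and A: "0 < A" and v: "\<And>j. j \<le> J \<Longrightarrow> 0 \<le> v j \<and> v j \<le> h \<and> v j \<le> A * ((1/2) ^ j) powr (-1/q)" for v h A J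
  proof (cases "h = 0")
    case True
    then have "v j = 0" if "j \<le> J" for j using v[OF that] by simp
    then show ?thesis using True \<theta> by simp
  next
    case False
    then have h: "0 < h" using h by simp
    define z where "z = (A / h) powr \<epsilon>"
    have z: "0 < z" using A h by (simp add: z_def)
    have tm: "((1/2) ^ j) powr \<beta> * v j \<le> (h powr (1 - \<theta>) * A powr \<theta>) * min (z * r ^ j) (1 / (z * r ^ j))" if "j \<le> J" for j
    proof -
      define y where "y = A * ((1/2) ^ j) powr (-1/q)"
      have y: "0 < y" using A by (simp add: y_def)
      have vy: "0 \<le> v j" "v j \<le> h" "v j \<le> y" using v[OF that] by (auto simp: y_def)
      have mix: "v j \<le> h powr (1 - \<tau>) * y powr \<tau>" if "0 \<le> \<tau>" "\<tau> \<le> 1" for \<tau>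
      proof (cases "v j = 0")
        case False
        then have "v j = v j powr (1 - \<tau>) * v j powr \<tau>" using vy by (simp flip: powr_add)
        also have "\<dots> \<le> h powr (1 - \<tau>) * y powr \<tau>" using vy that by (intro mult_mono powr_mono2) auto
        finally show ?thesis .
      qed simp
      have zr: "z * r ^ j = (y / h) powr \<epsilon>"
      proof -
        have "r ^ j = (2 powr real j) powr (\<epsilon> / q)" by (simp add: r_def powr_powr mult.commute flip: powr_realpow)
        moreover have "((1/2 :: real) ^ j) powr (-1/q) = (2 powr real j) powr (1 / q)"
          by (simp add: powr_realpow power_divide powr_divide powr_minus)
        ultimately show ?thesis using A h
          by (simp add: z_def y_def powr_mult powr_divide powr_powr)
      qed
      have yd: "((1/2) ^ j) powr \<beta> * y powr \<theta> = A powr \<theta>"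
      proof -
        have "y powr \<theta> = A powr \<theta> * ((1/2) ^ j) powr (-\<beta>)"
          using A q by (simp add: y_def powr_mult powr_powr \<theta>_def)
        then show ?thesis by (simp add: powr_minus)
      qed
      \<comment> \<open>With \<open>e = \<epsilon>\<close> and \<open>e = -\<epsilon>\<close> this gives the decay on the two sides of the scale where \<open>y = h\<close>.\<close>
      have gen: "((1/2) ^ j) powr \<beta> * v j \<le> h powr (1 - \<theta>) * A powr \<theta> * (y / h) powr e" if "0 \<le> \<theta> + e" "\<theta> + e \<le> 1" for e
      proof -
        have "((1/2) ^ j) powr \<beta> * v j \<le> ((1/2) ^ j) powr \<beta> * (h powr (1 - (\<theta> + e)) * y powr (\<theta> + e))"
          by (intro mult_left_mono mix that) auto
        also have "h powr (1 - (\<theta> + e)) = h powr (1 - \<theta>) / h powr e"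
          using h by (simp flip: powr_diff add: algebra_simps)
        also have "((1/2) ^ j) powr \<beta> * (h powr (1 - \<theta>) / h powr e * y powr (\<theta> + e)) = (((1/2) ^ j) powr \<beta> * y powr \<theta>) * h powr (1 - \<theta>) * (y powr e / h powr e)"
          using y by (simp add: powr_add)
        also have "\<dots> = h powr (1 - \<theta>) * A powr \<theta> * (y / h) powr e" unfolding yd using y h by (simp add: powr_divide)
        finally show ?thesis .
      qed
      have "1 / (z * r ^ j) = (y / h) powr (- \<epsilon>)" unfolding zr by (simp add: powr_minus_divide)
      then show ?thesis using gen[of \<epsilon>] gen[of "-\<epsilon>"] \<epsilon> \<theta> unfolding zr by (simp add: min_def)
    qed
    have "(\<Sum>j\<le>J. ((1/2) ^ j) powr \<beta> * v j) \<le> (\<Sum>j\<le>J. (h powr (1 - \<theta>) * A powr \<theta>) * min (z * r ^ j) (1 / (z * r ^ j)))"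
      by (intro sum_mono tm) auto
    also have "\<dots> = (h powr (1 - \<theta>) * A powr \<theta>) * (\<Sum>j\<le>J. min (z * r ^ j) (1 / (z * r ^ j)))"
      by (simp add: sum_distrib_left)
    also have "\<dots> \<le> (h powr (1 - \<theta>) * A powr \<theta>) * C"
      unfolding C_def by (intro mult_left_mono two_sided_geometric r z) auto
    finally show ?thesis by (simp add: mult_ac)
  qed
  moreover have "C > 0" using r by (simp add: C_def)
  ultimately show ?thesis unfolding \<theta>_def by blast
qed

section \<open>An estimate for nonlinear potentials\<close>
text \<open>
  With \<open>y = u * s\<close> this is \<open>u powr (1/p) * min (y powr \<mu>) (y powr (3 * \<mu>)) / s\<close>; here \<open>u\<close> is the value of a density
  at a point and \<open>s\<close> the distance to that point. The integral of \<open>Phi\<close> dominates the values of the operator. The two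
  exponents make the kernel integrable to a power slightly above \<open>1\<close> both near \<open>s = 0\<close> and far away.
\<close>
definition Phi :: "real \<Rightarrow> real \<Rightarrow> real \<Rightarrow> real \<Rightarrow> real" where
  "Phi p \<mu> u s = min (u powr (1/p + \<mu>) * s powr (\<mu> - 1)) (u powr (1/p + 3 * \<mu>) * s powr (3 * \<mu> - 1))"

text \<open>
  With \<open>y = u * s\<close> this is \<open>u * min (y powr \<mu>) (y powr (-\<mu>)) / s\<close>. Its integral over \<open>s\<close> is a
  constant times \<open>u\<close>, so that it spreads out the density \<open>u\<close> and keeps its mass up to a constant factor.
\<close>
definition Psi :: "real \<Rightarrow> real \<Rightarrow> real \<Rightarrow> real" where
  "Psi \<mu> u s = min (u powr (1 + \<mu>) * s powr (\<mu> - 1)) (u powr (1 - \<mu>) * s powr (- \<mu> - 1))"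

lemma Phi_nonneg [simp]: "0 \<le> Phi p \<mu> u s" and Psi_nonneg [simp]: "0 \<le> Psi \<mu> u s"
  by (simp_all add: Phi_def Psi_def)

lemma powr_mult_le_add:
  assumes "0 \<le> X" "0 \<le> Y" "0 \<le> \<theta>" "\<theta> \<le> (1::real)"
  shows "X powr \<theta> * Y powr (1 - \<theta>) \<le> X + Y"
proof -
  let ?m = "max X Y"
  have "X powr \<theta> * Y powr (1 - \<theta>) \<le> ?m powr \<theta> * ?m powr (1 - \<theta>)"
    using assms by (intro mult_mono powr_mono2) auto
  also have "\<dots> = ?m"
  proof (cases "?m = 0")
    case False then show ?thesis using assms by (simp flip: powr_add)
  qed simp
  also have "\<dots> \<le> X + Y" using assms by auto
  finally show ?thesis .
qed

text \<open>
  Four regions. Far away (\<open>s > 1 / l\<close>) a weighted arithmetic-geometric mean separates \<open>u\<close> from \<open>s\<close>; the exponent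
  \<open>e > 1\<close> is the one for which the powers of \<open>l\<close> cancel. Near and with \<open>u \<le> l\<close> one replaces \<open>u\<close> by \<open>l\<close>. Near and with
  \<open>u > l\<close> the quotient of \<open>Phi\<close> by \<open>Psi\<close> is \<open>u powr (1/p - 1 + 2 * \<mu>) * s powr (2 * \<mu>)\<close>, where the exponent of \<open>u\<close> is
  negative because \<open>3 * \<mu> < 1 - 1/p\<close>; so it is at most its value at \<open>u = l\<close>, \<open>s = 1 / l\<close>. For a density of mass
  at most one the first three terms have integrals of size \<open>l powr (1/p)\<close>.
\<close>
lemma Phi_split:
  assumes p: "1 < p" and \<mu>: "0 < \<mu>" "3 * \<mu> < 1 - 1/p" and u: "0 \<le> u" and l: "0 < l"
  defines "e \<equiv> (1 - \<mu>) / (1 - 1/p - \<mu>)"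
  shows "Phi p \<mu> u (chord x) \<le> l powr (1/p + 3 * \<mu>) * near (3 * \<mu>) (1/l) x + l powr (1/p) * u
     + l powr (1/p + 1 - e) * far (e - 1) (1/l) x + l powr (1/p - 1) * Psi \<mu> u (chord x)" (is "_ \<le> ?a + ?b + ?c + ?d")
proof -
  let ?s = "chord x"
  have p0: "0 < 1/p" "1/p < 1" using p by auto
  have k: "0 < 1 - 1/p - \<mu>" using \<mu> by linarith
  have nn: "0 \<le> ?a" "0 \<le> ?b" "0 \<le> ?c" "0 \<le> ?d" using u by auto
  consider (z) "?s = 0" | (f) "?s > 1/l" | (n) "?s \<noteq> 0" "?s \<le> 1/l" "u \<le> l" | (h) "?s \<noteq> 0" "?s \<le> 1/l" "u > l" by linarith
  then show ?thesis
  proof cases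
    case z
    then have "Phi p \<mu> u ?s = 0" by (simp add: Phi_def)
    then show ?thesis using nn by linarith
  next
    case f
    then have s: "0 < ?s" using l by (meson divide_pos_pos less_trans zero_less_one)
    define X Y where "X = l powr (1/p) * u" and "Y = l powr (1/p + 1 - e) * ?s powr (-e)"
    define \<theta> where "\<theta> = 1/p + \<mu>"
    have \<theta>: "0 \<le> \<theta>" "\<theta> \<le> 1" using p0 \<mu> k by (auto simp: \<theta>_def)
    have e\<theta>: "e * (1 - \<theta>) = 1 - \<mu>" 
    proof -
      have t: "1 - \<theta> = 1 - 1/p - \<mu>" by (simp add: \<theta>_def)
      show ?thesis unfolding t e_def using k by simp
    qed
    have "Phi p \<mu> u ?s \<le> u powr \<theta> * ?s powr (\<mu> - 1)" by (simp add: Phi_def \<theta>_def)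
    also have "\<dots> = X powr \<theta> * Y powr (1 - \<theta>)"
    proof -
      have "X powr \<theta> * Y powr (1 - \<theta>) = (l powr (1/p * \<theta>) * l powr ((1/p + 1 - e) * (1 - \<theta>))) * u powr \<theta> * ?s powr (- (e * (1 - \<theta>)))"
        using u l s by (simp add: X_def Y_def powr_mult powr_powr)
      also have "l powr (1/p * \<theta>) * l powr ((1/p + 1 - e) * (1 - \<theta>)) = l powr (1/p * \<theta> + (1/p + 1 - e) * (1 - \<theta>))"
        by (simp add: powr_add)
      also have "1/p * \<theta> + (1/p + 1 - e) * (1 - \<theta>) = 1/p + 1 - \<theta> - e * (1 - \<theta>)"
        using p by (simp add: field_simps)
      also have "\<dots> = 0" unfolding e\<theta> by (simp add: \<theta>_def)
      finally show ?thesis using l unfolding e\<theta> by simp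
    qed
    also have "\<dots> \<le> X + Y" using u \<theta> by (intro powr_mult_le_add) (auto simp: X_def Y_def)
    also have "\<dots> \<le> ?b + ?c" using f by (simp add: X_def Y_def far_def)
    finally show ?thesis using nn by linarith
  next
    case n
    have "Phi p \<mu> u ?s \<le> u powr (1/p + 3 * \<mu>) * ?s powr (3 * \<mu> - 1)" by (simp add: Phi_def)
    also have "\<dots> \<le> l powr (1/p + 3 * \<mu>) * ?s powr (3 * \<mu> - 1)"
      using n u p0 \<mu> by (intro mult_right_mono powr_mono2) auto
    also have "\<dots> = ?a" using n by (simp add: near_def)
    finally show ?thesis using nn by linarith
  next
    case h
    then have s: "0 < ?s" and u: "0 < u" using l by (auto simp: less_le)
    define c where "c = u powr (1/p - 1 + 2 * \<mu>) * ?s powr (2 * \<mu>)"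
    have c0: "0 \<le> c" by (simp add: c_def)
    have "u powr (1/p + 3 * \<mu>) * ?s powr (3 * \<mu> - 1) = c * (u powr (1 + \<mu>) * ?s powr (\<mu> - 1))"
      "u powr (1/p + \<mu>) * ?s powr (\<mu> - 1) = c * (u powr (1 - \<mu>) * ?s powr (- \<mu> - 1))"
    proof -
      have "c * (u powr a * ?s powr b) = u powr (1/p - 1 + 2 * \<mu> + a) * ?s powr (2 * \<mu> + b)" for a b
        by (simp add: c_def powr_add)
      from this[of "1 + \<mu>" "\<mu> - 1"] this[of "1 - \<mu>" "- \<mu> - 1"]
      show "u powr (1/p + 3 * \<mu>) * ?s powr (3 * \<mu> - 1) = c * (u powr (1 + \<mu>) * ?s powr (\<mu> - 1))"
        "u powr (1/p + \<mu>) * ?s powr (\<mu> - 1) = c * (u powr (1 - \<mu>) * ?s powr (- \<mu> - 1))"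
        by (simp_all add: add.commute)
    qed
    then have "Phi p \<mu> u ?s = c * Psi \<mu> u ?s"
      using c0 by (simp add: Phi_def Psi_def min_mult_distrib_left min.commute)
    also have "c \<le> l powr (1/p - 1 + 2 * \<mu>) * (1/l) powr (2 * \<mu>)"
      unfolding c_def using h l s \<mu> by (intro mult_mono powr_mono2 powr_mono2') auto
    then have "c * Psi \<mu> u ?s \<le> l powr (1/p - 1 + 2 * \<mu>) * (1/l) powr (2 * \<mu>) * Psi \<mu> u ?s"
      by (rule mult_right_mono) simp
    also have "l powr (1/p - 1 + 2 * \<mu>) * (1/l) powr (2 * \<mu>) = l powr (1/p - 1)"
    proof -
      have "(1/l) powr (2 * \<mu>) = l powr (- (2 * \<mu>))" using l by (simp add: powr_minus powr_divide field_simps)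
      then have "l powr (1/p - 1 + 2 * \<mu>) * (1/l) powr (2 * \<mu>) = l powr ((1/p - 1 + 2 * \<mu>) + - (2 * \<mu>))"
        by (simp only: powr_add)
      then show ?thesis by simp
    qed
    finally show ?thesis using nn by linarith
  qed
qed

lemma borel_Phi: 
  assumes [measurable]: "H \<in> borel_measurable M" "g \<in> borel_measurable M"
  shows "(\<lambda>z. Phi p \<mu> (H z) (g z)) \<in> borel_measurable M"
  unfolding Phi_def by measurable

lemma borel_Psi: 
  assumes [measurable]: "H \<in> borel_measurable M" "g \<in> borel_measurable M"
  shows "(\<lambda>z. Psi \<mu> (H z) (g z)) \<in> borel_measurable M"
  unfolding Psi_def by measurable

lemma near_commute: "near s a (x - y) = near s a (y - x)"
  and far_commute: "far s a (x - y) = far s a (y - x)"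
  by (simp_all add: near_def far_def chord_commute)

lemma Phi_integral_split:
  assumes p: "1 < p" and \<mu>: "0 < \<mu>" "3 * \<mu> < 1 - 1/p"
  shows "\<exists>C>0. \<forall>H x l. H \<in> borel_measurable borel \<and> (\<forall>t. 0 \<le> H t) \<and> (\<integral>\<^sup>+t. ennreal (H t) \<partial>circ) \<le> 1 \<and> 0 < l \<longrightarrow>
     (\<integral>\<^sup>+t. ennreal (Phi p \<mu> (H t) (chord (x - t))) \<partial>circ)
      \<le> ennreal (C * l powr (1/p)) + ennreal (l powr (1/p - 1)) * (\<integral>\<^sup>+t. ennreal (Psi \<mu> (H t) (chord (x - t))) \<partial>circ)"
proof -
  define e where "e = (1 - \<mu>) / (1 - 1/p - \<mu>)"
  have p0: "0 < 1/p" "1/p < 1" using p by auto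
  have k: "0 < 1 - 1/p - \<mu>" using \<mu> by linarith
  have \<mu>1: "3 * \<mu> \<le> 1" using \<mu> p0 by linarith
  have e1: "e - 1 > 0" unfolding e_def using k p0 by (simp add: field_simps)
  define C where "C = 2 * pi / (3 * \<mu>) + 1 + 2 * pi powr (e - 1 + 1) / (e - 1)"
  have C: "C > 0" unfolding C_def using \<mu> e1 by (intro add_pos_nonneg add_nonneg_pos) auto
  have "(\<integral>\<^sup>+t. ennreal (Phi p \<mu> (H t) (chord (x - t))) \<partial>circ)
      \<le> ennreal (C * l powr (1/p)) + ennreal (l powr (1/p - 1)) * (\<integral>\<^sup>+t. ennreal (Psi \<mu> (H t) (chord (x - t))) \<partial>circ)"
    if Hm: "H \<in> borel_measurable borel" and H0: "\<And>t. 0 \<le> H t" and H1: "(\<integral>\<^sup>+t. ennreal (H t) \<partial>circ) \<le> 1" and l: "0 < l" for H x l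
  proof -
    have [measurable]: "H \<in> borel_measurable circ" by (rule borel_measurable_circ[OF Hm])
    have [measurable]: "(\<lambda>t. chord (x - t)) \<in> borel_measurable circ" "(\<lambda>t. near (3 * \<mu>) (1/l) (t - x)) \<in> borel_measurable circ"
      "(\<lambda>t. far (e - 1) (1/l) (t - x)) \<in> borel_measurable circ"
      by (intro borel_measurable_circ; measurable)+
    note borel_Psi[measurable]
    let ?I = "\<lambda>g. \<integral>\<^sup>+t. ennreal (g t) \<partial>circ"
    have "?I (\<lambda>t. Phi p \<mu> (H t) (chord (x - t))) \<le> (\<integral>\<^sup>+t. ennreal (l powr (1/p + 3 * \<mu>)) * ennreal (near (3 * \<mu>) (1/l) (t - x)) + ennreal (l powr (1/p)) * ennreal (H t)
       + ennreal (l powr (1/p + 1 - e)) * ennreal (far (e - 1) (1/l) (t - x)) + ennreal (l powr (1/p - 1)) * ennreal (Psi \<mu> (H t) (chord (x - t))) \<partial>circ)"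
    proof (rule nn_integral_mono)
      fix t
      have "Phi p \<mu> (H t) (chord (x - t)) \<le> l powr (1/p + 3 * \<mu>) * near (3 * \<mu>) (1/l) (t - x) + l powr (1/p) * H t
        + l powr (1/p + 1 - e) * far (e - 1) (1/l) (t - x) + l powr (1/p - 1) * Psi \<mu> (H t) (chord (x - t))"
        using Phi_split[OF p \<mu> H0[of t] l, of "x - t"] unfolding e_def near_commute[of _ _ t x] far_commute[of _ _ t x] .
      from ennreal_leI[OF this] show "ennreal (Phi p \<mu> (H t) (chord (x - t))) \<le> ennreal (l powr (1/p + 3 * \<mu>)) * ennreal (near (3 * \<mu>) (1/l) (t - x)) + ennreal (l powr (1/p)) * ennreal (H t)
       + ennreal (l powr (1/p + 1 - e)) * ennreal (far (e - 1) (1/l) (t - x)) + ennreal (l powr (1/p - 1)) * ennreal (Psi \<mu> (H t) (chord (x - t)))"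
        using H0[of t] by (simp add: ennreal_mult)
    qed
    also have "\<dots> = ennreal (l powr (1/p + 3 * \<mu>)) * ?I (\<lambda>t. near (3 * \<mu>) (1/l) (t - x)) + ennreal (l powr (1/p)) * ?I H
       + ennreal (l powr (1/p + 1 - e)) * ?I (\<lambda>t. far (e - 1) (1/l) (t - x)) + ennreal (l powr (1/p - 1)) * ?I (\<lambda>t. Psi \<mu> (H t) (chord (x - t)))"
      by (simp add: nn_integral_add nn_integral_cmult)
    also have "\<dots> \<le> ennreal (l powr (1/p + 3 * \<mu>)) * ennreal (2 * pi / (3 * \<mu>) * (1/l) powr (3 * \<mu>)) + ennreal (l powr (1/p)) * ennreal 1
       + ennreal (l powr (1/p + 1 - e)) * ennreal (2 * pi powr (e - 1 + 1) / (e - 1) * (1/l) powr (-(e - 1))) + ennreal (l powr (1/p - 1)) * ?I (\<lambda>t. Psi \<mu> (H t) (chord (x - t)))"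
      using \<mu> \<mu>1 l e1 H1 p0 by (intro add_mono mult_left_mono nn_integral_near nn_integral_far) (use \<mu>1 in simp_all)
    also have "ennreal (l powr (1/p + 3 * \<mu>)) * ennreal (2 * pi / (3 * \<mu>) * (1/l) powr (3 * \<mu>)) + ennreal (l powr (1/p)) * ennreal 1
       + ennreal (l powr (1/p + 1 - e)) * ennreal (2 * pi powr (e - 1 + 1) / (e - 1) * (1/l) powr (-(e - 1))) = ennreal (C * l powr (1/p))"
    proof -
      have il: "(1/l) powr a = l powr (-a)" for a using l by (simp add: powr_minus powr_divide field_simps)
      have 1: "l powr (1/p + 3 * \<mu>) * (2 * pi / (3 * \<mu>) * (1/l) powr (3 * \<mu>)) = 2 * pi / (3 * \<mu>) * l powr (1/p)"
      proof -
        have "l powr (1/p + 3 * \<mu>) * l powr (- (3 * \<mu>)) = l powr (1/p)" by (simp flip: powr_add)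
        then show ?thesis unfolding il by (metis mult.assoc mult.left_commute)
      qed
      have 2: "l powr (1/p + 1 - e) * (2 * pi powr (e - 1 + 1) / (e - 1) * (1/l) powr (-(e - 1))) = 2 * pi powr (e - 1 + 1) / (e - 1) * l powr (1/p)"
      proof -
        have "l powr (1/p + 1 - e) * l powr (- (-(e - 1))) = l powr (1/p)" by (simp flip: powr_add)
        then show ?thesis unfolding il by (metis mult.assoc mult.left_commute)
      qed
      have "ennreal (l powr (1/p + 3 * \<mu>)) * ennreal (2 * pi / (3 * \<mu>) * (1/l) powr (3 * \<mu>)) = ennreal (2 * pi / (3 * \<mu>) * l powr (1/p))"
        "ennreal (l powr (1/p + 1 - e)) * ennreal (2 * pi powr (e - 1 + 1) / (e - 1) * (1/l) powr (-(e - 1))) = ennreal (2 * pi powr (e - 1 + 1) / (e - 1) * l powr (1/p))"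
        unfolding 1[symmetric] 2[symmetric] using \<mu> e1
        by (intro ennreal_mult[symmetric] mult_nonneg_nonneg divide_nonneg_nonneg powr_ge_zero; simp)+
      then show ?thesis using \<mu> e1
        by (simp add: C_def distrib_right ennreal_plus[symmetric] del: ennreal_plus)
    qed
    finally show ?thesis .
  qed
  with C show ?thesis by blast
qed

text \<open>
  The level \<open>l\<close> in \<open>Phi_integral_split\<close> is free. Choosing \<open>l\<close> equal to the integral of \<open>Psi\<close> makes both terms equal to a
  multiple of its power \<open>1/p\<close>. Together with \<open>Psi_integral\<close> this bounds the \<open>L\<^sup>p\<close> norm of the potential.
\<close>
lemma Phi_power_le_Psi:
  assumes p: "1 < p" and \<mu>: "0 < \<mu>" "3 * \<mu> < 1 - 1/p"
  shows "\<exists>C>0. \<forall>H x w. H \<in> borel_measurable borel \<and> (\<forall>t. 0 \<le> H t) \<and> (\<integral>\<^sup>+t. ennreal (H t) \<partial>circ) \<le> 1 \<and>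
       0 \<le> w \<and> ennreal w \<le> (\<integral>\<^sup>+t. ennreal (Phi p \<mu> (H t) (chord (x - t))) \<partial>circ) \<longrightarrow>
     ennreal (w powr p) \<le> ennreal C * (\<integral>\<^sup>+t. ennreal (Psi \<mu> (H t) (chord (x - t))) \<partial>circ)"
proof -
  obtain C where C: "C > 0" and le: "\<And>H x l. H \<in> borel_measurable borel \<Longrightarrow> (\<And>t. 0 \<le> H t) \<Longrightarrow> (\<integral>\<^sup>+t. ennreal (H t) \<partial>circ) \<le> 1 \<Longrightarrow> 0 < l \<Longrightarrow>
     (\<integral>\<^sup>+t. ennreal (Phi p \<mu> (H t) (chord (x - t))) \<partial>circ)
      \<le> ennreal (C * l powr (1/p)) + ennreal (l powr (1/p - 1)) * (\<integral>\<^sup>+t. ennreal (Psi \<mu> (H t) (chord (x - t))) \<partial>circ)"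
    using Phi_integral_split[OF p \<mu>] by blast
  have "ennreal (w powr p) \<le> ennreal ((C + 1) powr p) * (\<integral>\<^sup>+t. ennreal (Psi \<mu> (H t) (chord (x - t))) \<partial>circ)" (is "_ \<le> _ * ?Q")
    if H: "H \<in> borel_measurable borel" "\<And>t. 0 \<le> H t" "(\<integral>\<^sup>+t. ennreal (H t) \<partial>circ) \<le> 1"
      and w: "0 \<le> w" "ennreal w \<le> (\<integral>\<^sup>+t. ennreal (Phi p \<mu> (H t) (chord (x - t))) \<partial>circ)" for H x w
  proof (cases ?Q)
    case (real r)
    have wl: "w \<le> C * l powr (1/p) + l powr (1/p - 1) * r" if "l > 0" for l
    proof -
      have "ennreal w \<le> ennreal (C * l powr (1/p)) + ennreal (l powr (1/p - 1)) * ?Q"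
        using w(2) le[OF H that] by (rule order_trans)
      also have "\<dots> = ennreal (C * l powr (1/p) + l powr (1/p - 1) * r)"
        using real C by (simp add: ennreal_mult ennreal_plus)
      finally show ?thesis using real C by (subst (asm) ennreal_le_iff) auto
    qed
    have "w powr p \<le> (C + 1) powr p * r"
    proof (cases "r = 0")
      case True
      have "w \<le> 0"
      proof (rule ccontr)
        assume "\<not> w \<le> 0"
        then have w0: "0 < w" by simp
        define l where "l = (w / (2 * C)) powr p"
        have "l > 0" using w0 C by (simp add: l_def)
        from wl[OF this] have "w \<le> C * l powr (1/p)" using True by simp
        also have "l powr (1/p) = w / (2 * C)" using w0 C p by (simp add: l_def powr_powr)
        finally show False using w0 C by simp
      qed
      then show ?thesis using w(1) True by simp
    next
      case False
      then have r: "r > 0" using real by simp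
      have "w \<le> (C + 1) * r powr (1/p)"
      proof -
        have "r powr (1/p - 1) * r = r powr (1/p)" using r by (simp add: powr_diff)
        then show ?thesis using wl[OF r] by (simp add: distrib_right)
      qed
      then have "w powr p \<le> ((C + 1) * r powr (1/p)) powr p" using w(1) p by (intro powr_mono2) auto
      also have "\<dots> = (C + 1) powr p * r" using C r p by (simp add: powr_mult powr_powr)
      finally show ?thesis .
    qed
    then have "ennreal (w powr p) \<le> ennreal ((C + 1) powr p * r)" by (rule ennreal_leI)
    then show ?thesis using real by (simp add: ennreal_mult)
  next
    case top
    then show ?thesis using C by (simp add: ennreal_mult_top)
  qed
  moreover have "(C + 1) powr p > 0" using C by simp
  ultimately show ?thesis by blast
qed

text \<open>
  By Tonelli one may integrate over \<open>x\<close> first. For a fixed value \<open>u\<close> of the density one uses the first term of the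
  minimum for distances up to \<open>1 / u\<close> and the second one beyond; both contribute a multiple of \<open>u\<close>.
\<close>
lemma Psi_integral:
  assumes \<mu>: "0 < \<mu>" "\<mu> \<le> 1"
  shows "\<exists>C>0. \<forall>H. H \<in> borel_measurable borel \<and> (\<forall>t. 0 \<le> H t) \<longrightarrow>
    (\<integral>\<^sup>+x. (\<integral>\<^sup>+t. ennreal (Psi \<mu> (H t) (chord (x - t))) \<partial>circ) \<partial>circ) \<le> ennreal C * (\<integral>\<^sup>+t. ennreal (H t) \<partial>circ)"
proof -
  define C where "C = 2 * pi / \<mu> + 2 * pi powr (\<mu> + 1) / \<mu>"
  have C: "C > 0" unfolding C_def using \<mu> by (intro add_pos_pos) auto
  have one: "(\<integral>\<^sup>+x. ennreal (Psi \<mu> u (chord (x - t))) \<partial>circ) \<le> ennreal C * ennreal u" if u: "0 \<le> u" for u t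
  proof (cases "u = 0")
    case True
    then have "Psi \<mu> u s = 0" for s using \<mu> by (cases "\<mu> = 1") (auto simp: Psi_def)
    then show ?thesis by simp
  next
    case False
    then have u: "0 < u" using u by simp
    have [measurable]: "(\<lambda>x. near \<mu> (1/u) (x - t)) \<in> borel_measurable circ" "(\<lambda>x. far \<mu> (1/u) (x - t)) \<in> borel_measurable circ"
      by (intro borel_measurable_circ; measurable)+
    have "(\<integral>\<^sup>+x. ennreal (Psi \<mu> u (chord (x - t))) \<partial>circ)
      \<le> (\<integral>\<^sup>+x. ennreal (u powr (1 + \<mu>)) * ennreal (near \<mu> (1/u) (x - t)) + ennreal (u powr (1 - \<mu>)) * ennreal (far \<mu> (1/u) (x - t)) \<partial>circ)"
    proof (rule nn_integral_mono)
      fix x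
      have "Psi \<mu> u (chord (x - t)) \<le> u powr (1 + \<mu>) * near \<mu> (1/u) (x - t) + u powr (1 - \<mu>) * far \<mu> (1/u) (x - t)"
        by (cases "chord (x - t) \<le> 1/u") (auto simp: Psi_def near_def far_def)
      from ennreal_leI[OF this] show "ennreal (Psi \<mu> u (chord (x - t))) \<le> ennreal (u powr (1 + \<mu>)) * ennreal (near \<mu> (1/u) (x - t)) + ennreal (u powr (1 - \<mu>)) * ennreal (far \<mu> (1/u) (x - t))"
        by (simp add: ennreal_mult)
    qed
    also have "\<dots> = ennreal (u powr (1 + \<mu>)) * (\<integral>\<^sup>+x. ennreal (near \<mu> (1/u) (x - t)) \<partial>circ) + ennreal (u powr (1 - \<mu>)) * (\<integral>\<^sup>+x. ennreal (far \<mu> (1/u) (x - t)) \<partial>circ)"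
      by (simp add: nn_integral_add nn_integral_cmult)
    also have "\<dots> \<le> ennreal (u powr (1 + \<mu>)) * ennreal (2 * pi / \<mu> * (1/u) powr \<mu>) + ennreal (u powr (1 - \<mu>)) * ennreal (2 * pi powr (\<mu> + 1) / \<mu> * (1/u) powr (-\<mu>))"
      using \<mu> u by (intro add_mono mult_left_mono nn_integral_near nn_integral_far) auto
    also have "\<dots> = ennreal (u powr (1 + \<mu>) * (2 * pi / \<mu> * (1/u) powr \<mu>) + u powr (1 - \<mu>) * (2 * pi powr (\<mu> + 1) / \<mu> * (1/u) powr (-\<mu>)))"
      using \<mu> by (subst ennreal_plus) (auto simp: ennreal_mult[symmetric])
    also have "u powr (1 + \<mu>) * (2 * pi / \<mu> * (1/u) powr \<mu>) + u powr (1 - \<mu>) * (2 * pi powr (\<mu> + 1) / \<mu> * (1/u) powr (-\<mu>)) = C * u"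
    proof -
      have il: "(1/u) powr a = u powr (-a)" for a using u by (simp add: powr_minus powr_divide field_simps)
      have c: "u powr (1 + \<mu>) * u powr (-\<mu>) = u" "u powr (1 - \<mu>) * u powr (-(-\<mu>)) = u" using u by (simp_all flip: powr_add)
      have g: "a * (K * b) + c * (L * d) = K * (a * b) + L * (c * d)" for a b c d K L :: real
        by (simp add: algebra_simps)
      show ?thesis unfolding il C_def distrib_right by (rule trans[OF g]) (simp only: c)
    qed
    finally show ?thesis using C u by (simp add: ennreal_mult)
  qed
  have "(\<integral>\<^sup>+x. (\<integral>\<^sup>+t. ennreal (Psi \<mu> (H t) (chord (x - t))) \<partial>circ) \<partial>circ) \<le> ennreal C * (\<integral>\<^sup>+t. ennreal (H t) \<partial>circ)"
    if Hm: "H \<in> borel_measurable borel" and H0: "\<And>t. 0 \<le> H t" for H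
  proof -
    have [measurable]: "(\<lambda>z. H (snd z)) \<in> borel_measurable (circ \<Otimes>\<^sub>M circ)" "(\<lambda>z. chord (fst z - snd z)) \<in> borel_measurable (circ \<Otimes>\<^sub>M circ)"
      using Hm by measurable
    have "(\<integral>\<^sup>+x. (\<integral>\<^sup>+t. ennreal (Psi \<mu> (H t) (chord (x - t))) \<partial>circ) \<partial>circ) = (\<integral>\<^sup>+t. (\<integral>\<^sup>+x. ennreal (Psi \<mu> (H t) (chord (x - t))) \<partial>circ) \<partial>circ)"
      by (rule circ_pair.Fubini'[symmetric]) (simp add: case_prod_unfold borel_Psi)
    also have "\<dots> \<le> (\<integral>\<^sup>+t. ennreal C * ennreal (H t) \<partial>circ)" by (intro nn_integral_mono one H0)
    also have "\<dots> = ennreal C * (\<integral>\<^sup>+t. ennreal (H t) \<partial>circ)"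
      using borel_measurable_circ[OF Hm] by (intro nn_integral_cmult) measurable
    finally show ?thesis .
  qed
  with C show ?thesis by blast
qed

section \<open>The truncated operator\<close>
lemma AE_circ_chord: "AE t in circ. chord (x - t) \<noteq> 0"
  using AE_circ_sin[of x] by eventually_elim (simp add: chord_def)

lemma borel_hker_pair:
  assumes [measurable]: "b \<in> borel_measurable borel"
  shows "(\<lambda>z. hker b (fst z) (snd z)) \<in> borel_measurable (circ \<Otimes>\<^sub>M circ)"
  unfolding hker_def tan_def by measurable

lemma nn_hankel_norm_le: "ennreal (norm (hankel b F x)) \<le> (\<integral>\<^sup>+t. ennreal (norm (hker b x t)) * ennreal (norm (F t)) \<partial>circ)"
proof -
  have "ennreal (norm (hankel b F x)) \<le> (\<integral>\<^sup>+t. ennreal (norm (hker b x t * F t)) \<partial>circ)"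
    unfolding hankel_def
    by (cases "integrable circ (\<lambda>t. hker b x t * F t)") (auto intro: integral_norm_bound_ennreal simp: not_integrable_integral_eq)
  then show ?thesis by (simp add: norm_mult ennreal_mult)
qed

lemma divide_two_pi_le: "x / ennreal (2 * pi) \<le> x"
proof -
  have "x / ennreal (2 * pi) = x * ennreal (1 / (2 * pi))"
    by (simp add: divide_ennreal_def inverse_ennreal inverse_eq_divide)
  also have "\<dots> \<le> x * 1" using pi_gt3 by (intro mult_left_mono) (auto simp: divide_le_eq)
  finally show ?thesis by simp
qed

text \<open>
  By Tonelli the Poisson average of the output is an average of the kernel in \<open>x\<close>. The bound of
  \<open>hker_smoothed_bound\<close> for the two exponents \<open>\<gamma> = \<mu>\<close> and \<open>\<gamma> = 3 * \<mu>\<close> survives this average by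
  \<open>poisson_chord_powr\<close>.
\<close>
lemma poisson_hankel_bound:
  assumes c: "cper c" "\<And>x. norm (c x) \<le> M" and \<eta>: "0 < \<eta>" and u: "cper u"
    and \<rho>: "0 \<le> \<rho>" "\<rho> < 1" and \<mu>: "0 < \<mu>" "3 * \<mu> < 1"
  shows "ennreal (norm (poisson_integral \<rho> (hankel (pois \<eta> c) u) x))
    \<le> (\<integral>\<^sup>+t. ennreal ((8 * pi + 16 * pi / \<mu>) * M * min (\<eta> powr (-\<mu>) * chord (x - t) powr (\<mu> - 1))
         (\<eta> powr (- (3 * \<mu>)) * chord (x - t) powr (3 * \<mu> - 1)) * norm (u t)) \<partial>circ)"
proof -
  define K where "K = 8 * pi + 16 * pi / \<mu>"
  have K: "K > 0" unfolding K_def using \<mu> by (intro add_pos_pos) auto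
  let ?B = "pois \<eta> c"
  have B: "?B \<in> borel_measurable borel" by (intro cper_borel cper_pois cper_integrable c \<eta>)
  have M0: "0 \<le> M" using order_trans[OF norm_ge_zero c(2)] .
  have um[measurable]: "u \<in> borel_measurable borel" using u by (rule cper_borel)
  have km: "(\<lambda>t. poisson_kernel \<rho> (x - t)) \<in> borel_measurable borel" by measurable
  have m2: "(\<lambda>z. ennreal (poisson_kernel \<rho> (x - fst z)) * (ennreal (norm (hker ?B (fst z) (snd z))) * ennreal (norm (u (snd z))))) \<in> borel_measurable (circ \<Otimes>\<^sub>M circ)"
    using borel_hker_pair[OF B] by measurable
  have hkx[measurable]: "hker ?B y \<in> borel_measurable circ" for y by (rule borel_measurable_circ[OF borel_hker[OF B]])
  have hky[measurable]: "(\<lambda>y. hker ?B y t) \<in> borel_measurable circ" for t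
  proof -
    note [measurable] = B
    show ?thesis unfolding hker_def tan_def by (intro borel_measurable_circ) measurable
  qed
  have uc[measurable]: "(\<lambda>t. ennreal (norm (u t))) \<in> borel_measurable circ" by (intro borel_measurable_circ) measurable
  have kc[measurable]: "(\<lambda>y. ennreal (poisson_kernel \<rho> (x - y))) \<in> borel_measurable circ" by (intro borel_measurable_circ) measurable
  have g: "(\<integral>\<^sup>+y. ennreal (poisson_kernel \<rho> (x - y)) * ennreal (norm (hker ?B y t)) \<partial>circ) \<le> ennreal (K * M * (\<eta> powr (-\<gamma>) * chord (x - t) powr (\<gamma> - 1)))"
    if \<gamma>: "\<mu> \<le> \<gamma>" "\<gamma> < 1" and t: "chord (x - t) \<noteq> 0" for \<gamma> t
  proof -
    have g0: "0 < \<gamma>" using \<gamma> \<mu> by simp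
    have cm[measurable]: "(\<lambda>y. ennreal (chord (y - t) powr (\<gamma> - 1))) \<in> borel_measurable circ" by (intro borel_measurable_circ) measurable
    have "(\<integral>\<^sup>+y. ennreal (poisson_kernel \<rho> (x - y)) * ennreal (norm (hker ?B y t)) \<partial>circ)
      \<le> (\<integral>\<^sup>+y. ennreal (2 * M * \<eta> powr (-\<gamma>)) * (ennreal (poisson_kernel \<rho> (x - y)) * ennreal (chord (y - t) powr (\<gamma> - 1))) \<partial>circ)"
    proof (rule nn_integral_mono)
      fix y
      have "ennreal (norm (hker ?B y t)) \<le> ennreal (2 * M * \<eta> powr (-\<gamma>)) * ennreal (chord (y - t) powr (\<gamma> - 1))"
        using hker_smoothed_bound[OF c \<eta> g0 \<gamma>(2), of y t] M0 by (simp add: ennreal_mult[symmetric] ennreal_leI)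
      from mult_left_mono[OF this, of "ennreal (poisson_kernel \<rho> (x - y))"]
      show "ennreal (poisson_kernel \<rho> (x - y)) * ennreal (norm (hker ?B y t)) \<le> ennreal (2 * M * \<eta> powr (-\<gamma>)) * (ennreal (poisson_kernel \<rho> (x - y)) * ennreal (chord (y - t) powr (\<gamma> - 1)))"
        by (simp add: mult_ac)
    qed
    also have "\<dots> = ennreal (2 * M * \<eta> powr (-\<gamma>)) * (\<integral>\<^sup>+y. ennreal (poisson_kernel \<rho> (x - y)) * ennreal (chord (y - t) powr (\<gamma> - 1)) \<partial>circ)"
      by (rule nn_integral_cmult) measurable
    also have "\<dots> \<le> ennreal (2 * M * \<eta> powr (-\<gamma>)) * ennreal ((4 * pi + 8 * pi / \<gamma>) * chord (x - t) powr (\<gamma> - 1))"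
      using g0 \<gamma> t by (intro mult_left_mono poisson_chord_powr \<rho>) auto
    also have "\<dots> = ennreal (2 * M * \<eta> powr (-\<gamma>) * ((4 * pi + 8 * pi / \<gamma>) * chord (x - t) powr (\<gamma> - 1)))"
      using M0 g0 by (intro ennreal_mult[symmetric] mult_nonneg_nonneg add_nonneg_nonneg) auto
    also have "\<dots> \<le> ennreal (K * M * (\<eta> powr (-\<gamma>) * chord (x - t) powr (\<gamma> - 1)))"
    proof (rule ennreal_leI)
      have "8 * pi / \<gamma> \<le> 8 * pi / \<mu>" using \<gamma> \<mu> by (intro divide_left_mono) auto
      then have "2 * (4 * pi + 8 * pi / \<gamma>) \<le> K" by (simp add: K_def)
      then have "2 * (4 * pi + 8 * pi / \<gamma>) * (M * (\<eta> powr (-\<gamma>) * chord (x - t) powr (\<gamma> - 1))) \<le> K * (M * (\<eta> powr (-\<gamma>) * chord (x - t) powr (\<gamma> - 1)))"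
        using M0 by (intro mult_right_mono) auto
      then show "2 * M * \<eta> powr (-\<gamma>) * ((4 * pi + 8 * pi / \<gamma>) * chord (x - t) powr (\<gamma> - 1)) \<le> K * M * (\<eta> powr (-\<gamma>) * chord (x - t) powr (\<gamma> - 1))"
        by (simp only: mult_ac)
    qed
    finally show ?thesis .
  qed
  have "ennreal (norm (poisson_integral \<rho> (hankel ?B u) x)) \<le> (\<integral>\<^sup>+y. ennreal (poisson_kernel \<rho> (x - y)) * ennreal (norm (hankel ?B u y)) \<partial>circ) / ennreal (2 * pi)"
    by (rule nn_poisson_norm_le[OF \<rho>])
  also have "\<dots> \<le> (\<integral>\<^sup>+y. ennreal (poisson_kernel \<rho> (x - y)) * ennreal (norm (hankel ?B u y)) \<partial>circ)" by (rule divide_two_pi_le)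
  also have "\<dots> \<le> (\<integral>\<^sup>+y. ennreal (poisson_kernel \<rho> (x - y)) * (\<integral>\<^sup>+t. ennreal (norm (hker ?B y t)) * ennreal (norm (u t)) \<partial>circ) \<partial>circ)"
    by (intro nn_integral_mono mult_left_mono nn_hankel_norm_le) auto
  also have "\<dots> = (\<integral>\<^sup>+y. (\<integral>\<^sup>+t. ennreal (poisson_kernel \<rho> (x - y)) * (ennreal (norm (hker ?B y t)) * ennreal (norm (u t))) \<partial>circ) \<partial>circ)"
    using hkx uc by (intro nn_integral_cong nn_integral_cmult[symmetric]) measurable
  also have "\<dots> = (\<integral>\<^sup>+t. (\<integral>\<^sup>+y. ennreal (poisson_kernel \<rho> (x - y)) * (ennreal (norm (hker ?B y t)) * ennreal (norm (u t))) \<partial>circ) \<partial>circ)"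
    by (rule circ_pair.Fubini'[symmetric]) (use m2 in \<open>simp add: case_prod_unfold\<close>)
  also have "\<dots> = (\<integral>\<^sup>+t. (\<integral>\<^sup>+y. ennreal (poisson_kernel \<rho> (x - y)) * ennreal (norm (hker ?B y t)) \<partial>circ) * ennreal (norm (u t)) \<partial>circ)"
    using kc hky by (intro nn_integral_cong) (simp add: mult.assoc[symmetric] nn_integral_multc)
  also have "\<dots> \<le> (\<integral>\<^sup>+t. ennreal (K * M * min (\<eta> powr (-\<mu>) * chord (x - t) powr (\<mu> - 1))
         (\<eta> powr (- (3 * \<mu>)) * chord (x - t) powr (3 * \<mu> - 1)) * norm (u t)) \<partial>circ)"
  proof (rule nn_integral_mono_AE)
    show "AE t in circ. (\<integral>\<^sup>+y. ennreal (poisson_kernel \<rho> (x - y)) * ennreal (norm (hker ?B y t)) \<partial>circ) * ennreal (norm (u t))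
       \<le> ennreal (K * M * min (\<eta> powr (-\<mu>) * chord (x - t) powr (\<mu> - 1)) (\<eta> powr (- (3 * \<mu>)) * chord (x - t) powr (3 * \<mu> - 1)) * norm (u t))"
      using AE_circ_chord[of x]
    proof eventually_elim
      case (elim t)
      let ?a = "\<eta> powr (-\<mu>) * chord (x - t) powr (\<mu> - 1)" and ?b = "\<eta> powr (- (3 * \<mu>)) * chord (x - t) powr (3 * \<mu> - 1)"
      have "(\<integral>\<^sup>+y. ennreal (poisson_kernel \<rho> (x - y)) * ennreal (norm (hker ?B y t)) \<partial>circ) \<le> ennreal (K * M * min ?a ?b)"
        using g[of \<mu> t, OF _ _ elim] g[of "3 * \<mu>" t, OF _ _ elim] \<mu> by (cases "?a \<le> ?b") (auto simp: min_def)
      from mult_right_mono[OF this, of "ennreal (norm (u t))"] show ?case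
        using K M0 by (simp add: ennreal_mult[symmetric])
    qed
  qed
  finally show ?thesis unfolding K_def .
qed

text \<open>
  The maximal function over the first dyadic scales, normalised and raised to the power \<open>q\<close>: a density of mass at
  most one if \<open>A\<close> is at least the Hardy quasi-norm of \<open>f\<close>.
\<close>
definition profile :: "real \<Rightarrow> real \<Rightarrow> (real \<Rightarrow> complex) \<Rightarrow> nat \<Rightarrow> real \<Rightarrow> real" where
  "profile q A f J t = (Max ((\<lambda>j. norm (pois ((1/2) ^ j) (\<lambda>t. f (2 * t)) t)) ` {..J}) / A) powr q"

lemma profile:
  assumes f: "integrable circ f" "\<And>x. f (x + 2 * pi) = f x" and A: "hardy_norm q f \<le> ennreal A" "A > 0" "q > 0"
  shows "profile q A f J \<in> borel_measurable borel" "0 \<le> profile q A f J t" "(\<integral>\<^sup>+t. ennreal (profile q A f J t) \<partial>circ) \<le> 1"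
proof -
  let ?F = "\<lambda>t. f (2 * t)"
  let ?m = "\<lambda>t. Max ((\<lambda>j. norm (pois ((1/2) ^ j) ?F t)) ` {..J})"
  have F: "integrable circ ?F" by (rule integrable_circ_double[OF f])
  have [measurable]: "pois ((1/2) ^ j) ?F \<in> borel_measurable borel" for j
    using F by (intro cper_borel cper_pois) auto
  have mm[measurable]: "?m \<in> borel_measurable borel" by (intro borel_measurable_Max) auto
  have m0: "0 \<le> ?m t" for t
    by (rule order_trans[OF norm_ge_zero Max_ge]) auto
  show "profile q A f J \<in> borel_measurable borel" "0 \<le> profile q A f J t" unfolding profile_def[abs_def] by auto
  let ?R = "(\<lambda>j. exp (- ((1/2) ^ j))) ` {..J} :: real set"
  have "(\<integral>\<^sup>+t. ennreal (?m t powr q) \<partial>circ) \<le> ennreal (A powr q)"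
  proof -
    have "0 \<le> \<rho> \<and> \<rho> < 1" if "\<rho> \<in> ?R" for \<rho> using that by auto
    from nn_integral_Max_poisson[OF f A, of ?R, OF _ _ this] show ?thesis by (simp add: image_image pois_def)
  qed
  have "(\<integral>\<^sup>+t. ennreal (profile q A f J t) \<partial>circ) = (\<integral>\<^sup>+t. ennreal (?m t powr q) * ennreal (A powr (-q)) \<partial>circ)"
  proof (intro nn_integral_cong)
    fix t
    have "profile q A f J t = ?m t powr q * A powr (-q)"
      using A m0[of t] by (simp add: profile_def powr_divide powr_minus_divide)
    then show "ennreal (profile q A f J t) = ennreal (?m t powr q) * ennreal (A powr (-q))" by (simp add: ennreal_mult)
  qed
  also have "\<dots> = (\<integral>\<^sup>+t. ennreal (?m t powr q) \<partial>circ) * ennreal (A powr (-q))"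
    by (intro nn_integral_multc borel_measurable_circ) measurable
  also have "\<dots> \<le> ennreal (A powr q) * ennreal (A powr (-q))" by (rule mult_right_mono) (fact, simp)
  also have "\<dots> = 1" using A by (simp add: ennreal_mult[symmetric] flip: powr_add)
  finally show "(\<integral>\<^sup>+t. ennreal (profile q A f J t) \<partial>circ) \<le> 1" .
qed

text \<open>
  By \<open>hankel_pois\<close> the piece at scale \<open>\<eta> = 1 / 2 ^ j\<close> acts on \<open>u j = P \<eta> F\<close>, and \<open>poisson_hankel_bound\<close> gives it the kernel
  \<open>L * \<eta> powr (\<alpha> - \<gamma>) * chord powr (\<gamma> - 1)\<close>. The functions \<open>u j\<close> are at most their maximum \<open>h\<close> and at most a multiple of
  \<open>A * \<eta> powr (-1/q)\<close>, so \<open>dyadic_sum_bound\<close> with \<open>\<beta> = \<alpha> - \<gamma>\<close> sums the pieces to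
  \<open>A * H powr (1/p + \<gamma>) * chord powr (\<gamma> - 1)\<close> with \<open>H = (h / A) powr q\<close>. The exponent of \<open>H\<close> is where
  \<open>\<alpha> = 1/q - 1/p\<close> enters.
\<close>
lemma truncated_bound:
  fixes p q \<alpha> \<mu> :: real
  assumes p: "1 < p" and q: "0 < q" and \<alpha>: "\<alpha> = 1 / q - 1 / p" and \<mu>: "0 < \<mu>" "3 * \<mu> < 1 - 1/p" "3 * \<mu> < \<alpha>"
  shows "\<exists>D>0. \<forall>f A c L J \<rho> x. integrable circ f \<and> (\<forall>x. f (x + 2 * pi) = f x) \<and> hardy_norm q f \<le> ennreal A \<and> 0 < A \<and> 0 < L \<and>
     (\<forall>j. cper (c j)) \<and> (\<forall>j x. norm (c j x) \<le> L * ((1/2) ^ j) powr \<alpha>) \<and> 0 \<le> \<rho> \<and> \<rho> < 1 \<longrightarrow>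
     ennreal (norm (poisson_integral \<rho> (\<lambda>x. \<Sum>j\<le>J. hankel (pois (3 * (1/2) ^ j) (c j)) (\<lambda>t. f (2 * t)) x) x))
       \<le> ennreal (D * A * L) * (\<integral>\<^sup>+t. ennreal (Phi p \<mu> (profile q A f J t) (chord (x - t))) \<partial>circ)"
proof -
  have p0: "0 < 1/p" "1/p < 1" using p by auto
  have \<mu>1: "3 * \<mu> < 1" using \<mu> p0 by linarith
  from poisson_sup_bound[OF q] obtain C0 where C0: "C0 > 0" and sup0: "\<forall>F A. integrable circ F \<and> A > 0 \<and>
     (\<forall>\<eta>>0. (\<integral>\<^sup>+t. ennreal (norm (poisson_integral (exp (-\<eta>)) F t) powr q) \<partial>circ) \<le> ennreal (A powr q)) \<longrightarrow>
     (\<forall>\<eta> t. 0 < \<eta> \<and> \<eta> \<le> 1 \<longrightarrow> norm (poisson_integral (exp (-\<eta>)) F t) \<le> C0 * A * \<eta> powr (-1 / q))"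
    by (elim exE conjE) (rule that)
  have sup: "norm (poisson_integral (exp (-\<eta>)) F t) \<le> C0 * A * \<eta> powr (-1 / q)"
    if "integrable circ F" "A > 0" "\<And>\<eta>. \<eta> > 0 \<Longrightarrow> (\<integral>\<^sup>+t. ennreal (norm (poisson_integral (exp (-\<eta>)) F t) powr q) \<partial>circ) \<le> ennreal (A powr q)"
      "0 < \<eta>" "\<eta> \<le> 1" for F A \<eta> t
    by (rule sup0[rule_format]) (use that in blast)+
  define good where "good \<gamma> C \<longleftrightarrow> (\<forall>v h A J. 0 \<le> h \<and> 0 < A \<and> (\<forall>j\<le>J. 0 \<le> v j \<and> v j \<le> h \<and> v j \<le> A * ((1/2) ^ j) powr (-1/q)) \<longrightarrow>
     (\<Sum>j\<le>J. ((1/2) ^ j) powr (\<alpha> - \<gamma>) * v j) \<le> C * h powr (1 - (\<alpha> - \<gamma>) * q) * A powr ((\<alpha> - \<gamma>) * q))" for \<gamma> C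
  have dy: "\<exists>C>0. good \<gamma> C" if "0 < \<gamma>" "\<gamma> < \<alpha>" for \<gamma>
    unfolding good_def
  proof (rule dyadic_sum_bound[OF q])
    show "\<alpha> - \<gamma> < 1 / q" unfolding \<alpha> using that p0 by linarith
  qed (use that in simp)
  have goodD: "(\<Sum>j\<le>J. ((1/2) ^ j) powr (\<alpha> - \<gamma>) * v j) \<le> C * h powr (1 - (\<alpha> - \<gamma>) * q) * A powr ((\<alpha> - \<gamma>) * q)"
    if "good \<gamma> C" "0 \<le> h" "0 < A" "\<And>j. j \<le> J \<Longrightarrow> 0 \<le> v j \<and> v j \<le> h \<and> v j \<le> A * ((1/2) ^ j) powr (-1/q)" for \<gamma> C v h A J
    by (rule that(1)[unfolded good_def, rule_format]) (use that(2-4) in blast)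
  obtain C1 where C1: "C1 > 0" and "good \<mu> C1" using dy[of \<mu>] \<mu> by auto
  note s1 = goodD[OF this(2)]
  obtain C2 where C2: "C2 > 0" and "good (3 * \<mu>) C2" using dy[of "3 * \<mu>"] \<mu> by auto
  note s2 = goodD[OF this(2)]
  define C3 where "C3 = max (C1 * C0 powr ((\<alpha> - \<mu>) * q)) (C2 * C0 powr ((\<alpha> - 3 * \<mu>) * q))"
  have C3: "C3 > 0" unfolding C3_def using C1 C0 by (intro max.strict_coboundedI1) auto
  define K where "K = 8 * pi + 16 * pi / \<mu>"
  have K: "K > 0" unfolding K_def using \<mu> by (intro add_pos_pos) auto
  define D where "D = K * C3"
  have D: "D > 0" using K C3 by (simp add: D_def)
  have "ennreal (norm (poisson_integral \<rho> (\<lambda>x. \<Sum>j\<le>J. hankel (pois (3 * (1/2) ^ j) (c j)) (\<lambda>t. f (2 * t)) x) x))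
       \<le> ennreal (D * A * L) * (\<integral>\<^sup>+t. ennreal (Phi p \<mu> (profile q A f J t) (chord (x - t))) \<partial>circ)"
    if f: "integrable circ f" "\<And>x. f (x + 2 * pi) = f x" and A: "hardy_norm q f \<le> ennreal A" "0 < A" and L: "0 < L"
      and c: "\<And>j. cper (c j)" "\<And>j x. norm (c j x) \<le> L * ((1/2) ^ j) powr \<alpha>" and \<rho>: "0 \<le> \<rho>" "\<rho> < 1"
    for f A c L J \<rho> x
  proof -
    define F where "F = (\<lambda>t. f (2 * t))"
    have F: "integrable circ F" unfolding F_def by (rule integrable_circ_double[OF f])
    define \<eta> where "\<eta> j = (1/2 :: real) ^ j" for j :: nat
    have \<eta>: "0 < \<eta> j" "\<eta> j \<le> 1" for j by (auto simp: \<eta>_def power_le_one)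
    define u where "u j = pois (\<eta> j) F" for j
    have cu: "cper (u j)" for j unfolding u_def by (intro cper_pois F \<eta>)
    define h where "h t = Max ((\<lambda>j. norm (u j t)) ` {..J})" for t
    have h0: "0 \<le> h t" for t unfolding h_def by (rule order_trans[OF norm_ge_zero Max_ge]) auto
    have uh: "norm (u j t) \<le> h t" if "j \<le> J" for j t unfolding h_def using that by (intro Max_ge) auto
    have uA: "norm (u j t) \<le> C0 * A * \<eta> j powr (-1/q)" for j t
      unfolding u_def pois_def
    proof (rule sup[OF F A(2) _ \<eta>])
      fix e :: real assume "e > 0"
      then show "(\<integral>\<^sup>+t. ennreal (norm (poisson_integral (exp (-e)) F t) powr q) \<partial>circ) \<le> ennreal (A powr q)"
        using nn_integral_Max_poisson[OF f A q, of "{exp (-e)}"] by (simp add: F_def)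
    qed
    define H where "H = profile q A f J"
    have HH: "H t = (h t / A) powr q" for t by (simp add: H_def profile_def h_def u_def F_def \<eta>_def)
    have Hp: "h t powr (1 - (\<alpha> - \<gamma>) * q) * (C0 * A) powr ((\<alpha> - \<gamma>) * q) = C0 powr ((\<alpha> - \<gamma>) * q) * A * H t powr (1/p + \<gamma>)" for t \<gamma>
    proof -
      have e: "q * (1/p + \<gamma>) = 1 - (\<alpha> - \<gamma>) * q" using q by (simp add: \<alpha> field_simps)
      have "H t powr (1/p + \<gamma>) = h t powr (1 - (\<alpha> - \<gamma>) * q) / A powr (1 - (\<alpha> - \<gamma>) * q)"
        unfolding HH powr_powr e using h0 A by (simp add: powr_divide)
      moreover have "A = A powr (1 - (\<alpha> - \<gamma>) * q) * A powr ((\<alpha> - \<gamma>) * q)" using A by (simp flip: powr_add)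
      then have "A / A powr (1 - (\<alpha> - \<gamma>) * q) = A powr ((\<alpha> - \<gamma>) * q)" using A by (simp add: field_simps)
      ultimately show ?thesis using C0 A by (simp add: powr_mult) (metis mult.commute times_divide_eq_right)
    qed
    let ?B = "\<lambda>j. pois (\<eta> j) (c j)"
    let ?M = "\<lambda>j. L * \<eta> j powr \<alpha>"
    have ch: "cper (hankel (?B j) G)" if "integrable circ G" for j G by (rule hankel_pois(2)[OF c(1) \<eta>(1) F that])
    have eq: "hankel (pois (3 * (1/2) ^ j) (c j)) F = pois (\<eta> j) (hankel (?B j) (u j))" for j
    proof
      fix x
      have "pois (3 * (1/2) ^ j) (c j) = pois (2 * \<eta> j) (?B j)"
        using pois_pois[OF cper_integrable[OF c(1)], of "2 * \<eta> j" "\<eta> j" j] \<eta> by (simp add: \<eta>_def)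
      then show "hankel (pois (3 * (1/2) ^ j) (c j)) F x = pois (\<eta> j) (hankel (?B j) (u j)) x"
        unfolding u_def using hankel_pois(1)[OF c(1) \<eta>(1) F] by simp
    qed
    have ihu: "integrable circ (hankel (?B j) (u j))" for j by (intro cper_integrable ch cu)
    have r': "0 \<le> \<rho> * exp (- \<eta> j)" "\<rho> * exp (- \<eta> j) < 1" for j
    proof -
      show "0 \<le> \<rho> * exp (- \<eta> j)" using \<rho> by simp
      have "\<rho> * exp (- \<eta> j) \<le> \<rho> * 1" using \<rho> \<eta>(1)[of j] by (intro mult_left_mono) auto
      then show "\<rho> * exp (- \<eta> j) < 1" using \<rho> by simp
    qed
    have sum1: "poisson_integral \<rho> (\<lambda>x. \<Sum>j\<le>J. hankel (pois (3 * (1/2) ^ j) (c j)) F x) x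
       = (\<Sum>j\<le>J. poisson_integral (\<rho> * exp (- \<eta> j)) (hankel (?B j) (u j)) x)"
    proof -
      have ip: "integrable circ (pois (\<eta> j) (hankel (?B j) (u j)))" for j by (intro cper_integrable cper_pois ihu \<eta>)
      have "poisson_integral \<rho> (\<lambda>x. \<Sum>j\<le>J. pois (\<eta> j) (hankel (?B j) (u j)) x) x = (\<Sum>j\<le>J. poisson_integral \<rho> (pois (\<eta> j) (hankel (?B j) (u j))) x)"
        using integrable_kernel_mult[OF ip \<rho>, of x] unfolding poisson_integral_circ by (simp add: sum_distrib_left sum_divide_distrib)
      also have "\<dots> = (\<Sum>j\<le>J. poisson_integral (\<rho> * exp (- \<eta> j)) (hankel (?B j) (u j)) x)"
        unfolding pois_def[of "\<eta> _" "hankel _ _"] using \<rho> \<eta> by (intro sum.cong refl) (subst poisson_semigroup[OF ihu]; simp)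
      finally show ?thesis by (simp add: eq)
    qed
    have Mb: "norm (c j x) \<le> ?M j" for j x using c(2) by (simp add: \<eta>_def)
    let ?g = "\<lambda>j t. K * ?M j * min (\<eta> j powr (-\<mu>) * chord (x - t) powr (\<mu> - 1)) (\<eta> j powr (- (3 * \<mu>)) * chord (x - t) powr (3 * \<mu> - 1)) * norm (u j t)"
    have g0: "0 \<le> ?g j t" for j t using K L by (intro mult_nonneg_nonneg) auto
    have gm: "(\<lambda>t. ennreal (?g j t)) \<in> borel_measurable circ" for j
      using cper_borel[OF cu] by (intro borel_measurable_circ) measurable
    have "ennreal (norm (poisson_integral \<rho> (\<lambda>x. \<Sum>j\<le>J. hankel (pois (3 * (1/2) ^ j) (c j)) F x) x))
      \<le> ennreal (\<Sum>j\<le>J. norm (poisson_integral (\<rho> * exp (- \<eta> j)) (hankel (?B j) (u j)) x))"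
      unfolding sum1 by (intro ennreal_leI norm_sum)
    also have "\<dots> = (\<Sum>j\<le>J. ennreal (norm (poisson_integral (\<rho> * exp (- \<eta> j)) (hankel (?B j) (u j)) x)))"
      by (simp add: sum_ennreal)
    also have "\<dots> \<le> (\<Sum>j\<le>J. \<integral>\<^sup>+t. ennreal (?g j t) \<partial>circ)"
      unfolding K_def using \<mu>1 by (intro sum_mono poisson_hankel_bound c Mb \<eta> cu r' \<mu>) auto
    also have "\<dots> = (\<integral>\<^sup>+t. (\<Sum>j\<le>J. ennreal (?g j t)) \<partial>circ)" by (rule nn_integral_sum[symmetric]) (rule gm)
    also have "\<dots> \<le> (\<integral>\<^sup>+t. ennreal (D * A * L) * ennreal (Phi p \<mu> (H t) (chord (x - t))) \<partial>circ)"
    proof (rule nn_integral_mono)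
      fix t
      let ?s = "chord (x - t)"
      have ab: "0 \<le> norm (u j t) \<and> norm (u j t) \<le> h t \<and> norm (u j t) \<le> (C0 * A) * ((1/2) ^ j) powr (-1/q)" if "j \<le> J" for j
        using uh[OF that, of t] uA[of j t] by (simp add: \<eta>_def)
      have S1: "(\<Sum>j\<le>J. \<eta> j powr (\<alpha> - \<mu>) * norm (u j t)) \<le> C3 * A * H t powr (1/p + \<mu>)"
      proof -
        have "(\<Sum>j\<le>J. \<eta> j powr (\<alpha> - \<mu>) * norm (u j t)) \<le> C1 * h t powr (1 - (\<alpha> - \<mu>) * q) * (C0 * A) powr ((\<alpha> - \<mu>) * q)"
          unfolding \<eta>_def by (rule s1[OF h0 _ ab]) (use C0 A in auto)
        also have "\<dots> = C1 * C0 powr ((\<alpha> - \<mu>) * q) * (A * H t powr (1/p + \<mu>))"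
          using Hp[of t \<mu>] by (simp only: mult.assoc)
        also have "\<dots> \<le> C3 * (A * H t powr (1/p + \<mu>))" using A by (intro mult_right_mono) (auto simp: C3_def)
        finally show ?thesis by (simp add: mult.assoc)
      qed
      have S2: "(\<Sum>j\<le>J. \<eta> j powr (\<alpha> - 3 * \<mu>) * norm (u j t)) \<le> C3 * A * H t powr (1/p + 3 * \<mu>)"
      proof -
        have "(\<Sum>j\<le>J. \<eta> j powr (\<alpha> - 3 * \<mu>) * norm (u j t)) \<le> C2 * h t powr (1 - (\<alpha> - 3 * \<mu>) * q) * (C0 * A) powr ((\<alpha> - 3 * \<mu>) * q)"
          unfolding \<eta>_def by (rule s2[OF h0 _ ab]) (use C0 A in auto)
        also have "\<dots> = C2 * C0 powr ((\<alpha> - 3 * \<mu>) * q) * (A * H t powr (1/p + 3 * \<mu>))"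
          using Hp[of t "3 * \<mu>"] by (simp only: mult.assoc)
        also have "\<dots> \<le> C3 * (A * H t powr (1/p + 3 * \<mu>))" using A by (intro mult_right_mono) (auto simp: C3_def)
        finally show ?thesis by (simp add: mult.assoc)
      qed
      have KL: "0 \<le> K * L" using K L by simp
      have pull: "?g j t \<le> K * L * ((\<eta> j powr (\<alpha> - \<gamma>) * norm (u j t)) * ?s powr (\<gamma> - 1))" if "\<gamma> = \<mu> \<or> \<gamma> = 3 * \<mu>" for j \<gamma>
      proof -
        have "?g j t \<le> K * ?M j * (\<eta> j powr (-\<gamma>) * ?s powr (\<gamma> - 1)) * norm (u j t)"
          using that K L by (intro mult_right_mono mult_left_mono) auto
        also have "\<dots> = K * L * (((\<eta> j powr \<alpha> * \<eta> j powr (-\<gamma>)) * norm (u j t)) * ?s powr (\<gamma> - 1))" by simp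
        also have "\<eta> j powr \<alpha> * \<eta> j powr (-\<gamma>) = \<eta> j powr (\<alpha> - \<gamma>)" by (simp flip: powr_add)
        finally show ?thesis .
      qed
      have tot: "(\<Sum>j\<le>J. ?g j t) \<le> K * L * (C3 * A * H t powr (1/p + \<gamma>) * ?s powr (\<gamma> - 1))"
        if \<gamma>: "\<gamma> = \<mu> \<or> \<gamma> = 3 * \<mu>" for \<gamma>
      proof -
        have "(\<Sum>j\<le>J. ?g j t) \<le> (\<Sum>j\<le>J. K * L * ((\<eta> j powr (\<alpha> - \<gamma>) * norm (u j t)) * ?s powr (\<gamma> - 1)))"
          by (intro sum_mono pull \<gamma>)
        also have "\<dots> = K * L * ((\<Sum>j\<le>J. \<eta> j powr (\<alpha> - \<gamma>) * norm (u j t)) * ?s powr (\<gamma> - 1))"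
          by (simp only: sum_distrib_left sum_distrib_right)
        also have "\<dots> \<le> K * L * (C3 * A * H t powr (1/p + \<gamma>) * ?s powr (\<gamma> - 1))"
          using \<gamma> S1 S2 KL by (intro mult_left_mono mult_right_mono) auto
        finally show ?thesis .
      qed
      have "(\<Sum>j\<le>J. ?g j t) \<le> (D * A * L) * Phi p \<mu> (H t) ?s"
      proof -
        have e: "K * L * (C3 * A * H t powr (1/p + \<gamma>) * ?s powr (\<gamma> - 1)) = (D * A * L) * (H t powr (1/p + \<gamma>) * ?s powr (\<gamma> - 1))" for \<gamma>
          by (simp add: D_def)
        have t1: "(\<Sum>j\<le>J. ?g j t) \<le> (D * A * L) * (H t powr (1/p + \<mu>) * ?s powr (\<mu> - 1))"
          using tot[of \<mu>] unfolding e by blast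
        have t2: "(\<Sum>j\<le>J. ?g j t) \<le> (D * A * L) * (H t powr (1/p + 3 * \<mu>) * ?s powr (3 * \<mu> - 1))"
          using tot[of "3 * \<mu>"] unfolding e by blast
        have "Phi p \<mu> (H t) ?s = H t powr (1/p + \<mu>) * ?s powr (\<mu> - 1) \<or> Phi p \<mu> (H t) ?s = H t powr (1/p + 3 * \<mu>) * ?s powr (3 * \<mu> - 1)"
          unfolding Phi_def by linarith
        then show ?thesis
          by (elim disjE) (simp only: t1, simp only: t2)
      qed
      then have "ennreal (\<Sum>j\<le>J. ?g j t) \<le> ennreal ((D * A * L) * Phi p \<mu> (H t) ?s)" by (rule ennreal_leI)
      then show "(\<Sum>j\<le>J. ennreal (?g j t)) \<le> ennreal (D * A * L) * ennreal (Phi p \<mu> (H t) ?s)"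
        using D A L g0 by (simp add: ennreal_mult sum_ennreal)
    qed
    also have "\<dots> = ennreal (D * A * L) * (\<integral>\<^sup>+t. ennreal (Phi p \<mu> (H t) (chord (x - t))) \<partial>circ)"
    proof (rule nn_integral_cmult)
      have "(\<lambda>t. Phi p \<mu> (H t) (chord (x - t))) \<in> borel_measurable borel"
        unfolding H_def by (intro borel_Phi profile(1)[OF f A q]) measurable
      then show "(\<lambda>t. ennreal (Phi p \<mu> (H t) (chord (x - t)))) \<in> borel_measurable circ" by (intro borel_measurable_circ) measurable
    qed
    finally show ?thesis by (simp add: F_def H_def)
  qed
  with D show ?thesis by blast
qed

section \<open>The limit of the truncations\<close>
lemma borel_hankel:
  assumes b: "b \<in> borel_measurable borel" and F: "integrable circ F"
  shows "hankel b F \<in> borel_measurable borel"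
proof -
  note [measurable] = b
  have [measurable]: "F \<in> borel_measurable circ" using F by auto
  have [measurable]: "snd \<in> borel_measurable (borel \<Otimes>\<^sub>M circ)"
    using measurable_compose[OF measurable_snd borel_measurable_circ[of "\<lambda>x. x"]] by auto
  have "(\<lambda>z. hker b (fst z) (snd z) * F (snd z)) \<in> borel_measurable (borel \<Otimes>\<^sub>M circ)"
    unfolding hker_def tan_def by measurable
  then show ?thesis unfolding hankel_def[abs_def]
    by (intro circ.borel_measurable_lebesgue_integral) (simp add: case_prod_unfold)
qed

lemma integrable_hankel:
  assumes "b \<in> borel_measurable borel" "chord_lipschitz \<Lambda> b" "integrable circ F"
  shows "integrable circ (hankel b F)"
  by (rule circ.integrable_const_bound[of _ "\<Lambda> * (\<integral>t. norm (F t) \<partial>circ)"])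
     (use hankel_norm[OF assms] borel_measurable_circ[OF borel_hker] borel_measurable_circ[OF borel_hankel[OF assms(1,3)]] in auto)

lemma hankel_add:
  assumes "b \<in> borel_measurable borel" "chord_lipschitz \<Lambda> b" "c \<in> borel_measurable borel" "chord_lipschitz \<Lambda>' c" "integrable circ F"
  shows "hankel (\<lambda>x. b x + c x) F x = hankel b F x + hankel c F x"
proof -
  have "hker (\<lambda>x. b x + c x) x t * F t = hker b x t * F t + hker c x t * F t" for t
    by (simp add: hker_def diff_divide_distrib add_divide_distrib algebra_simps)
  then show ?thesis using integrable_hker[OF assms(1,2,5)] integrable_hker[OF assms(3,4,5)] by (simp add: hankel_def)
qed

lemma hankel_sum:
  assumes "\<And>i. i \<in> I \<Longrightarrow> b i \<in> borel_measurable borel" "\<And>i. i \<in> I \<Longrightarrow> chord_lipschitz (\<Lambda> i) (b i)" "integrable circ F"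
  shows "hankel (\<lambda>x. \<Sum>i\<in>I. b i x) F x = (\<Sum>i\<in>I. hankel (b i) F x)"
proof -
  have "hker (\<lambda>x. \<Sum>i\<in>I. b i x) x t * F t = (\<Sum>i\<in>I. hker (b i) x t * F t)" for t
    by (simp add: hker_def sum_subtractf[symmetric] sum_divide_distrib sum_distrib_right)
  then show ?thesis using integrable_hker[OF assms(1,2,3)] by (simp add: hankel_def)
qed

lemma chord_lipschitz_sum:
  assumes "finite I" "\<And>i. i \<in> I \<Longrightarrow> chord_lipschitz (\<Lambda> i) (b i)"
  shows "chord_lipschitz (\<Sum>i\<in>I. \<Lambda> i) (\<lambda>x. \<Sum>i\<in>I. b i x)"
  unfolding chord_lipschitz_def
proof (intro allI)
  fix x y
  have "norm ((\<Sum>i\<in>I. b i x) - (\<Sum>i\<in>I. b i y)) \<le> (\<Sum>i\<in>I. norm (b i x - b i y))"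
    unfolding sum_subtractf[symmetric] by (rule norm_sum)
  also have "\<dots> \<le> (\<Sum>i\<in>I. \<Lambda> i * chord (x - y))"
    using assms(2) by (intro sum_mono) (auto simp: chord_lipschitz_def)
  finally show "norm ((\<Sum>i\<in>I. b i x) - (\<Sum>i\<in>I. b i y)) \<le> (\<Sum>i\<in>I. \<Lambda> i) * chord (x - y)"
    by (simp add: sum_distrib_right)
qed

text \<open>
  The uniform Lipschitz bound dominates the kernels, and off the diagonal they tend to zero with the symbols.
\<close>
lemma hankel_tendsto_zero:
  assumes R: "\<And>j. R j \<in> borel_measurable borel" "\<And>j. chord_lipschitz \<Lambda> (R j)" and e: "\<And>j x. norm (R j x) \<le> e j" "e \<longlonglongrightarrow> 0"
    and F: "integrable circ F"
  shows "(\<lambda>j. hankel (R j) F x) \<longlonglongrightarrow> 0"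
proof -
  have "(\<lambda>j. \<integral>t. hker (R j) x t * F t \<partial>circ) \<longlonglongrightarrow> (\<integral>t. 0 \<partial>circ)"
  proof (rule integral_dominated_convergence)
    show "(\<lambda>t. hker (R j) x t * F t) \<in> borel_measurable circ" for j using integrable_hker[OF R F, where x = x] by auto
    show "integrable circ (\<lambda>t. \<Lambda> * norm (F t))" using F by auto
    show "AE t in circ. norm (hker (R j) x t * F t) \<le> \<Lambda> * norm (F t)" for j
      using hker_lipschitz[OF R(2)] by (intro AE_I2) (simp add: norm_mult mult_right_mono)
    show "AE t in circ. (\<lambda>j. hker (R j) x t * F t) \<longlonglongrightarrow> 0"
      using AE_circ_chord[of x]
    proof eventually_elim
      case (elim t)
      have "(\<lambda>j. 2 * e j / chord (x - t)) \<longlonglongrightarrow> 2 * 0 / chord (x - t)"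
        using elim by (intro tendsto_intros e) auto
      then have z: "(\<lambda>j. 2 * e j / chord (x - t)) \<longlonglongrightarrow> 0" by simp
      have "(\<lambda>j. hker (R j) x t) \<longlonglongrightarrow> 0"
        by (rule Lim_null_comparison[OF _ z]) (intro always_eventually allI hker_bounded e(1))
      from tendsto_mult_left_zero[OF this] show ?case by (simp add: mult.commute)
    qed
  qed simp
  then show ?thesis by (simp add: hankel_def)
qed

lemma poisson_hankel_tendsto_zero:
  assumes R: "\<And>j. R j \<in> borel_measurable borel" "\<And>j. chord_lipschitz \<Lambda> (R j)" and e: "\<And>j x. norm (R j x) \<le> e j" "e \<longlonglongrightarrow> 0"
    and F: "integrable circ F" and \<rho>: "0 \<le> \<rho>" "\<rho> < 1"
  shows "(\<lambda>j. poisson_integral \<rho> (hankel (R j) F) x) \<longlonglongrightarrow> 0"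
proof -
  let ?N = "\<Lambda> * (\<integral>t. norm (F t) \<partial>circ)"
  have "(\<lambda>j. \<integral>t. complex_of_real (poisson_kernel \<rho> (x - t)) * hankel (R j) F t \<partial>circ) \<longlonglongrightarrow> (\<integral>t. 0 \<partial>circ)"
  proof (rule integral_dominated_convergence)
    show "(\<lambda>t. complex_of_real (poisson_kernel \<rho> (x - t)) * hankel (R j) F t) \<in> borel_measurable circ" for j
      using integrable_kernel_mult[OF integrable_hankel[OF R F] \<rho>, where x = x] by auto
    show "integrable circ (\<lambda>t. poisson_kernel \<rho> (x - t) * ?N)" using integrable_poisson_kernel[OF \<rho>] by auto
    show "AE t in circ. norm (complex_of_real (poisson_kernel \<rho> (x - t)) * hankel (R j) F t) \<le> poisson_kernel \<rho> (x - t) * ?N" for j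
      using hankel_norm[OF R F] \<rho> by (intro AE_I2) (auto simp: norm_mult intro!: mult_left_mono)
    show "AE t in circ. (\<lambda>j. complex_of_real (poisson_kernel \<rho> (x - t)) * hankel (R j) F t) \<longlonglongrightarrow> 0"
      using hankel_tendsto_zero[OF R e F] by (intro AE_I2 tendsto_mult_right_zero)
  qed simp
  then have "(\<lambda>j. (\<integral>t. complex_of_real (poisson_kernel \<rho> (x - t)) * hankel (R j) F t \<partial>circ) / complex_of_real (2 * pi)) \<longlonglongrightarrow> 0 / complex_of_real (2 * pi)"
    by (intro tendsto_divide) auto
  then show ?thesis by (simp add: poisson_integral_circ)
qed

lemma ennreal_powr_SUP_le:
  assumes a: "\<And>\<rho>. \<rho> \<in> S \<Longrightarrow> 0 \<le> a \<rho>" and p: "0 < p" and le: "\<And>\<rho>. \<rho> \<in> S \<Longrightarrow> ennreal (a \<rho> powr p) \<le> Z"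
  shows "ennreal_powr (SUP \<rho>\<in>S. ennreal (a \<rho>)) p \<le> Z"
proof (cases Z)
  case (real z)
  have "ennreal (a \<rho>) \<le> ennreal (z powr (1/p))" if "\<rho> \<in> S" for \<rho>
  proof (rule ennreal_leI)
    have "a \<rho> powr p \<le> z" using le[OF that] real by simp
    then have "(a \<rho> powr p) powr (1/p) \<le> z powr (1/p)" using p by (intro powr_mono2) auto
    then show "a \<rho> \<le> z powr (1/p)" using a[OF that] p by (simp add: powr_powr)
  qed
  then have s: "(SUP \<rho>\<in>S. ennreal (a \<rho>)) \<le> ennreal (z powr (1/p))" by (rule SUP_least)
  have "(SUP \<rho>\<in>S. ennreal (a \<rho>)) < top" by (rule le_less_trans[OF s]) simp
  then have f: "(SUP \<rho>\<in>S. ennreal (a \<rho>)) \<noteq> \<infinity>" unfolding infinity_ennreal_def by (rule less_imp_neq)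
  have "enn2real (SUP \<rho>\<in>S. ennreal (a \<rho>)) \<le> z powr (1/p)" using s by (rule enn2real_leI[rotated]) simp
  then have "enn2real (SUP \<rho>\<in>S. ennreal (a \<rho>)) powr p \<le> (z powr (1/p)) powr p" using p by (intro powr_mono2) auto
  also have "\<dots> = z" using real p by (simp add: powr_powr)
  finally have e: "enn2real (SUP \<rho>\<in>S. ennreal (a \<rho>)) powr p \<le> z" .
  have Z: "Z = ennreal z" using real by simp
  show ?thesis unfolding ennreal_powr_def if_not_P[OF f] Z by (rule ennreal_leI[OF e])
qed simp

text \<open>
  The truncated operators satisfy the estimate with densities that change with the truncation, but with the same
  constants. The remainders tend to zero in each Poisson integral, so Fatou's lemma for the integrals of \<open>Psi\<close> yields
  the estimate for the full operator.
\<close>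
lemma hankel_estimate:
  fixes p q \<alpha> :: real
  assumes p: "1 < p" and q: "0 < q" "q < p" and \<alpha>: "\<alpha> = 1 / q - 1 / p"
  shows "\<exists>C>0. \<forall>b f A L \<Lambda>. cper b \<and> chord_lipschitz \<Lambda> b \<and> lipschitz_norm \<alpha> b \<le> ennreal L \<and> 0 < L \<and>
     integrable circ f \<and> (\<forall>x. f (x + 2 * pi) = f x) \<and> hardy_norm q f \<le> ennreal A \<and> 0 < A \<longrightarrow>
     hardy_norm p (hankel_tilde b f) \<le> ennreal (C * A * L)"
proof -
  have a0: "0 < \<alpha>" unfolding \<alpha> using p q by (simp add: divide_strict_left_mono)
  have p1: "0 < 1 - 1/p" using p by simp
  \<comment> \<open>Any positive number with \<open>3 * \<mu> < \<alpha>\<close> and \<open>3 * \<mu> < 1 - 1/p\<close> serves.\<close>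
  define \<mu> where "\<mu> = min \<alpha> (1 - 1/p) / 4"
  have \<mu>: "0 < \<mu>" "3 * \<mu> < 1 - 1/p" "3 * \<mu> < \<alpha>" using a0 p1 by (auto simp: \<mu>_def min_def)
  have \<mu>1: "\<mu> \<le> 1"
  proof -
    have "0 < 1/p" using p by simp
    then show ?thesis using \<mu> by linarith
  qed
  obtain C1 where C1: "C1 > 0" and dec: "\<forall>b L \<Lambda>. cper b \<and> 0 \<le> L \<and> lipschitz_norm \<alpha> b \<le> ennreal L \<and> chord_lipschitz \<Lambda> b \<longrightarrow>
    (\<exists>c R \<Lambda>'. \<forall>j. cper (c j) \<and> cper (R j) \<and> (\<forall>x. norm (c j x) \<le> C1 * L * ((1/2) ^ j) powr \<alpha>) \<and>
       (\<forall>x. norm (R j x) \<le> C1 * L * ((1/2) ^ j) powr \<alpha>) \<and> chord_lipschitz \<Lambda>' (R j) \<and>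
       (\<forall>x. b x = (\<Sum>i\<le>j. pois (3 * (1/2) ^ i) (c i) x) + R j x))"
    using lipschitz_decomposition[OF a0] by (elim exE conjE) (rule that)
  from truncated_bound[OF p q(1) \<alpha> \<mu>] obtain D where D: "D > 0" and
    tr: "\<forall>f A c L J \<rho> x. integrable circ f \<and> (\<forall>x. f (x + 2 * pi) = f x) \<and> hardy_norm q f \<le> ennreal A \<and> 0 < A \<and> 0 < L \<and>
     (\<forall>j. cper (c j)) \<and> (\<forall>j x. norm (c j x) \<le> L * ((1/2) ^ j) powr \<alpha>) \<and> 0 \<le> \<rho> \<and> \<rho> < 1 \<longrightarrow>
     ennreal (norm (poisson_integral \<rho> (\<lambda>x. \<Sum>j\<le>J. hankel (pois (3 * (1/2) ^ j) (c j)) (\<lambda>t. f (2 * t)) x) x))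
       \<le> ennreal (D * A * L) * (\<integral>\<^sup>+t. ennreal (Phi p \<mu> (profile q A f J t) (chord (x - t))) \<partial>circ)"
    by (elim exE conjE) (rule that)
  from Phi_power_le_Psi[OF p \<mu>(1,2)] obtain C2 where C2: "C2 > 0" and
    pp: "\<forall>H x w. H \<in> borel_measurable borel \<and> (\<forall>t. 0 \<le> H t) \<and> (\<integral>\<^sup>+t. ennreal (H t) \<partial>circ) \<le> 1 \<and>
       0 \<le> w \<and> ennreal w \<le> (\<integral>\<^sup>+t. ennreal (Phi p \<mu> (H t) (chord (x - t))) \<partial>circ) \<longrightarrow>
     ennreal (w powr p) \<le> ennreal C2 * (\<integral>\<^sup>+t. ennreal (Psi \<mu> (H t) (chord (x - t))) \<partial>circ)"
    by (elim exE conjE) (rule that)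
  from Psi_integral[OF \<mu>(1) \<mu>1] obtain C3 where C3: "C3 > 0" and
    pi3: "\<forall>H. H \<in> borel_measurable borel \<and> (\<forall>t. 0 \<le> H t) \<longrightarrow>
    (\<integral>\<^sup>+x. (\<integral>\<^sup>+t. ennreal (Psi \<mu> (H t) (chord (x - t))) \<partial>circ) \<partial>circ) \<le> ennreal C3 * (\<integral>\<^sup>+t. ennreal (H t) \<partial>circ)"
    by (elim exE conjE) (rule that)
  define C where "C = D * C1 * (C2 * C3) powr (1/p)"
  have C: "C > 0" using D C1 C2 C3 by (simp add: C_def)
  have "hardy_norm p (hankel_tilde b f) \<le> ennreal (C * A * L)"
    if b: "cper b" "chord_lipschitz \<Lambda> b" "lipschitz_norm \<alpha> b \<le> ennreal L" and L: "0 < L"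
      and f: "integrable circ f" "\<And>x. f (x + 2 * pi) = f x" and A: "hardy_norm q f \<le> ennreal A" "0 < A" for b f A L \<Lambda>
  proof -
    define F where "F = (\<lambda>t. f (2 * t))"
    have F: "integrable circ F" unfolding F_def by (rule integrable_circ_double[OF f])
    obtain c R \<Lambda>' where cR: "\<forall>j. cper (c j) \<and> cper (R j) \<and> (\<forall>x. norm (c j x) \<le> C1 * L * ((1/2) ^ j) powr \<alpha>) \<and>
       (\<forall>x. norm (R j x) \<le> C1 * L * ((1/2) ^ j) powr \<alpha>) \<and> chord_lipschitz \<Lambda>' (R j) \<and>
       (\<forall>x. b x = (\<Sum>i\<le>j. pois (3 * (1/2) ^ i) (c i) x) + R j x)"
      using dec[rule_format, of b L \<Lambda>] b L by auto
    have c: "cper (c j)" "norm (c j x) \<le> C1 * L * ((1/2) ^ j) powr \<alpha>" and R: "cper (R j)" "norm (R j x) \<le> C1 * L * ((1/2) ^ j) powr \<alpha>" "chord_lipschitz \<Lambda>' (R j)"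
      and bs: "b x = (\<Sum>i\<le>j. pois (3 * (1/2) ^ i) (c i) x) + R j x" for j x using cR by blast+
    define K where "K = D * A * (C1 * L)"
    have K: "K > 0" using D A C1 L by (simp add: K_def)
    define T where "T = hankel b F"
    define TJ where "TJ J x = (\<Sum>j\<le>J. hankel (pois (3 * (1/2) ^ j) (c j)) F x)" for J x
    have cl: "chord_lipschitz (2 * (C1 * L * ((1/2) ^ j) powr \<alpha>) / (3 * (1/2) ^ j)) (pois (3 * (1/2) ^ j) (c j))" for j
      by (rule chord_lipschitz_smoothed[OF c]) simp
    have cb: "pois (3 * (1/2) ^ j) (c j) \<in> borel_measurable borel" for j
      by (intro cper_borel cper_pois cper_integrable c) simp
    have Rb: "R j \<in> borel_measurable borel" for j by (rule cper_borel[OF R(1)])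
    have Tsplit: "T x = TJ J x + hankel (R J) F x" for J x
    proof -
      have "b = (\<lambda>x. (\<Sum>i\<le>J. pois (3 * (1/2) ^ i) (c i) x) + R J x)" using bs[of _ J] by auto
      then have "T x = hankel (\<lambda>x. (\<Sum>i\<le>J. pois (3 * (1/2) ^ i) (c i) x) + R J x) F x" by (simp add: T_def)
      also have "\<dots> = hankel (\<lambda>x. \<Sum>i\<le>J. pois (3 * (1/2) ^ i) (c i) x) F x + hankel (R J) F x"
        by (rule hankel_add[OF _ chord_lipschitz_sum[OF _ cl] Rb R(3) F]) (auto intro!: borel_measurable_sum cb)
      also have "hankel (\<lambda>x. \<Sum>i\<le>J. pois (3 * (1/2) ^ i) (c i) x) F x = TJ J x"
        unfolding TJ_def by (rule hankel_sum[OF cb cl F])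
      finally show ?thesis .
    qed
    have iT: "integrable circ T" unfolding T_def by (rule integrable_hankel[OF cper_borel[OF b(1)] b(2) F])
    have iR: "integrable circ (hankel (R J) F)" for J by (rule integrable_hankel[OF Rb R(3) F])
    have iTJ: "integrable circ (TJ J)" for J
    proof -
      have "TJ J = (\<lambda>x. T x - hankel (R J) F x)" using Tsplit[of _ J] by (auto simp: fun_eq_iff)
      then show ?thesis using iT iR by auto
    qed
    have lim: "(\<lambda>J. poisson_integral \<rho> (TJ J) x) \<longlonglongrightarrow> poisson_integral \<rho> T x" if \<rho>: "0 \<le> \<rho>" "\<rho> < 1" for \<rho> x
    proof -
      have "(\<lambda>J. C1 * L * ((1/2) ^ J) powr \<alpha>) \<longlonglongrightarrow> C1 * L * 0"
      proof (intro tendsto_mult tendsto_const)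
        have "(\<lambda>J. ((1/2) powr \<alpha>) ^ J) \<longlonglongrightarrow> 0"
          using powr_less_mono2[OF a0, of "1/2" 1] by (intro LIMSEQ_realpow_zero) auto
        moreover have "((1/2 :: real) powr \<alpha>) ^ J = ((1/2) ^ J) powr \<alpha>" for J
          by (simp add: powr_powr mult.commute flip: powr_realpow)
        ultimately show "(\<lambda>J. ((1/2 :: real) ^ J) powr \<alpha>) \<longlonglongrightarrow> 0" by simp
      qed
      then have "(\<lambda>J. C1 * L * ((1/2) ^ J) powr \<alpha>) \<longlonglongrightarrow> 0" by simp
      from poisson_hankel_tendsto_zero[OF Rb R(3) R(2) this F \<rho>]
      have "(\<lambda>J. poisson_integral \<rho> T x - poisson_integral \<rho> (hankel (R J) F) x) \<longlonglongrightarrow> poisson_integral \<rho> T x - 0"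
        by (intro tendsto_diff tendsto_const)
      moreover have "poisson_integral \<rho> (TJ J) x = poisson_integral \<rho> T x - poisson_integral \<rho> (hankel (R J) F) x" for J
      proof -
        have "TJ J = (\<lambda>x. T x - hankel (R J) F x)" using Tsplit[of _ J] by (auto simp: fun_eq_iff)
        then show ?thesis using poisson_integral_lincomb(2)[OF iT iR \<rho>] by simp
      qed
      ultimately show ?thesis by simp
    qed
    define Q where "Q J x = (\<integral>\<^sup>+t. ennreal (Psi \<mu> (profile q A f J t) (chord (x - t))) \<partial>circ)" for J x
    note prof = profile[OF f A q(1)]
    have QJ: "ennreal ((norm (poisson_integral \<rho> (TJ J) x) / K) powr p) \<le> ennreal C2 * Q J x" if \<rho>: "0 \<le> \<rho>" "\<rho> < 1" for \<rho> J x
    proof -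
      define w where "w = norm (poisson_integral \<rho> (TJ J) x) / K"
      have kw: "ennreal (K * w) \<le> ennreal K * (\<integral>\<^sup>+t. ennreal (Phi p \<mu> (profile q A f J t) (chord (x - t))) \<partial>circ)"
        using tr[rule_format, of f A "C1 * L" c \<rho> J x] f A L C1 c \<rho> K
        by (simp add: w_def K_def TJ_def[abs_def] F_def)
      have "ennreal (K * w) = ennreal K * ennreal w" using K by (intro ennreal_mult) (auto simp: w_def)
      note kw[unfolded this]
      then have "ennreal w \<le> (\<integral>\<^sup>+t. ennreal (Phi p \<mu> (profile q A f J t) (chord (x - t))) \<partial>circ)"
        using K by (subst (asm) ennreal_mult_le_mult_iff) auto
      then show ?thesis using pp[rule_format, of "profile q A f J" w x] prof K by (simp add: w_def Q_def)
    qed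
    have Qm: "Q J \<in> borel_measurable circ" for J
    proof -
      have [measurable]: "(\<lambda>z. profile q A f J (snd z)) \<in> borel_measurable (circ \<Otimes>\<^sub>M circ)" "(\<lambda>z. chord (fst z - snd z)) \<in> borel_measurable (circ \<Otimes>\<^sub>M circ)"
        using prof(1)[of J] by measurable
      show ?thesis unfolding Q_def[abs_def]
        by (intro circ.borel_measurable_nn_integral) (simp add: case_prod_unfold borel_Psi)
    qed
    have Qint: "(\<integral>\<^sup>+x. Q J x \<partial>circ) \<le> ennreal C3" for J
    proof -
      have "(\<integral>\<^sup>+x. Q J x \<partial>circ) \<le> ennreal C3 * (\<integral>\<^sup>+t. ennreal (profile q A f J t) \<partial>circ)"
        using pi3[rule_format, of "profile q A f J"] prof by (simp add: Q_def)
      also have "\<dots> \<le> ennreal C3 * 1" by (intro mult_left_mono prof) auto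
      finally show ?thesis by simp
    qed
    define Z where "Z x = ennreal (K powr p) * liminf (\<lambda>J. ennreal C2 * Q J x)" for x
    have point: "ennreal (norm (poisson_integral \<rho> T x) powr p) \<le> Z x" if \<rho>: "0 \<le> \<rho>" "\<rho> < 1" for \<rho> x
    proof -
      let ?w = "\<lambda>J. (norm (poisson_integral \<rho> (TJ J) x) / K) powr p"
      have "?w \<longlonglongrightarrow> (norm (poisson_integral \<rho> T x) / K) powr p"
        using K p by (intro tendsto_powr' tendsto_divide tendsto_norm lim[OF \<rho>] tendsto_const) auto
      then have "(\<lambda>J. ennreal (?w J)) \<longlonglongrightarrow> ennreal ((norm (poisson_integral \<rho> T x) / K) powr p)"
        by (rule tendsto_ennrealI)
      then have "ennreal ((norm (poisson_integral \<rho> T x) / K) powr p) = liminf (\<lambda>J. ennreal (?w J))"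
        by (intro lim_imp_Liminf[symmetric]) auto
      also have "\<dots> \<le> liminf (\<lambda>J. ennreal C2 * Q J x)" by (intro Liminf_mono always_eventually allI QJ[OF \<rho>])
      finally have "ennreal (K powr p) * ennreal ((norm (poisson_integral \<rho> T x) / K) powr p) \<le> Z x"
        unfolding Z_def by (rule mult_left_mono) simp
      then show ?thesis using K by (simp add: ennreal_mult[symmetric] powr_divide)
    qed
    have "(\<integral>\<^sup>+x. ennreal_powr (poisson_maximal T x) p \<partial>circ) \<le> (\<integral>\<^sup>+x. Z x \<partial>circ)"
      unfolding poisson_maximal_def
      by (intro nn_integral_mono ennreal_powr_SUP_le point) (use p in auto)
    also have "\<dots> = ennreal (K powr p) * (\<integral>\<^sup>+x. liminf (\<lambda>J. ennreal C2 * Q J x) \<partial>circ)"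
    proof -
      note [measurable] = Qm
      show ?thesis unfolding Z_def by (intro nn_integral_cmult) measurable
    qed
    also have "\<dots> \<le> ennreal (K powr p) * (ennreal C2 * ennreal C3)"
    proof (rule mult_left_mono)
      note [measurable] = Qm
      have "(\<integral>\<^sup>+x. liminf (\<lambda>J. ennreal C2 * Q J x) \<partial>circ) \<le> liminf (\<lambda>J. \<integral>\<^sup>+x. ennreal C2 * Q J x \<partial>circ)"
        by (rule nn_integral_liminf) measurable
      also have "\<dots> \<le> liminf (\<lambda>J::nat. ennreal C2 * ennreal C3)"
      proof (intro Liminf_mono always_eventually allI)
        show "(\<integral>\<^sup>+x. ennreal C2 * Q J x \<partial>circ) \<le> ennreal C2 * ennreal C3" for J
          using Qint[of J] by (simp add: nn_integral_cmult mult_left_mono)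
      qed
      finally show "(\<integral>\<^sup>+x. liminf (\<lambda>J. ennreal C2 * Q J x) \<partial>circ) \<le> ennreal C2 * ennreal C3" by (simp add: Liminf_const)
    qed simp
    also have "\<dots> = ennreal (K powr p * (C2 * C3))" using C2 C3 by (simp add: ennreal_mult)
    finally have I: "(\<integral>\<^sup>+x. ennreal_powr (poisson_maximal T x) p \<partial>circ) \<le> ennreal (K powr p * (C2 * C3))" (is "?I \<le> _") .
    then have fin: "?I \<noteq> \<infinity>" by (auto simp: top_unique)
    have "hardy_norm p T = ennreal (enn2real ?I powr (1/p))"
      using fin by (simp add: hardy_norm_def nn_set_integral_circ ennreal_powr_def)
    also have "\<dots> \<le> ennreal ((K powr p * (C2 * C3)) powr (1/p))"
      using I p C2 C3 by (intro ennreal_leI powr_mono2 enn2real_leI) auto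
    also have "(K powr p * (C2 * C3)) powr (1/p) = C * A * L"
      using D A(2) C1 L p C2 C3 by (simp add: powr_mult powr_powr C_def K_def)
    finally show ?thesis by (simp add: hankel_tilde_conv T_def F_def)
  qed
  with C show ?thesis by blast
qed

lemma chord_lipschitz_smooth:
  assumes "smooth b" and per: "\<And>x. b (x + 2 * pi) = b x"
  obtains \<Lambda> where "chord_lipschitz \<Lambda> b"
proof -
  let ?b' = "\<lambda>x. vector_derivative b (at x)"
  have "((\<lambda>u x. vector_derivative u (at x)) ^^ 0) b differentiable_on UNIV"
    "((\<lambda>u x. vector_derivative u (at x)) ^^ 1) b differentiable_on UNIV"
    using assms(1) unfolding smooth_def by blast+
  then have d: "b differentiable_on UNIV" and d': "?b' differentiable_on UNIV" by simp_all
  have hd: "(b has_vector_derivative ?b' x) (at x)" for x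
    using d by (simp add: differentiable_on_def vector_derivative_works)
  have "bounded (?b' ` {-pi..3*pi})"
    using differentiable_imp_continuous_on[OF d']
    by (intro compact_imp_bounded compact_continuous_image) (auto intro: continuous_on_subset)
  then obtain B where "B > 0" "\<forall>y\<in>?b' ` {-pi..3*pi}. norm y \<le> B" unfolding bounded_pos by blast
  then have B: "B > 0" "\<And>x. x \<in> {-pi..3*pi} \<Longrightarrow> norm (?b' x) \<le> B" by auto
  have lip: "norm (b x - b y) \<le> B * \<bar>x - y\<bar>" if "x \<in> {-pi..3*pi}" "y \<in> {-pi..3*pi}" for x y
  proof -
    have "norm (b x - b y) \<le> B * norm (x - y)"
    proof (rule differentiable_bound[of "{-pi..3*pi}" b "\<lambda>x h. h *\<^sub>R ?b' x"])
      show "(b has_derivative (\<lambda>h. h *\<^sub>R ?b' x)) (at x within {-pi..3*pi})" if "x \<in> {-pi..3*pi}" for x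
        using hd[of x] by (simp add: has_vector_derivative_def has_derivative_at_withinI)
      show "onorm (\<lambda>h. h *\<^sub>R ?b' x) \<le> B" if "x \<in> {-pi..3*pi}" for x
        using mult_right_mono[OF B(2)[OF that] abs_ge_zero] by (intro onorm_le) (simp add: mult.commute)
    qed (use that in auto)
    then show ?thesis by simp
  qed
  have "norm (b x - b y) \<le> (B * pi) * chord (x - y)" for x y
  proof -
    obtain n :: int and r where n: "y - x + pi = r + of_int n * (2 * pi)" "0 \<le> r" "r < 2 * pi" by (rule reduce_period)
    obtain m :: int and s where m: "x = s + of_int m * (2 * pi)" "0 \<le> s" "s < 2 * pi" by (rule reduce_period)
    define y' where "y' = s + (r - pi)"
    have y: "y = y' + of_int (n + m) * (2 * pi)" using n m by (simp add: y'_def algebra_simps)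
    have bx: "b x = b s" "b y = b y'" using periodic_int[of b s m, OF per] periodic_int[of b y' "n + m", OF per] m(1) y by (simp_all only:)
    have ch: "chord (x - y) = chord (s - y')"
    proof -
      have "x - y = (s - y') + of_int (- n) * (2 * pi)" using m(1) y by (simp add: algebra_simps)
      then show ?thesis using periodic_int[of chord "s - y'" "-n", OF chord_periodic] by simp
    qed
    have "norm (b s - b y') \<le> B * \<bar>s - y'\<bar>" using m n by (intro lip) (auto simp: y'_def)
    also have "\<dots> \<le> B * (pi * chord (s - y'))"
    proof (intro mult_left_mono)
      have "\<bar>s - y'\<bar> \<le> pi" using n by (auto simp: y'_def)
      from chord_ge[OF this] show "\<bar>s - y'\<bar> \<le> pi * chord (s - y')" by (simp add: divide_le_eq mult.commute)
    qed (use B in simp)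
    finally show ?thesis by (simp add: bx ch mult.assoc)
  qed
  then show ?thesis by (intro that[of "B * pi"]) (simp add: chord_lipschitz_def)
qed

lemma borel_poisson_maximal:
  assumes f: "integrable circ f" shows "poisson_maximal f \<in> borel_measurable borel"
proof (rule borel_measurableI_greater)
  fix y
  have "{x \<in> space borel. y < poisson_maximal f x} = (\<Union>\<rho>\<in>{0..<1}. {x. y < ennreal (norm (poisson_integral \<rho> f x))})"
    by (auto simp: poisson_maximal_def less_SUP_iff)
  also have "open \<dots>"
  proof (intro open_UN ballI open_Collect_less continuous_on_const)
    fix \<rho> :: real assume "\<rho> \<in> {0..<1}"
    then have "continuous_on UNIV (poisson_integral \<rho> f)" by (intro cper_cont cper_poisson_integral f) auto
    then show "continuous_on UNIV (\<lambda>x. ennreal (norm (poisson_integral \<rho> f x)))"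
      by (intro continuous_on_ennreal continuous_on_norm)
  qed
  finally show "{x \<in> space borel. y < poisson_maximal f x} \<in> sets borel" by simp
qed

text \<open>
  Pointwise \<open>y powr q \<le> 1 + y powr p\<close>, and the torus has finite measure.
\<close>
lemma hardy_norm_finite_mono:
  assumes f: "integrable circ f" and q: "0 < q" "q < p" and fin: "hardy_norm p f < \<infinity>"
  shows "hardy_norm q f < \<infinity>"
proof -
  let ?m = "poisson_maximal f"
  have [measurable]: "?m \<in> borel_measurable circ" by (intro borel_measurable_circ borel_poisson_maximal f)
  have [measurable]: "(\<lambda>x. ennreal_powr (?m x) p) \<in> borel_measurable circ" unfolding ennreal_powr_def by measurable
  have le: "ennreal_powr y q \<le> 1 + ennreal_powr y p" for y
  proof (cases y)
    case (real r)
    have "r powr q \<le> 1 + r powr p"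
    proof (cases "r \<le> 1")
      case True then show ?thesis using real q powr_mono2[of q r 1] by (simp add: add_increasing2)
    next
      case False
      then have "r powr q \<le> r powr p" using q by (intro powr_mono) auto
      then show ?thesis by simp
    qed
    then show ?thesis using real by (simp add: ennreal_powr_def ennreal_plus[symmetric] ennreal_leI del: ennreal_plus flip: ennreal_1)
  qed (simp add: ennreal_powr_def)
  have fp: "(\<integral>\<^sup>+x. ennreal_powr (?m x) p \<partial>circ) < \<infinity>"
    using fin by (auto simp: hardy_norm_def nn_set_integral_circ ennreal_powr_def less_top split: if_splits)
  have "(\<integral>\<^sup>+x. ennreal_powr (?m x) q \<partial>circ) \<le> (\<integral>\<^sup>+x. 1 + ennreal_powr (?m x) p \<partial>circ)"
    by (intro nn_integral_mono le)
  also have "\<dots> = emeasure circ (space circ) + (\<integral>\<^sup>+x. ennreal_powr (?m x) p \<partial>circ)"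
    by (simp add: nn_integral_add)
  also have "\<dots> < \<infinity>" using fp unfolding emeasure_circ by simp
  finally show ?thesis by (auto simp: hardy_norm_def nn_set_integral_circ ennreal_powr_def less_top)
qed

theorem theorem3:
  fixes p q \<alpha> :: real
  assumes "1 < p" and "0 < q" and "q < p" and "\<alpha> = 1 / q - 1 / p"
  shows "\<exists>C::real. C > 0 \<and>
    (\<forall>b f. smooth b \<and> b \<in> lipschitz_space \<alpha> \<and> f \<in> hardy_space p \<longrightarrow>
       hankel_tilde b f \<in> hardy_space p \<and>
       hardy_norm p (hankel_tilde b f) \<le> ennreal C * hardy_norm q f * lipschitz_norm \<alpha> b)"
proof -
  from hankel_estimate[OF assms] obtain C where C: "C > 0" and
    est: "\<forall>b f A L \<Lambda>. cper b \<and> chord_lipschitz \<Lambda> b \<and> lipschitz_norm \<alpha> b \<le> ennreal L \<and> 0 < L \<and>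
     integrable circ f \<and> (\<forall>x. f (x + 2 * pi) = f x) \<and> hardy_norm q f \<le> ennreal A \<and> 0 < A \<longrightarrow>
     hardy_norm p (hankel_tilde b f) \<le> ennreal (C * A * L)"
    by (elim exE conjE) (rule that)
  have "hankel_tilde b f \<in> hardy_space p \<and>
       hardy_norm p (hankel_tilde b f) \<le> ennreal C * hardy_norm q f * lipschitz_norm \<alpha> b"
    if sb: "smooth b" and lb: "b \<in> lipschitz_space \<alpha>" and hf: "f \<in> hardy_space p" for b f
  proof -
    have bper: "b (x + 2 * pi) = b x" for x
      using lb by (simp add: lipschitz_space_def periodic_fun_simple_def)
    have b: "cper b" using lb bper by (simp add: lipschitz_space_def cper_def)
    obtain \<Lambda> where \<Lambda>: "chord_lipschitz \<Lambda> b" using chord_lipschitz_smooth[OF sb bper] .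
    have f: "integrable circ f" "\<And>x. f (x + 2 * pi) = f x" "hardy_norm p f < \<infinity>"
      using hf by (auto simp: hardy_space_def periodic_fun_simple_def integrable_circ_iff)
    define L where "L = enn2real (lipschitz_norm \<alpha> b)"
    define A where "A = enn2real (hardy_norm q f)"
    have L: "lipschitz_norm \<alpha> b = ennreal L" "0 \<le> L"
      using lb by (auto simp: L_def lipschitz_space_def)
    have A: "hardy_norm q f = ennreal A" "0 \<le> A"
      using hardy_norm_finite_mono[OF f(1) assms(2,3) f(3)] by (auto simp: A_def)
    let ?h = "hardy_norm p (hankel_tilde b f)"
    \<comment> \<open>The estimate is for positive majorants of the norms; either norm may vanish.\<close>
    have bound: "?h \<le> ennreal (C * (A + inverse (real (Suc n))) * (L + inverse (real (Suc n))))" for n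
      using est[rule_format, of b \<Lambda> "L + inverse (real (Suc n))" f "A + inverse (real (Suc n))"] b \<Lambda> f L A
      by (simp add: add_nonneg_pos ennreal_leI)
    have "(\<lambda>n. ennreal (C * (A + inverse (real (Suc n))) * (L + inverse (real (Suc n))))) \<longlonglongrightarrow> ennreal (C * (A + 0) * (L + 0))"
      by (intro tendsto_ennrealI tendsto_mult tendsto_add tendsto_const LIMSEQ_inverse_real_of_nat)
    then have "?h \<le> ennreal (C * (A + 0) * (L + 0))"
      by (rule LIMSEQ_le_const) (use bound in blast)
    then have h: "?h \<le> ennreal C * hardy_norm q f * lipschitz_norm \<alpha> b"
      using A L C by (simp add: ennreal_mult)
    moreover have "hankel_tilde b f \<in> hardy_space p"
    proof -
      have "integrable circ (hankel_tilde b f)"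
        unfolding hankel_tilde_conv by (rule integrable_hankel[OF cper_borel[OF b] \<Lambda> integrable_circ_double[OF f(1,2)]])
      moreover have "hankel_tilde b f (x + 2 * pi) = hankel_tilde b f x" for x
      proof -
        have "hker b (x + 2 * pi) t = hker b x t" for t
        proof -
          have "b (x + 2 * pi + t) = b (x + t)" "b (2 * (x + 2 * pi)) = b (2 * x)"
            using bper[of "x + t"] bper[of "2 * x"] bper[of "2 * x + 2 * pi"] by (simp_all add: algebra_simps)
          moreover have "tan ((x + 2 * pi - t) / 2) = tan ((x - t) / 2)"
            using tan_periodic_pi[of "(x - t) / 2"] by (simp add: field_simps)
          ultimately show ?thesis by (simp add: hker_def)
        qed
        then show ?thesis by (simp add: hankel_tilde_conv hankel_def)
      qed
      moreover have "?h < \<infinity>" using h A L C by (auto simp: ennreal_mult[symmetric] less_top[symmetric] top_unique)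
      ultimately show ?thesis by (simp add: hardy_space_def periodic_fun_simple_def integrable_circ_iff)
    qed
    ultimately show ?thesis by blast
  qed
  with C show ?thesis by blast
qed

end
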